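(* Let $\Gamma\subset\mathbb{Q}^*$ be a finitely generated subgroup, let $A=\prod_p A_p$ and $G\subset A$ be as in the context, and let $\nu=\prod_p\nu_p$ be the product Haar measure on $A$. Let $S=\prod_p S_p\subset A$ be a product of $\nu_p$-measurable subsets $S_p\subset A_p$ with $\nu_p(S_p)>0$ for all primes $p$. Then $$\delta(S)=\frac{\nu(G\cap S)}{\nu(G)}=E\cdot\frac{\nu(S)}{\nu(A)},\qquad E=\sum_{\chi\in X}\prod_p E_{\chi,p},\qquad E_{\chi,p}=\frac{1}{\nu_p(S_p)}\int_{S_p}\chi_p\,d\nu_p,$$ where $X=\mathrm{Hom}(A/G,\mu_2)$ and, for $\chi\in X$ (viewed as a character of $A$), $\chi=\prod_p\chi_p$ is its decomposition into characters $\chi_p$ of $A_p$ (so $E_{\chi,p}$ is the average value of $\chi_p$ on $S_p$).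
   Context: Put $\Gamma_\infty=\{x\in\mathbb{C}^*: x^n\in\Gamma$ for some $n\ge1\}$ and, for a prime $p$, $\Gamma_{p^\infty}=\{x\in\mathbb{C}^*: x^{p^n}\in\Gamma$ for some $n\ge1\}$. Let $A=\mathrm{Aut}_{\Gamma_\infty\cap\mathbb{Q}^*}(\Gamma_\infty)$ be the profinite group of group automorphisms of $\Gamma_\infty$ fixing $\Gamma_\infty\cap\mathbb{Q}^*$ pointwise, and $A_p=\mathrm{Aut}_{\Gamma_{p^\infty}\cap\mathbb{Q}^*}(\Gamma_{p^\infty})$; restriction gives a natural isomorphism $A\cong\prod_p A_p$. $G=\mathrm{Gal}(\mathbb{Q}(\Gamma_\infty)/\mathbb{Q})$ is viewed as a subgroup of $A$ by restricting field automorphisms to $\Gamma_\infty$; it is a normal subgroup of finite index with $A/G$ an elementary abelian $2$-group. $\nu_p$ is the Haar measure on $A_p$ normalized by $\nu_p(A_p)=1$. Every continuous character $\chi:A\to\mu_2=\{\pm1\}$ trivial on $G$ factors uniquely as a product $\chi=\prod_p\chi_p$ with $\chi_p:A\to A_p\to\mu_2$ and $\chi_p$ trivial for all but finitely many $p$; so the product $\prod_pE_{\chi,p}$ has only finitely many factors different from $1$. *)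

theory Defs
  imports
    "HOL-Probability.Probability"
    "HOL-Computational_Algebra.Primes"
    "HOL-Algebra.Algebra"
    "HOL-Algebra.Algebraic_Closure_Type"
begin

hide_const (open) Divisibility.prime

abbreviation complex_field :: "complex ring" where
  "complex_field \<equiv> ring_of_type_algebra"

abbreviation complex_units :: "complex monoid" where
  "complex_units \<equiv> Multiplicative_Group.mult_of complex_field"

definition radicals :: "complex set \<Rightarrow> complex set" where
  "radicals \<Gamma> = {x. x \<noteq> 0 \<and> (\<exists>n\<ge>1. x ^ n \<in> \<Gamma>)}"

definition p_radicals :: "complex set \<Rightarrow> nat \<Rightarrow> complex set" where
  "p_radicals \<Gamma> p = {x. x \<noteq> 0 \<and> (\<exists>n\<ge>1. x ^ (p ^ n) \<in> \<Gamma>)}"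

text \<open>The automorphisms of a subgroup \<open>M\<close> of the multiplicative group of complex numbers that
  fix \<open>M \<inter> \<rat>\<close> pointwise. As in \<^const>\<open>AutoGroup\<close>, they are functions on \<open>M\<close>, extended by
  \<^const>\<open>undefined\<close>.\<close>

definition aut_fixing_rats :: "complex set \<Rightarrow> (complex \<Rightarrow> complex) monoid" where
  "aut_fixing_rats M = (let H = complex_units\<lparr>carrier := M\<rparr> in
     (AutoGroup H)\<lparr>carrier := {\<sigma> \<in> auto H. \<forall>x\<in>M \<inter> \<rat>. \<sigma> x = x}\<rparr>)"

definition local_aut :: "complex set \<Rightarrow> nat \<Rightarrow> (complex \<Rightarrow> complex) monoid" where
  "local_aut \<Gamma> p = aut_fixing_rats (p_radicals \<Gamma> p)"

text \<open>The profinite topology of \<open>A\<^sub>p\<close> is the topology of pointwise convergence for the discrete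
  topology on \<open>p_radicals \<Gamma> p\<close>.\<close>

definition local_topology :: "complex set \<Rightarrow> nat \<Rightarrow> (complex \<Rightarrow> complex) topology" where
  "local_topology \<Gamma> p =
     subtopology (product_topology (\<lambda>_. discrete_topology (p_radicals \<Gamma> p)) (p_radicals \<Gamma> p))
       (carrier (local_aut \<Gamma> p))"

text \<open>The group \<open>A\<close>, as the product of the groups \<open>A\<^sub>p\<close>. The natural isomorphism from
  \<open>aut_fixing_rats (radicals \<Gamma>)\<close> onto it is \<open>prime_components \<Gamma>\<close>, and the Galois group is
  viewed inside the product by means of this map.\<close>

definition global_aut :: "complex set \<Rightarrow> (nat \<Rightarrow> complex \<Rightarrow> complex) monoid" where
  "global_aut \<Gamma> = product_group {p. prime p} (local_aut \<Gamma>)"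

definition prime_components :: "complex set \<Rightarrow> (complex \<Rightarrow> complex) \<Rightarrow> nat \<Rightarrow> complex \<Rightarrow> complex" where
  "prime_components \<Gamma> \<sigma> = (\<lambda>p\<in>{p. prime p}. restrict \<sigma> (p_radicals \<Gamma> p))"

definition radical_field :: "complex set \<Rightarrow> complex ring" where
  "radical_field \<Gamma> = complex_field\<lparr>carrier := generate_field complex_field (radicals \<Gamma>)\<rparr>"

definition galois_automorphisms :: "complex set \<Rightarrow> (complex \<Rightarrow> complex) set" where
  "galois_automorphisms \<Gamma> =
     {\<sigma> \<in> ring_iso (radical_field \<Gamma>) (radical_field \<Gamma>). \<forall>q\<in>\<rat>. \<sigma> q = q}"

definition galois_on_radicals :: "complex set \<Rightarrow> (complex \<Rightarrow> complex) set" where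
  "galois_on_radicals \<Gamma> = (\<lambda>\<sigma>. restrict \<sigma> (radicals \<Gamma>)) ` galois_automorphisms \<Gamma>"

definition galois_subgroup :: "complex set \<Rightarrow> (nat \<Rightarrow> complex \<Rightarrow> complex) set" where
  "galois_subgroup \<Gamma> = prime_components \<Gamma> ` galois_on_radicals \<Gamma>"

text \<open>The completed Haar measure of total mass 1 on a compact group \<open>G\<close> with topology \<open>T\<close>: the
  completion of a left invariant Borel probability measure. No regularity condition is needed
  for second countable \<open>T\<close>, such as \<open>local_topology \<Gamma> p\<close> for countable \<open>\<Gamma>\<close>.\<close>

definition normalized_haar_measure ::
    "('a, 'b) monoid_scheme \<Rightarrow> 'a topology \<Rightarrow> 'a measure \<Rightarrow> bool" where
  "normalized_haar_measure G T \<nu> \<longleftrightarrow>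
     (\<exists>\<mu>. space \<mu> = carrier G \<and>
          sets \<mu> = sigma_sets (carrier G) {U. openin T U} \<and>
          emeasure \<mu> (carrier G) = 1 \<and>
          (\<forall>g\<in>carrier G. \<forall>B\<in>sets \<mu>. emeasure \<mu> (g <#\<^bsub>G\<^esub> B) = emeasure \<mu> B) \<and>
          \<nu> = completion \<mu>)"

definition mu2 :: "real monoid" where
  "mu2 = \<lparr>carrier = {1, -1}, monoid.mult = (*), one = 1\<rparr>"

text \<open>\<open>X = Hom(A/G, \<mu>\<^sub>2)\<close>. Since \<^const>\<open>hom\<close> does not constrain values outside the carrier,
  extensionality is needed to count each homomorphism once. Continuity is automatic, as
  \<open>A/G\<close> is finite and \<open>G\<close> is closed.\<close>

definition quotient_characters :: "complex set \<Rightarrow> ((nat \<Rightarrow> complex \<Rightarrow> complex) set \<Rightarrow> real) set" where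
  "quotient_characters \<Gamma> =
     (let Q = global_aut \<Gamma> Mod galois_subgroup \<Gamma> in hom Q mu2 \<inter> extensional (carrier Q))"

definition inflate ::
    "complex set \<Rightarrow> ((nat \<Rightarrow> complex \<Rightarrow> complex) set \<Rightarrow> real) \<Rightarrow> (nat \<Rightarrow> complex \<Rightarrow> complex) \<Rightarrow> real" where
  "inflate \<Gamma> chi a = chi (galois_subgroup \<Gamma> #>\<^bsub>global_aut \<Gamma>\<^esub> a)"

definition local_characters :: "complex set \<Rightarrow> nat \<Rightarrow> ((complex \<Rightarrow> complex) \<Rightarrow> real) set" where
  "local_characters \<Gamma> p =
     {\<psi> \<in> hom (local_aut \<Gamma> p) mu2 \<inter> extensional (carrier (local_aut \<Gamma> p)).
        continuous_map (local_topology \<Gamma> p) (discrete_topology (carrier mu2)) \<psi>}"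

definition character_decomposition ::
    "complex set \<Rightarrow> ((nat \<Rightarrow> complex \<Rightarrow> complex) \<Rightarrow> real) \<Rightarrow> (nat \<Rightarrow> (complex \<Rightarrow> complex) \<Rightarrow> real) \<Rightarrow> bool" where
  "character_decomposition \<Gamma> chi \<psi> \<longleftrightarrow>
     \<psi> \<in> (\<Pi>\<^sub>E p\<in>{p. prime p}. local_characters \<Gamma> p) \<and>
     (let P = {p. prime p \<and> (\<exists>a\<in>carrier (local_aut \<Gamma> p). \<psi> p a \<noteq> 1)} in
        finite P \<and> (\<forall>a\<in>carrier (global_aut \<Gamma>). chi a = (\<Prod>p\<in>P. \<psi> p (a p))))"

definition character_component ::
    "complex set \<Rightarrow> ((nat \<Rightarrow> complex \<Rightarrow> complex) \<Rightarrow> real) \<Rightarrow> nat \<Rightarrow> (complex \<Rightarrow> complex) \<Rightarrow> real" where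
  "character_component \<Gamma> chi = (THE \<psi>. character_decomposition \<Gamma> chi \<psi>)"

definition local_average ::
    "complex set \<Rightarrow> (nat \<Rightarrow> (complex \<Rightarrow> complex) measure) \<Rightarrow> (nat \<Rightarrow> (complex \<Rightarrow> complex) set) \<Rightarrow>
     ((nat \<Rightarrow> complex \<Rightarrow> complex) set \<Rightarrow> real) \<Rightarrow> nat \<Rightarrow> real" where
  "local_average \<Gamma> \<nu> S chi p =
     1 / measure (\<nu> p) (S p) * (LINT a:S p|\<nu> p. character_component \<Gamma> (inflate \<Gamma> chi) p a)"

text \<open>Only finitely many factors of the product over all primes differ from 1; the product is
  taken over these.\<close>

definition correction_factor ::
    "complex set \<Rightarrow> (nat \<Rightarrow> (complex \<Rightarrow> complex) measure) \<Rightarrow> (nat \<Rightarrow> (complex \<Rightarrow> complex) set) \<Rightarrow> real" where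
  "correction_factor \<Gamma> \<nu> S =
     (\<Sum>chi\<in>quotient_characters \<Gamma>.
        \<Prod>p | prime p \<and> local_average \<Gamma> \<nu> S chi p \<noteq> 1. local_average \<Gamma> \<nu> S chi p)"

text \<open>\<open>\<delta>(S)\<close>, for a measure \<open>\<nu>\<close> on \<open>A\<close> and subsets \<open>G\<close> and \<open>S\<close> of \<open>A\<close>.\<close>

definition relative_density :: "'a measure \<Rightarrow> 'a set \<Rightarrow> 'a set \<Rightarrow> real" where
  "relative_density \<nu> G S = measure \<nu> (G \<inter> S) / measure \<nu> G"

end

theory Submission
  imports Defs "HOL-Number_Theory.Residues"
begin

text \<open>
  Let \<open>L\<close> be the field generated by all roots of unity and \<open>B\<close> the group of radicals lying in \<open>L\<close>.
  As cyclotomic polynomials are irreducible, every \<open>\<sigma>\<close> in \<open>A\<close> agrees on the roots of unity with an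
  automorphism of \<open>L\<close>; on \<open>B\<close> the two differ by a sign, because the square of an element of \<open>B\<close> is
  rational up to a root of unity. Radicals in distinct classes modulo \<open>B\<close> are linearly independent
  over \<open>L\<close>, so \<open>\<sigma>\<close> extends to a field automorphism if and only if all these signs are trivial.
  Modulo rationals and roots of unity \<open>B\<close> is finite, hence \<open>G\<close> is the common kernel of finitely many
  continuous sign characters of \<open>A\<close>. Therefore the indicator function of \<open>G\<close> is the mean of the
  characters in \<open>X\<close>. Integrating it over \<open>S\<close> gives a sum of products of local integrals; for \<open>S = A\<close>
  only the trivial character contributes, by invariance of the Haar measures.
\<close>

hide_const (open) UnivPoly.coeff UnivPoly.monom module.smult
  Polynomials.degree Polynomials.lead_coeff

section \<open>Extending homomorphisms of subfields of the complex numbers\<close>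

definition subfield_set :: "'a::field set \<Rightarrow> bool" where
  "subfield_set F \<longleftrightarrow> 0 \<in> F \<and> 1 \<in> F \<and> (\<forall>x\<in>F. \<forall>y\<in>F. x - y \<in> F \<and> x * y \<in> F) \<and> (\<forall>x\<in>F. inverse x \<in> F)"

definition subring_set :: "'a::field set \<Rightarrow> bool" where
  "subring_set F \<longleftrightarrow> 0 \<in> F \<and> 1 \<in> F \<and> (\<forall>x\<in>F. \<forall>y\<in>F. x - y \<in> F \<and> x * y \<in> F)"

definition hom_on :: "'a::field set \<Rightarrow> ('a \<Rightarrow> 'a) \<Rightarrow> bool" where
  "hom_on F \<sigma> \<longleftrightarrow> \<sigma> 1 = 1 \<and> (\<forall>x\<in>F. \<forall>y\<in>F. \<sigma> (x + y) = \<sigma> x + \<sigma> y \<and> \<sigma> (x * y) = \<sigma> x * \<sigma> y)"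

definition poly_over :: "'a::zero set \<Rightarrow> 'a poly \<Rightarrow> bool" where
  "poly_over F p \<longleftrightarrow> (\<forall>i. coeff p i \<in> F)"

lemma subfield_set_imp_subring_set: "subfield_set F \<Longrightarrow> subring_set F"
  by (simp add: subfield_set_def subring_set_def)

lemma subring_set_closed:
  assumes "subring_set F"
  shows "0 \<in> F" "1 \<in> F" "x \<in> F \<Longrightarrow> y \<in> F \<Longrightarrow> x - y \<in> F"
    "x \<in> F \<Longrightarrow> y \<in> F \<Longrightarrow> x * y \<in> F" "x \<in> F \<Longrightarrow> - x \<in> F"
    "x \<in> F \<Longrightarrow> y \<in> F \<Longrightarrow> x + y \<in> F" "x \<in> F \<Longrightarrow> x ^ n \<in> F"
proof -
  have neg: "- y \<in> F" if "y \<in> F" for y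
    using assms that unfolding subring_set_def by (metis diff_0)
  show "0 \<in> F" "1 \<in> F" "x \<in> F \<Longrightarrow> y \<in> F \<Longrightarrow> x - y \<in> F" "x \<in> F \<Longrightarrow> y \<in> F \<Longrightarrow> x * y \<in> F"
    using assms by (auto simp: subring_set_def)
  show "x \<in> F \<Longrightarrow> - x \<in> F" by (rule neg)
  show "x \<in> F \<Longrightarrow> y \<in> F \<Longrightarrow> x + y \<in> F"
    using assms neg unfolding subring_set_def by (metis diff_minus_eq_add)
  show "x \<in> F \<Longrightarrow> x ^ n \<in> F"
    by (induction n) (use assms in \<open>auto simp: subring_set_def\<close>)
qed

lemma subring_set_sum: "subring_set F \<Longrightarrow> (\<And>i. i \<in> I \<Longrightarrow> f i \<in> F) \<Longrightarrow> sum f I \<in> F"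
  by (induction I rule: infinite_finite_induct) (auto simp: subring_set_closed)

lemma subfield_set_inverse: "subfield_set F \<Longrightarrow> x \<in> F \<Longrightarrow> inverse x \<in> F"
  by (simp add: subfield_set_def)

lemma subfield_set_divide: "subfield_set F \<Longrightarrow> x \<in> F \<Longrightarrow> y \<in> F \<Longrightarrow> x / y \<in> F"
  by (simp add: subfield_set_def divide_inverse)

lemma hom_on_0: "subring_set F \<Longrightarrow> hom_on F \<sigma> \<Longrightarrow> \<sigma> 0 = 0"
  using subring_set_closed(1)[of F] unfolding hom_on_def by (metis add_cancel_left_left)

lemma hom_on_simps:
  assumes "hom_on F \<sigma>"
  shows "\<sigma> 1 = 1" "x \<in> F \<Longrightarrow> y \<in> F \<Longrightarrow> \<sigma> (x + y) = \<sigma> x + \<sigma> y"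
    "x \<in> F \<Longrightarrow> y \<in> F \<Longrightarrow> \<sigma> (x * y) = \<sigma> x * \<sigma> y"
  using assms by (auto simp: hom_on_def)

lemma hom_on_diff:
  assumes "subring_set F" "hom_on F \<sigma>" "x \<in> F" "y \<in> F"
  shows "\<sigma> (x - y) = \<sigma> x - \<sigma> y"
proof -
  have "\<sigma> x = \<sigma> (x - y) + \<sigma> y"
    using hom_on_simps(2)[OF assms(2), of "x - y" y] assms subring_set_closed(3)[of F x y] by simp
  then show ?thesis by simp
qed

lemma hom_on_sum:
  assumes "subring_set F" "hom_on F \<sigma>" "\<And>i. i \<in> I \<Longrightarrow> f i \<in> F"
  shows "\<sigma> (sum f I) = (\<Sum>i\<in>I. \<sigma> (f i))"
  using assms(3)
proof (induction I rule: infinite_finite_induct)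
  case (insert x I)
  then show ?case
    using hom_on_simps(2)[OF assms(2), of "f x" "sum f I"] subring_set_sum[OF assms(1), of I f] by simp
qed (use hom_on_0[OF assms(1,2)] in auto)

lemma hom_on_power:
  assumes "subring_set F" "hom_on F \<sigma>" "x \<in> F"
  shows "\<sigma> (x ^ n) = \<sigma> x ^ n"
  by (induction n) (use assms hom_on_simps[OF assms(2)] subring_set_closed(7)[OF assms(1)] in auto)

lemma hom_on_eq_0_iff:
  assumes "subfield_set F" "hom_on F \<sigma>" "x \<in> F"
  shows "\<sigma> x = 0 \<longleftrightarrow> x = 0"
proof
  assume "\<sigma> x = 0"
  show "x = 0"
  proof (rule ccontr)
    assume "x \<noteq> 0"
    then have "\<sigma> x * \<sigma> (inverse x) = 1"
      using hom_on_simps(3)[OF assms(2), of x "inverse x"] hom_on_simps(1)[OF assms(2)]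
          assms subfield_set_inverse[OF assms(1)] by simp
    with \<open>\<sigma> x = 0\<close> show False by simp
  qed
qed (use assms hom_on_0 subfield_set_imp_subring_set in blast)

lemma hom_on_subset: "hom_on F \<sigma> \<Longrightarrow> E \<subseteq> F \<Longrightarrow> hom_on E \<sigma>"
  by (auto simp: hom_on_def subset_iff)

lemma hom_on_compose:
  assumes "hom_on F \<tau>" "\<And>x. x \<in> F \<Longrightarrow> \<tau> x \<in> E" "hom_on E \<sigma>"
  shows "hom_on F (\<lambda>x. \<sigma> (\<tau> x))"
  using assms by (simp add: hom_on_def)

lemma poly_over_intros:
  assumes "subring_set F"
  shows "poly_over F 0" "c \<in> F \<Longrightarrow> poly_over F [:c:]"
    "poly_over F p \<Longrightarrow> poly_over F q \<Longrightarrow> poly_over F (p + q)"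
    "poly_over F p \<Longrightarrow> poly_over F q \<Longrightarrow> poly_over F (p - q)"
    "poly_over F p \<Longrightarrow> poly_over F (- p)"
    "poly_over F p \<Longrightarrow> poly_over F q \<Longrightarrow> poly_over F (p * q)"
    "c \<in> F \<Longrightarrow> poly_over F (monom c n)"
    "c \<in> F \<Longrightarrow> poly_over F p \<Longrightarrow> poly_over F (pCons c p)"
  using assms
  by (auto simp: poly_over_def subring_set_closed coeff_mult coeff_pCons coeff_monom
      intro!: subring_set_sum subring_set_closed split: nat.splits)

lemma poly_over_power:
  assumes "subring_set F" "poly_over F p"
  shows "poly_over F (p ^ n)"
  by (induction n) (use assms subring_set_closed(2)[OF assms(1)] in
      \<open>auto intro: poly_over_intros simp: one_pCons\<close>)

lemma poly_over_pcompose: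
  assumes "subring_set F" "poly_over F p" "poly_over F q"
  shows "poly_over F (pcompose p q)"
  using assms(2)
proof (induction p)
  case (pCons c p)
  have "poly_over F p" "c \<in> F"
    using pCons.prems unfolding poly_over_def by (metis coeff_pCons_Suc, metis coeff_pCons_0)
  then show ?case
    using pCons.IH assms by (auto simp: pcompose_pCons intro!: poly_over_intros)
qed (auto intro: poly_over_intros assms)

lemma poly_over_sum:
  "subring_set F \<Longrightarrow> (\<And>i. i \<in> I \<Longrightarrow> poly_over F (f i)) \<Longrightarrow> poly_over F (sum f I)"
  by (induction I rule: infinite_finite_induct) (auto intro: poly_over_intros)

lemma poly_over_mono: "poly_over F p \<Longrightarrow> F \<subseteq> E \<Longrightarrow> poly_over E p"
  by (auto simp: poly_over_def)

lemma poly_in_subring: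
  assumes "subring_set F" "poly_over F p" "x \<in> F"
  shows "poly p x \<in> F"
  unfolding poly_altdef
  by (rule subring_set_sum) (use assms in \<open>auto simp: poly_over_def subring_set_closed\<close>)

lemma poly_over_division:
  assumes F: "subfield_set F" and m: "poly_over F m" "m \<noteq> 0" and p: "poly_over F p"
  obtains q r where "poly_over F q" "poly_over F r" "p = m * q + r" "r = 0 \<or> degree r < degree m"
proof -
  note R = subfield_set_imp_subring_set[OF F]
  have "\<exists>q r. poly_over F q \<and> poly_over F r \<and> p = m * q + r \<and> (r = 0 \<or> degree r < degree m)"
    using p
  proof (induction "degree p" arbitrary: p rule: less_induct)
    case less
    show ?case
    proof (cases "p = 0 \<or> degree p < degree m")
      case True
      then show ?thesis
        by (intro exI[of _ 0] exI[of _ p]) (use less.prems poly_over_intros[OF R] in auto)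
    next
      case False
      define c where "c = lead_coeff p / lead_coeff m"
      define s where "s = monom c (degree p - degree m)"
      have c: "c \<in> F" "c \<noteq> 0"
        using less.prems m False unfolding c_def
        by (auto intro!: subfield_set_divide[OF F] simp: poly_over_def)
      have s: "poly_over F s"
        unfolding s_def using c poly_over_intros[OF R] by auto
      have p': "poly_over F (p - m * s)"
        using s m less.prems poly_over_intros[OF R] by auto
      have deg: "degree (m * s) = degree p"
        using False m c by (simp add: s_def degree_mult_eq monom_eq_0_iff degree_monom_eq)
      have lc: "lead_coeff (m * s) = lead_coeff p"
        using m c(2) unfolding lead_coeff_mult s_def lead_coeff_monom by (simp add: c_def)
      show ?thesis
      proof (cases "p - m * s = 0")
        case True
        then show ?thesis
          by (intro exI[of _ s] exI[of _ 0]) (use s poly_over_intros[OF R] in auto)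
      next
        case nz: False
        have "degree (p - m * s) < degree p"
        proof (rule ccontr)
          assume "\<not> ?thesis"
          then have "degree (p - m * s) = degree p"
            using deg degree_diff_le_max[of p "m * s"] by auto
          then have "lead_coeff (p - m * s) = 0"
            using deg lc by simp
          with nz show False by (metis leading_coeff_0_iff)
        qed
        from less.hyps[OF this p'] obtain q r where
          "poly_over F q" "poly_over F r" "p - m * s = m * q + r" "r = 0 \<or> degree r < degree m"
          by blast
        then show ?thesis
          by (intro exI[of _ "q + s"] exI[of _ r])
            (use s poly_over_intros[OF R] in \<open>auto simp: algebra_simps\<close>)
      qed
    qed
  qed
  then show ?thesis using that by blast
qed

definition minimal_poly :: "'a::field set \<Rightarrow> 'a \<Rightarrow> 'a poly \<Rightarrow> bool" where
  "minimal_poly F x m \<longleftrightarrow> poly_over F m \<and> m \<noteq> 0 \<and> poly m x = 0 \<and>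
     (\<forall>p. poly_over F p \<longrightarrow> poly p x = 0 \<longrightarrow> p \<noteq> 0 \<longrightarrow> degree m \<le> degree p)"

definition algebraic_over :: "'a::field set \<Rightarrow> 'a \<Rightarrow> bool" where
  "algebraic_over F x \<longleftrightarrow> (\<exists>p. poly_over F p \<and> p \<noteq> 0 \<and> poly p x = 0)"

lemma minimal_poly_exists:
  assumes "algebraic_over F x"
  obtains m where "minimal_poly F x m"
proof -
  define P where "P p \<longleftrightarrow> poly_over F p \<and> p \<noteq> 0 \<and> poly p x = 0" for p
  obtain p where "P p" using assms by (auto simp: algebraic_over_def P_def)
  from ex_has_least_nat[of P p degree, OF this] show ?thesis
    using that unfolding minimal_poly_def P_def by blast
qed

lemma minimal_poly_dvd:
  assumes "subfield_set F" "minimal_poly F x m" "poly_over F p" "poly p x = 0"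
  obtains q where "poly_over F q" "p = m * q"
proof -
  have m: "poly_over F m" "m \<noteq> 0" "poly m x = 0"
    using assms(2) by (auto simp: minimal_poly_def)
  obtain q r where qr: "poly_over F q" "poly_over F r" "p = m * q + r" "r = 0 \<or> degree r < degree m"
    using poly_over_division[OF assms(1) m(1,2) assms(3)] by blast
  have "poly r x = 0" using qr(3) assms(4) m(3) by simp
  then have "r = 0"
    using assms(2) qr(2,4) unfolding minimal_poly_def by (meson leD)
  then show ?thesis using qr that by simp
qed

lemma minimal_poly_degree_pos: "minimal_poly F x m \<Longrightarrow> degree m > 0"
  by (rule ccontr) (auto simp: minimal_poly_def elim!: degree_eq_zeroE)

lemma subfield_set_poly_image:
  assumes F: "subfield_set F" and m: "minimal_poly F x m"
  shows "subfield_set {poly p x | p. poly_over F p}" (is "subfield_set ?E")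
proof -
  note R = subfield_set_imp_subring_set[OF F]
  have m': "poly_over F m" "m \<noteq> 0" "poly m x = 0"
    using m by (auto simp: minimal_poly_def)
  have inv: "\<exists>q. poly_over F q \<and> poly q x * poly p x = 1"
    if "poly_over F p" "degree p < degree m" "poly p x \<noteq> 0" for p
    using that
  proof (induction "degree p" arbitrary: p rule: less_induct)
    case less
    have p0: "p \<noteq> 0" using less.prems by auto
    show ?case
    proof (cases "degree p = 0")
      case True
      then obtain c where c: "p = [:c:]" by (rule degree_eq_zeroE)
      have "c \<in> F" using less.prems(1) c unfolding poly_over_def by (metis coeff_pCons_0)
      then show ?thesis
        by (intro exI[of _ "[:inverse c:]"])
          (use c p0 in \<open>auto intro!: poly_over_intros R subfield_set_inverse F\<close>)
    next
      case False
      obtain s r where sr: "poly_over F s" "poly_over F r" "m = p * s + r" "r = 0 \<or> degree r < degree p"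
        using poly_over_division[OF F less.prems(1) p0 m'(1)] by blast
      have rx: "poly r x = - (poly p x * poly s x)"
        using m'(3) sr(3) by (simp add: eq_neg_iff_add_eq_0 add.commute)
      have nz: "poly r x \<noteq> 0"
      proof
        assume "poly r x = 0"
        then have "r = 0"
          using m sr less.prems(2) unfolding minimal_poly_def by (meson leD less_trans)
        then have eq: "m = p * s" using sr by simp
        have "poly s x = 0" using \<open>poly r x = 0\<close> rx less.prems(3) by simp
        moreover have "s \<noteq> 0" using eq m'(2) by auto
        ultimately have "degree m \<le> degree s" using m sr(1) by (auto simp: minimal_poly_def)
        moreover have "degree m = degree p + degree s"
          using eq p0 \<open>s \<noteq> 0\<close> by (simp add: degree_mult_eq)
        ultimately show False using False by simp
      qed
      then have "r \<noteq> 0" by auto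
      then have "degree r < degree p" using sr by auto
      then obtain q where q: "poly_over F q" "poly q x * poly r x = 1"
        using less.hyps[of r] sr(2) less.prems(2) nz by (meson less_trans)
      then have "poly (- (s * q)) x * poly p x = 1"
        using rx by (simp add: algebra_simps)
      then show ?thesis using q sr poly_over_intros[OF R] by meson
    qed
  qed
  have "inverse (poly p x) \<in> ?E" if p: "poly_over F p" for p
  proof (cases "poly p x = 0")
    case True
    then show ?thesis
      by (intro CollectI exI[of _ 0]) (use poly_over_intros(1)[OF R] in simp)
  next
    case False
    obtain q r where qr: "poly_over F q" "poly_over F r" "p = m * q + r" "r = 0 \<or> degree r < degree m"
      using poly_over_division[OF F m'(1,2) p] by blast
    have rp: "poly r x = poly p x" using qr m' by simp
    then have "r \<noteq> 0" using False by auto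
    then have "degree r < degree m" using qr(4) by simp
    from inv[OF qr(2) this] obtain s where s: "poly_over F s" "poly s x * poly p x = 1"
      using False unfolding rp by blast
    have "inverse (poly p x) = poly s x"
      using s(2) False by (metis inverse_eq_divide nonzero_eq_divide_eq)
    then show ?thesis using s(1) by blast
  qed
  moreover have "0 \<in> ?E"
    by (intro CollectI exI[of _ 0]) (use poly_over_intros(1)[OF R] in simp)
  moreover have "1 \<in> ?E"
    by (intro CollectI exI[of _ "[:1:]"])
      (use poly_over_intros(2)[OF R] subring_set_closed(2)[OF R] in simp)
  moreover have "a - b \<in> ?E \<and> a * b \<in> ?E" if "a \<in> ?E" "b \<in> ?E" for a b
  proof -
    obtain p q where "a = poly p x" "b = poly q x" "poly_over F p" "poly_over F q"
      using \<open>a \<in> ?E\<close> \<open>b \<in> ?E\<close> by blast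
    then have "poly_over F (p - q)" "a - b = poly (p - q) x" "poly_over F (p * q)" "a * b = poly (p * q) x"
      using poly_over_intros(4,6)[OF R] by simp_all
    then show ?thesis by blast
  qed
  ultimately show ?thesis unfolding subfield_set_def by auto
qed

lemma map_poly_hom:
  assumes R: "subring_set F" and \<sigma>: "hom_on F \<sigma>" and p: "poly_over F p" and q: "poly_over F q"
  shows "map_poly \<sigma> (p + q) = map_poly \<sigma> p + map_poly \<sigma> q"
    "map_poly \<sigma> (p - q) = map_poly \<sigma> p - map_poly \<sigma> q"
    "map_poly \<sigma> (p * q) = map_poly \<sigma> p * map_poly \<sigma> q"
proof -
  have 0: "\<sigma> 0 = 0" by (rule hom_on_0[OF R \<sigma>])
  have c: "coeff p i \<in> F" "coeff q i \<in> F" for i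
    using p q by (auto simp: poly_over_def)
  show "map_poly \<sigma> (p + q) = map_poly \<sigma> p + map_poly \<sigma> q"
    by (rule poly_eqI) (simp add: coeff_map_poly 0 hom_on_simps(2)[OF \<sigma>] c)
  show "map_poly \<sigma> (p - q) = map_poly \<sigma> p - map_poly \<sigma> q"
    by (rule poly_eqI) (simp add: coeff_map_poly 0 hom_on_diff[OF R \<sigma>] c)
  show "map_poly \<sigma> (p * q) = map_poly \<sigma> p * map_poly \<sigma> q"
    by (rule poly_eqI) (simp add: coeff_map_poly 0 coeff_mult hom_on_simps(3)[OF \<sigma>] c
        hom_on_sum[OF R \<sigma>] subring_set_closed[OF R])
qed

lemma map_poly_hom_pCons:
  assumes "subring_set F" "hom_on F \<sigma>"
  shows "map_poly \<sigma> [:c:] = [:\<sigma> c:]"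
  by (rule poly_eqI)
    (auto simp: coeff_map_poly hom_on_0[OF assms] coeff_pCons split: nat.splits)

lemma simple_extension_hom:
  assumes F: "subfield_set F" and \<sigma>: "hom_on F \<sigma>" and m: "minimal_poly F x m"
    and y: "poly (map_poly \<sigma> m) y = 0"
  obtains E \<sigma>' where "subfield_set E" "F \<subseteq> E" "x \<in> E" "hom_on E \<sigma>'"
    "\<And>z. z \<in> F \<Longrightarrow> \<sigma>' z = \<sigma> z" "\<sigma>' x = y"
    "\<And>V. subring_set V \<Longrightarrow> F \<subseteq> V \<Longrightarrow> x \<in> V \<Longrightarrow> E \<subseteq> V"
proof -
  note R = subfield_set_imp_subring_set[OF F]
  define E where "E = {poly p x | p. poly_over F p}"
  define rep where "rep z = (SOME p. poly_over F p \<and> z = poly p x)" for z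
  define \<sigma>' where "\<sigma>' z = poly (map_poly \<sigma> (rep z)) y" for z
  have wd: "poly (map_poly \<sigma> p) y = poly (map_poly \<sigma> q) y"
    if pq: "poly_over F p" "poly_over F q" "poly p x = poly q x" for p q
  proof -
    obtain s where s: "poly_over F s" "p - q = m * s"
      using minimal_poly_dvd[OF F m, of "p - q"] pq poly_over_intros(4)[OF R] by auto
    have "map_poly \<sigma> p - map_poly \<sigma> q = map_poly \<sigma> m * map_poly \<sigma> s"
      using map_poly_hom(2)[OF R \<sigma> pq(1,2)] map_poly_hom(3)[OF R \<sigma> _ s(1), of m] s(2) m
      by (simp add: minimal_poly_def)
    then have "poly (map_poly \<sigma> p) y - poly (map_poly \<sigma> q) y = 0"
      using y by (metis mult_zero_left poly_diff poly_mult)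
    then show ?thesis by simp
  qed
  have \<sigma>'_eq: "\<sigma>' (poly p x) = poly (map_poly \<sigma> p) y" if "poly_over F p" for p
  proof -
    have "poly_over F (rep (poly p x)) \<and> poly p x = poly (rep (poly p x)) x"
      unfolding rep_def by (rule someI[of _ p]) (use that in simp)
    then show ?thesis unfolding \<sigma>'_def using wd that by metis
  qed
  have E: "subfield_set E"
    unfolding E_def by (rule subfield_set_poly_image[OF F m])
  have const: "poly_over F [:z:]" if "z \<in> F" for z
    using that poly_over_intros[OF R] by auto
  have \<sigma>'F: "\<sigma>' z = \<sigma> z" if "z \<in> F" for z
    using \<sigma>'_eq[OF const[OF that]] by (simp add: map_poly_hom_pCons[OF R \<sigma>])
  have FE: "F \<subseteq> E"
  proof
    fix z assume "z \<in> F"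
    then show "z \<in> E" unfolding E_def using const[of z] by (intro CollectI exI[of _ "[:z:]"]) auto
  qed
  have X: "poly_over F [:0, 1:]"
    using poly_over_intros[OF R] subring_set_closed[OF R] by auto
  have xE: "x \<in> E" unfolding E_def using X by (intro CollectI exI[of _ "[:0, 1:]"]) auto
  have mapX: "map_poly \<sigma> [:0, 1:] = [:0, 1:]"
    by (rule poly_eqI) (auto simp: coeff_map_poly hom_on_0[OF R \<sigma>] hom_on_simps(1)[OF \<sigma>]
        coeff_pCons split: nat.splits)
  have \<sigma>'x: "\<sigma>' x = y" using \<sigma>'_eq[OF X] by (simp add: mapX)
  have hom: "hom_on E \<sigma>'"
    unfolding hom_on_def
  proof (intro conjI ballI)
    show "\<sigma>' 1 = 1" using \<sigma>'F[of 1] subring_set_closed[OF R] hom_on_simps[OF \<sigma>] by simp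
    fix a b assume "a \<in> E" "b \<in> E"
    then obtain p q where pq: "a = poly p x" "b = poly q x" "poly_over F p" "poly_over F q"
      unfolding E_def by blast
    show "\<sigma>' (a + b) = \<sigma>' a + \<sigma>' b"
      using \<sigma>'_eq[OF poly_over_intros(3)[OF R pq(3,4)]] \<sigma>'_eq[OF pq(3)] \<sigma>'_eq[OF pq(4)]
        map_poly_hom(1)[OF R \<sigma> pq(3,4)] pq by simp
    show "\<sigma>' (a * b) = \<sigma>' a * \<sigma>' b"
      using \<sigma>'_eq[OF poly_over_intros(6)[OF R pq(3,4)]] \<sigma>'_eq[OF pq(3)] \<sigma>'_eq[OF pq(4)]
        map_poly_hom(3)[OF R \<sigma> pq(3,4)] pq by simp
  qed
  have min: "E \<subseteq> V" if "subring_set V" "F \<subseteq> V" "x \<in> V" for V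
    unfolding E_def using poly_in_subring[OF that(1) poly_over_mono that(3)] that(2) by blast
  show ?thesis using that[OF E FE xE hom \<sigma>'F \<sigma>'x min] .
qed

lemma algebraic_over_mono: "algebraic_over F x \<Longrightarrow> F \<subseteq> E \<Longrightarrow> algebraic_over E x"
  by (auto simp: algebraic_over_def intro: poly_over_mono)

lemma hom_on_extend_finite:
  fixes \<sigma> :: "complex \<Rightarrow> complex"
  assumes F: "subfield_set F" and \<sigma>: "hom_on F \<sigma>" and T: "finite T" "\<And>x. x \<in> T \<Longrightarrow> algebraic_over F x"
  obtains E \<sigma>' where "subfield_set E" "F \<subseteq> E" "T \<subseteq> E" "hom_on E \<sigma>'"
    "\<And>z. z \<in> F \<Longrightarrow> \<sigma>' z = \<sigma> z"
    "\<And>V. subring_set V \<Longrightarrow> F \<subseteq> V \<Longrightarrow> T \<subseteq> V \<Longrightarrow> E \<subseteq> V"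
proof -
  have "\<exists>E \<sigma>'. subfield_set E \<and> F \<subseteq> E \<and> T \<subseteq> E \<and> hom_on E \<sigma>' \<and> (\<forall>z\<in>F. \<sigma>' z = \<sigma> z) \<and>
    (\<forall>V. subring_set V \<longrightarrow> F \<subseteq> V \<longrightarrow> T \<subseteq> V \<longrightarrow> E \<subseteq> V)"
    using T
  proof (induction T rule: finite_induct)
    case empty
    show ?case by (intro exI[of _ F] exI[of _ \<sigma>]) (use F \<sigma> in auto)
  next
    case (insert x T)
    then obtain E \<sigma>' where E: "subfield_set E" "F \<subseteq> E" "T \<subseteq> E" "hom_on E \<sigma>'" "\<forall>z\<in>F. \<sigma>' z = \<sigma> z"
      and min: "\<forall>V. subring_set V \<longrightarrow> F \<subseteq> V \<longrightarrow> T \<subseteq> V \<longrightarrow> E \<subseteq> V"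
      by auto
    have "algebraic_over E x"
      using insert.prems E(2) algebraic_over_mono by blast
    then obtain m where m: "minimal_poly E x m" by (rule minimal_poly_exists)
    have R: "subring_set E" using E(1) by (rule subfield_set_imp_subring_set)
    have "coeff (map_poly \<sigma>' m) (degree m) \<noteq> 0"
      using hom_on_eq_0_iff[OF E(1,4)] m hom_on_0[OF R E(4)]
      by (auto simp: coeff_map_poly minimal_poly_def poly_over_def)
    then have "degree (map_poly \<sigma>' m) \<ge> degree m" by (rule le_degree)
    then have "\<not> constant (poly (map_poly \<sigma>' m))"
      using minimal_poly_degree_pos[OF m] by (simp add: constant_degree)
    then obtain y where y: "poly (map_poly \<sigma>' m) y = 0"
      using fundamental_theorem_of_algebra by blast
    obtain E' \<sigma>'' where E': "subfield_set E'" "E \<subseteq> E'" "x \<in> E'" "hom_on E' \<sigma>''"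
      "\<And>z. z \<in> E \<Longrightarrow> \<sigma>'' z = \<sigma>' z" "\<And>V. subring_set V \<Longrightarrow> E \<subseteq> V \<Longrightarrow> x \<in> V \<Longrightarrow> E' \<subseteq> V"
      using simple_extension_hom[OF E(1,4) m y] by metis
    have "F \<subseteq> E'" "insert x T \<subseteq> E'" using E E' by blast+
    moreover have "\<forall>z\<in>F. \<sigma>'' z = \<sigma> z" using E(2,5) E'(5) by (metis subsetD)
    moreover have "E' \<subseteq> V" if "subring_set V" "F \<subseteq> V" "insert x T \<subseteq> V" for V
      using E'(6)[of V] min that by simp
    ultimately show ?case using E'(1,4) by blast
  qed
  then obtain E \<sigma>' where "subfield_set E" "F \<subseteq> E" "T \<subseteq> E" "hom_on E \<sigma>'" "\<forall>z\<in>F. \<sigma>' z = \<sigma> z"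
    "\<forall>V. subring_set V \<longrightarrow> F \<subseteq> V \<longrightarrow> T \<subseteq> V \<longrightarrow> E \<subseteq> V"
    by (elim exE conjE)
  then show ?thesis by (intro that[of E \<sigma>']) simp_all
qed

section \<open>Linear independence of radicals\<close>

definition unity_roots :: "complex set" where
  "unity_roots = {z. \<exists>n\<ge>1. z ^ n = 1}"

lemma minimal_poly_other_root:
  fixes r :: complex
  assumes L: "subfield_set L" and m: "minimal_poly L r m" and n: "n \<ge> 1" "r ^ n \<in> L" and r: "r \<notin> L"
  obtains r' where "poly m r' = 0" "r' \<noteq> r"
proof -
  note R = subfield_set_imp_subring_set[OF L]
  have m': "poly_over L m" "m \<noteq> 0" "poly m r = 0"
    using m by (auto simp: minimal_poly_def)
  have r0: "r \<noteq> 0" using r subring_set_closed(1)[OF R] by blast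
  define p where "p = monom 1 n - [:r ^ n:]"
  have "poly_over L p"
    unfolding p_def using n(2) poly_over_intros[OF R] subring_set_closed(2)[OF R] by simp
  moreover have "poly p r = 0" by (simp add: p_def poly_monom)
  ultimately obtain q where q: "p = m * q" using minimal_poly_dvd[OF L m] by blast
  obtain k where k: "m = [:-r, 1:] * k" using m'(3) by (auto simp: poly_eq_0_iff_dvd)
  have "k \<noteq> 0" using k m'(2) by auto
  have "degree k \<noteq> 0"
  proof
    assume "degree k = 0"
    then obtain c where c: "k = [:c:]" by (rule degree_eq_zeroE)
    have "c \<noteq> 0" using \<open>k \<noteq> 0\<close> c by simp
    have "m = [:-(r * c), c:]" using k c by simp
    then have "coeff m 0 = -(r * c)" "coeff m 1 = c" by simp_all
    then have "-(r * c) \<in> L" "c \<in> L" using m'(1) unfolding poly_over_def by metis+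
    then have "- (-(r * c) / c) \<in> L"
      using subfield_set_divide[OF L] subring_set_closed(5)[OF R] by blast
    then show False using r \<open>c \<noteq> 0\<close> by simp
  qed
  then have "\<not> constant (poly k)" by (simp add: constant_degree)
  then obtain r' where r': "poly k r' = 0" using fundamental_theorem_of_algebra by blast
  have "r' \<noteq> r"
  proof
    assume "r' = r"
    then obtain k' where k': "k = [:-r, 1:] * k'" using r' by (auto simp: poly_eq_0_iff_dvd)
    have eq: "p = [:-r, 1:] * ([:-r, 1:] * (k' * q))" unfolding q k k' by (simp only: mult.assoc)
    have "poly (pderiv p) r = 0" unfolding eq pderiv_mult by simp
    moreover have "poly (pderiv p) r = of_nat n * r ^ (n - 1)"
      by (simp add: p_def pderiv_diff pderiv_monom poly_monom pderiv_pCons)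
    ultimately show False using n(1) r0 by simp
  qed
  moreover have "poly m r' = 0" using k r' by simp
  ultimately show ?thesis using that by blast
qed

lemma algebraic_over_root:
  assumes "subfield_set L" "n \<ge> 1" "x ^ n \<in> L"
  shows "algebraic_over L x"
proof -
  note R = subfield_set_imp_subring_set[OF assms(1)]
  have "poly_over L (monom 1 n - [:x ^ n:])"
    using assms(3) poly_over_intros[OF R] subring_set_closed(2)[OF R] by simp
  moreover have "poly (monom 1 n - [:x ^ n:]) x = 0" by (simp add: poly_monom)
  moreover have "coeff (monom 1 n - [:x ^ n:]) n \<noteq> 0"
    using assms(2) by (simp add: coeff_pCons split: nat.splits)
  then have "monom 1 n - [:x ^ n:] \<noteq> 0" by (metis coeff_0)
  ultimately show ?thesis unfolding algebraic_over_def by blast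
qed

text \<open>The ratio \<open>r\<close> of two of the radicals in a relation is not in \<open>L\<close>, so some embedding over
  \<open>L\<close> moves it. The embedding multiplies every term by a root of unity, which lies in \<open>L\<close>, and
  subtracting a multiple of the original relation shortens it.\<close>

lemma radicals_linear_independent:
  fixes c :: "complex \<Rightarrow> complex"
  assumes L: "subfield_set L" "unity_roots \<subseteq> L"
    and T: "finite T" "\<And>x. x \<in> T \<Longrightarrow> x \<noteq> 0 \<and> (\<exists>n\<ge>1. x ^ n \<in> L)"
    and distinct: "\<And>x y. x \<in> T \<Longrightarrow> y \<in> T \<Longrightarrow> x / y \<in> L \<Longrightarrow> x = y"
    and c: "\<And>x. x \<in> T \<Longrightarrow> c x \<in> L" and sum0: "(\<Sum>x\<in>T. c x * x) = 0"
    and x: "x \<in> T"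
  shows "c x = 0"
  using T distinct c sum0 x
proof (induction "card T" arbitrary: T c x rule: less_induct)
  case less
  note R = subfield_set_imp_subring_set[OF L(1)]
  show ?case
  proof (cases "T = {x}")
    case True
    then have "c x * x = 0" using less.prems(5) by simp
    then show ?thesis using less.prems(2)[OF less.prems(6)] by simp
  next
    case False
    then obtain z where z: "z \<in> T" "z \<noteq> x" using less.prems(6) by auto
    have nz: "y \<noteq> 0" if "y \<in> T" for y using less.prems(2)[OF that] by simp
    have alg: "algebraic_over L y" if "y \<in> T" for y
      using less.prems(2)[OF that] algebraic_over_root[OF L(1)] by auto
    define r where "r = x / z"
    have rL: "r \<notin> L" using less.prems(3)[OF less.prems(6) z(1)] z(2) unfolding r_def by blast
    obtain n1 where n1: "n1 \<ge> 1" "x ^ n1 \<in> L" using less.prems(2)[OF less.prems(6)] by auto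
    obtain n2 where n2: "n2 \<ge> 1" "z ^ n2 \<in> L" using less.prems(2)[OF z(1)] by auto
    note n = n1 n2
    have "r ^ (n1 * n2) = (x ^ n1) ^ n2 / (z ^ n2) ^ n1"
      by (simp add: r_def power_divide power_mult[symmetric] mult.commute)
    then have rn: "r ^ (n1 * n2) \<in> L"
      using n(2,4) subfield_set_divide[OF L(1)] subring_set_closed(7)[OF R] by simp
    have n12: "n1 * n2 \<ge> 1" using n(1,3) by simp
    obtain m where m: "minimal_poly L r m"
      using minimal_poly_exists algebraic_over_root[OF L(1) n12 rn] by blast
    obtain r' where r': "poly m r' = 0" "r' \<noteq> r"
      by (rule minimal_poly_other_root[OF L(1) m n12 rn rL])
    have hom_id: "hom_on L id" by (simp add: hom_on_def)
    obtain E \<sigma> where E: "subfield_set E" "L \<subseteq> E" "r \<in> E" "hom_on E \<sigma>"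
      "\<And>z. z \<in> L \<Longrightarrow> \<sigma> z = id z" "\<sigma> r = r'"
      "\<And>V. subring_set V \<Longrightarrow> L \<subseteq> V \<Longrightarrow> r \<in> V \<Longrightarrow> E \<subseteq> V"
      by (rule simple_extension_hom[OF L(1) hom_id m, of r']) (simp_all add: map_poly_id r'(1))
    obtain E' \<sigma>' where E': "subfield_set E'" "E \<subseteq> E'" "T \<subseteq> E'" "hom_on E' \<sigma>'"
      "\<And>z. z \<in> E \<Longrightarrow> \<sigma>' z = \<sigma> z"
      "\<And>V. subring_set V \<Longrightarrow> E \<subseteq> V \<Longrightarrow> T \<subseteq> V \<Longrightarrow> E' \<subseteq> V"
      using hom_on_extend_finite[OF E(1,4) less.prems(1) algebraic_over_mono[OF alg E(2)]] by metis
    note R' = subfield_set_imp_subring_set[OF E'(1)]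
    have fixL: "\<sigma>' y = y" if "y \<in> L" for y using E'(5)[of y] E(2,5) that by auto
    define w where "w y = \<sigma>' y / y" for y
    have wL: "w y \<in> L" if "y \<in> T" for y
    proof -
      obtain k where k: "k \<ge> 1" "y ^ k \<in> L" using less.prems(2)[OF \<open>y \<in> T\<close>] by blast
      have "\<sigma>' y ^ k = y ^ k"
        using hom_on_power[OF R' E'(4), of y k] E'(3) that fixL[OF k(2)] by auto
      then have "w y ^ k = 1" using nz[OF that] by (simp add: w_def power_divide)
      then have "w y \<in> unity_roots" using k(1) by (auto simp: unity_roots_def)
      then show ?thesis using L(2) by blast
    qed
    have wxz: "w x \<noteq> w z"
    proof
      assume eq: "w x = w z"
      have "\<sigma>' x = \<sigma>' (r * z)" using nz[OF z(1)] by (simp add: r_def)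
      also have "\<dots> = \<sigma>' r * \<sigma>' z"
        using hom_on_simps(3)[OF E'(4), of r z] E(3) E'(2,3) z(1) by blast
      finally have "\<sigma>' x = r' * \<sigma>' z" using E'(5)[OF E(3)] E(6) by simp
      moreover have "\<sigma>' x = w x * x" "\<sigma>' z = w z * z"
        using nz[OF z(1)] nz[OF less.prems(6)] by (simp_all add: w_def)
      moreover have "w z \<noteq> 0"
        using hom_on_eq_0_iff[OF E'(1,4), of z] E'(3) z(1) nz[OF z(1)] by (auto simp: w_def)
      ultimately have "x = r' * z" using eq by simp
      then show False using r'(2) nz[OF z(1)] by (simp add: r_def)
    qed
    have sum': "(\<Sum>y\<in>T. c y * w y * y) = 0"
    proof -
      have "0 = \<sigma>' (\<Sum>y\<in>T. c y * y)" using less.prems(5) hom_on_0[OF R' E'(4)] by simp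
      also have "\<dots> = (\<Sum>y\<in>T. \<sigma>' (c y * y))"
        by (rule hom_on_sum[OF R' E'(4)])
          (use less.prems(4) E(2) E'(2,3) subring_set_closed(4)[OF R'] in blast)
      also have "\<dots> = (\<Sum>y\<in>T. c y * w y * y)"
      proof (rule sum.cong[OF refl])
        fix y assume y: "y \<in> T"
        have "\<sigma>' (c y * y) = \<sigma>' (c y) * \<sigma>' y"
          using hom_on_simps(3)[OF E'(4), of "c y" y] less.prems(4)[OF y] E(2) E'(2,3) y by blast
        then show "\<sigma>' (c y * y) = c y * w y * y"
          using fixL[OF less.prems(4)[OF y]] nz[OF y] by (simp add: w_def)
      qed
      finally show ?thesis by simp
    qed
    have "(\<Sum>y\<in>T. c y * (w y - w z) * y) = 0"
    proof -
      have "(\<Sum>y\<in>T. c y * (w y - w z) * y) = (\<Sum>y\<in>T. c y * w y * y) - w z * (\<Sum>y\<in>T. c y * y)"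
        by (simp add: sum_subtractf[symmetric] sum_distrib_left algebra_simps)
      then show ?thesis using sum' less.prems(5) by simp
    qed
    then have "(\<Sum>y\<in>T - {z}. c y * (w y - w z) * y) = 0"
      using less.prems(1) z(1) by (simp add: sum.remove)
    moreover have "card (T - {z}) < card T"
      using less.prems(1) z(1) by (intro card_Diff1_less)
    moreover have "c y * (w y - w z) \<in> L" if "y \<in> T - {z}" for y
      using that less.prems(4)[of y] wL[of y] wL[OF z(1)] by (simp add: subring_set_closed[OF R])
    moreover have "finite (T - {z})" "x \<in> T - {z}" using less.prems(1,6) z(2) by auto
    moreover have "y \<noteq> 0 \<and> (\<exists>n\<ge>1. y ^ n \<in> L)" if "y \<in> T - {z}" for y
      using that less.prems(2) by blast
    moreover have "y = y'" if "y \<in> T - {z}" "y' \<in> T - {z}" "y / y' \<in> L" for y y'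
      using that by (intro less.prems(3)) auto
    ultimately have "c x * (w x - w z) = 0"
      by (intro less.hyps[of "T - {z}" "\<lambda>y. c y * (w y - w z)" x]) assumption+
    then show ?thesis using wxz by simp
  qed
qed

section \<open>Irreducibility of cyclotomic polynomials\<close>

abbreviation int_poly_eval :: "int poly \<Rightarrow> complex \<Rightarrow> complex" where
  "int_poly_eval p \<equiv> poly (map_poly of_int p)"

lemma int_poly_eval_simps [simp]:
  "int_poly_eval 0 z = 0"
  "int_poly_eval (pCons a p) z = of_int a + z * int_poly_eval p z"
  "int_poly_eval (smult a p) z = of_int a * int_poly_eval p z"
  "int_poly_eval (p + q) z = int_poly_eval p z + int_poly_eval q z"
  "int_poly_eval (p * q) z = int_poly_eval p z * int_poly_eval q z"
proof -
  show pC: "int_poly_eval (pCons a p) z = of_int a + z * int_poly_eval p z" for a p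
    by (simp add: map_poly_pCons)
  show 0: "int_poly_eval 0 z = 0" by simp
  show sm: "int_poly_eval (smult a p) z = of_int a * int_poly_eval p z" for a p
    by (induction p) (simp_all add: pC algebra_simps)
  show add: "int_poly_eval (p + q) z = int_poly_eval p z + int_poly_eval q z" for p q
    by (induction p q rule: poly_induct2) (simp_all add: pC algebra_simps)
  show "int_poly_eval (p * q) z = int_poly_eval p z * int_poly_eval q z"
    by (induction p) (simp_all add: pC add sm mult_pCons_left algebra_simps)
qed

lemma int_poly_eval_1 [simp]: "int_poly_eval 1 z = 1"
  unfolding one_pCons by (simp del: map_poly_1)

lemma int_poly_eval_diff [simp]: "int_poly_eval (p - q) z = int_poly_eval p z - int_poly_eval q z"
proof -
  have "int_poly_eval (p - q + q) z = int_poly_eval (p - q) z + int_poly_eval q z"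
    by (rule int_poly_eval_simps)
  then show ?thesis by simp
qed

lemma int_poly_eval_power [simp]: "int_poly_eval (p ^ n) z = int_poly_eval p z ^ n"
  by (induction n) simp_all

lemma int_poly_eval_monom [simp]: "int_poly_eval (monom a n) z = of_int a * z ^ n"
  by (simp add: map_poly_monom poly_monom)

lemma int_poly_eval_pcompose [simp]:
  "int_poly_eval (pcompose p q) z = int_poly_eval p (int_poly_eval q z)"
  by (induction p) (simp_all add: pcompose_pCons)

lemma pcompose_monom_prime:
  fixes f :: "int poly"
  assumes p: "prime p"
  shows "[:int p:] dvd pcompose f (monom 1 p) - f ^ p"
proof (induction f)
  case 0
  then show ?case using prime_gt_0_nat[OF p] by (simp add: power_0_left)
next
  case (pCons a f)
  define u where "u = [:a:]"
  define v where "v = pCons 0 f"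
  have uv: "pCons a f = u + v" by (simp add: u_def v_def)
  have "(u + v) ^ p = (\<Sum>k\<le>p. of_nat (p choose k) * u ^ k * v ^ (p - k))"
    by (rule binomial_ring)
  also have "{..p} = insert 0 (insert p {1..<p})" using prime_gt_0_nat[OF p] by auto
  also have "(\<Sum>k\<in>insert 0 (insert p {1..<p}). of_nat (p choose k) * u ^ k * v ^ (p - k)) =
      v ^ p + (u ^ p + (\<Sum>k=1..<p. of_nat (p choose k) * u ^ k * v ^ (p - k)))"
    using prime_gt_0_nat[OF p] by (subst sum.insert, simp, simp)+ simp
  finally have binom: "(u + v) ^ p = v ^ p + (u ^ p + (\<Sum>k=1..<p. of_nat (p choose k) * u ^ k * v ^ (p - k)))" .
  have "[:int p:] dvd of_nat (p choose k) * u ^ k * v ^ (p - k)" if "k \<in> {1..<p}" for k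
  proof -
    have "p dvd p choose k" using that p by (intro dvd_choose_prime) auto
    then obtain j where "p choose k = p * j" by blast
    then have "(of_nat (p choose k) :: int poly) = [:int p:] * of_nat j"
      by (simp add: of_nat_poly)
    then show ?thesis by (simp only: mult.assoc dvd_triv_left)
  qed
  then have 1: "[:int p:] dvd (\<Sum>k=1..<p. of_nat (p choose k) * u ^ k * v ^ (p - k))"
    by (rule dvd_sum)
  have "int p dvd a ^ p - a"
  proof (cases "int p dvd a")
    case True
    then show ?thesis using prime_gt_0_nat[OF p] by (meson dvd_diff dvd_power dvd_trans)
  next
    case False
    have "[a ^ (p - 1) = 1] (mod int p)"
    proof -
      define b where "b = nat (a mod int p)"
      have b: "int b = a mod int p" using prime_gt_0_nat[OF p] by (simp add: b_def)
      have "\<not> p dvd b"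
        using False by (metis b dvd_mod_iff dvd_refl int_dvd_int_iff)
      then have "[b ^ (p - 1) = 1] (mod p)" using fermat_theorem[OF p] by blast
      then have "[int b ^ (p - 1) = 1] (mod int p)"
        by (metis cong_int_iff of_nat_1 of_nat_power)
      then show ?thesis unfolding b by (metis cong_def power_mod)
    qed
    then have "int p dvd a ^ (p - 1) - 1" by (simp add: cong_iff_dvd_diff)
    then have "int p dvd a * (a ^ (p - 1) - 1)" by (rule dvd_mult)
    moreover have "a * (a ^ (p - 1) - 1) = a ^ p - a"
      using prime_gt_0_nat[OF p] by (simp add: right_diff_distrib power_eq_if)
    ultimately show ?thesis by simp
  qed
  then have 2: "[:int p:] dvd u - u ^ p"
    unfolding u_def by (simp add: poly_const_pow const_poly_dvd_const_poly_iff dvd_diff_commute)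
  have v_pow: "v ^ p = monom 1 p * f ^ p"
  proof -
    have "v = monom 1 1 * f" by (simp add: v_def monom_Suc monom_0)
    then show ?thesis by (simp only: power_mult_distrib monom_power power_one mult_1)
  qed
  have comp: "pcompose (pCons a f) (monom 1 p) = u + monom 1 p * pcompose f (monom 1 p)"
    by (simp add: pcompose_pCons u_def)
  have "pcompose (pCons a f) (monom 1 p) - (pCons a f) ^ p =
      (u - u ^ p) + monom 1 p * (pcompose f (monom 1 p) - f ^ p) -
      (\<Sum>k=1..<p. of_nat (p choose k) * u ^ k * v ^ (p - k))"
    unfolding comp unfolding uv binom v_pow by (simp add: algebra_simps)
  then show ?case using dvd_diff[OF dvd_add[OF 2 dvd_mult[OF pCons.IH]] 1] by simp
qed

lemma primitive_minimal_poly_dvd: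
  fixes f g :: "int poly"
  assumes f: "content f = 1" and fz: "int_poly_eval f z = 0"
    and min: "\<And>h. h \<noteq> 0 \<Longrightarrow> int_poly_eval h z = 0 \<Longrightarrow> degree f \<le> degree h"
    and g: "int_poly_eval g z = 0"
  shows "f dvd g"
proof -
  have f0: "f \<noteq> 0" using f by auto
  obtain q r where qr: "pseudo_divmod g f = (q, r)" by (cases "pseudo_divmod g f")
  define c where "c = lead_coeff f ^ (Suc (degree g) - degree f)"
  have c0: "c \<noteq> 0" using f0 by (simp add: c_def)
  have eq: "smult c g = f * q + r" and r: "r = 0 \<or> degree r < degree f"
    using pseudo_divmod[OF f0 qr] by (auto simp: c_def)
  have "int_poly_eval (smult c g) z = int_poly_eval (f * q + r) z" using eq by simp
  then have "int_poly_eval r z = 0" using g fz by simp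
  then have "r = 0" using r min[of r] by fastforce
  then have eq: "smult c g = f * q" using eq by simp
  have "content (smult c g) = content f * content q" unfolding eq by (rule content_mult)
  then have "c dvd content q" using f by (metis content_smult dvd_mult2 dvd_normalize_iff dvd_refl mult_1 normalize_dvd_iff)
  then obtain q' where "q = [:c:] * q'" using const_poly_dvd_iff_dvd_content by blast
  then have "smult c g = smult c (f * q')" using eq by simp
  then have "smult c (g - f * q') = 0" by (simp only: smult_diff_right diff_self)
  then have "g = f * q'" using c0 by simp
  then show ?thesis by simp
qed

text \<open>Landau's argument. Let \<open>f\<close> be the primitive minimal polynomial of \<open>z\<close>. The remainder of \<open>f(X^k)\<close>
  modulo \<open>f\<close> depends only on \<open>k mod n\<close>, so all its coefficients are bounded by some \<open>B\<close>. For a prime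
  \<open>k = p\<close> they are divisible by \<open>p\<close>, because \<open>f(X^p)\<close> is congruent to \<open>f(X)^p\<close>; so they vanish for
  \<open>p > B\<close>. Finally \<open>a\<close> is congruent modulo \<open>n\<close> to a number without prime factors up to \<open>B\<close>.\<close>

lemma unity_root_conjugates_int:
  assumes n: "n \<ge> 1" and z: "z ^ n = 1" and cop: "coprime a n" and g: "int_poly_eval g z = 0"
  shows "int_poly_eval g (z ^ a) = 0"
proof -
  define P where "P h \<longleftrightarrow> h \<noteq> 0 \<and> int_poly_eval h z = 0" for h
  have xn: "int_poly_eval (monom 1 n - 1) z = 0" using z by simp
  have lcn: "degree (monom (1::int) n - 1) = n" "lead_coeff (monom (1::int) n - 1) = 1"
  proof -
    show d: "degree (monom (1::int) n - 1) = n"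
    proof (rule antisym)
      show "degree (monom (1::int) n - 1) \<le> n"
        by (rule degree_diff_le) (simp_all add: degree_monom_le)
      show "n \<le> degree (monom (1::int) n - 1)"
        by (rule le_degree) (use n in simp)
    qed
    show "lead_coeff (monom (1::int) n - 1) = 1" unfolding d using n by simp
  qed
  then have "P (monom 1 n - 1)" using xn by (auto simp: P_def)
  from ex_has_least_nat[of P _ degree, OF this]
  obtain f0 where f0: "P f0" "\<And>h. P h \<Longrightarrow> degree f0 \<le> degree h" by blast
  define f where "f = primitive_part f0"
  have f: "content f = 1" "degree f = degree f0" using f0(1) by (auto simp: f_def P_def)
  have "of_int (content f0) * int_poly_eval f z = int_poly_eval f0 z"
    unfolding f_def by (simp only: int_poly_eval_simps(3)[symmetric] content_times_primitive_part)
  then have fz: "int_poly_eval f z = 0" using f0(1) by (auto simp: P_def)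
  have min: "degree f \<le> degree h" if "h \<noteq> 0" "int_poly_eval h z = 0" for h
    using f0(2) f(2) that by (simp add: P_def)
  note dvd = primitive_minimal_poly_dvd[OF f(1) fz min]
  have fne: "f \<noteq> 0" using f(1) by auto
  have "f dvd monom 1 n - 1" by (rule dvd[OF _ _ xn])
  then have "lead_coeff f dvd 1"
    using lcn(2) by (metis dvd_def lead_coeff_mult)
  then have lcf: "lead_coeff f = 1 \<or> lead_coeff f = -1" by (auto simp: abs_if dest!: zdvd1_eq[THEN iffD1] split: if_splits)
  have rem: "\<exists>r. int_poly_eval r z = int_poly_eval h z \<and> (r = 0 \<or> degree r < degree f)" for h
  proof -
    obtain q r where qr: "pseudo_divmod h f = (q, r)" by (cases "pseudo_divmod h f")
    define c where "c = lead_coeff f ^ (Suc (degree h) - degree f)"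
    have cc: "c * c = 1"
      using lcf unfolding c_def power_mult_distrib[symmetric] by auto
    have eq: "smult c h = f * q + r" and r: "r = 0 \<or> degree r < degree f"
      using pseudo_divmod[OF fne qr] by (auto simp: c_def)
    have "int_poly_eval (smult c h) z = int_poly_eval (f * q + r) z" using eq by simp
    then have "of_int c * int_poly_eval h z = int_poly_eval r z" using fz by simp
    then have "of_int c * (of_int c * int_poly_eval h z) = int_poly_eval (smult c r) z" by simp
    moreover have "of_int c * (of_int c * int_poly_eval h z) = of_int (c * c) * int_poly_eval h z" by simp
    ultimately have "int_poly_eval (smult c r) z = int_poly_eval h z" using cc by simp
    moreover have "smult c r = 0 \<or> degree (smult c r) < degree f" using r by auto
    ultimately show ?thesis by blast
  qed
  have uniq: "r = s" if "int_poly_eval r z = int_poly_eval s z"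
    "r = 0 \<or> degree r < degree f" "s = 0 \<or> degree s < degree f" for r s
  proof (rule ccontr)
    assume "r \<noteq> s"
    then have "degree f \<le> degree (r - s)" using min[of "r - s"] that(1) by simp
    moreover have "degree (r - s) \<le> max (degree r) (degree s)" by (rule degree_diff_le_max)
    ultimately have "degree f = 0 \<and> r = 0 \<and> s = 0" using that(2,3) by (auto simp: max_def split: if_splits)
    then show False using \<open>r \<noteq> s\<close> by simp
  qed
  have "\<exists>R. \<forall>k. int_poly_eval (R k) z = int_poly_eval f (z ^ k) \<and> (R k = 0 \<or> degree (R k) < degree f)"
    (is "\<exists>R. \<forall>k. ?Q k (R k)")
  proof (rule choice, rule allI)
    fix k show "\<exists>r. ?Q k r" using rem[of "pcompose f (monom 1 k)"] by simp
  qed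
  then obtain R where R: "\<And>k. int_poly_eval (R k) z = int_poly_eval f (z ^ k)"
    "\<And>k. R k = 0 \<or> degree (R k) < degree f" by blast
  define B where "B = (\<Sum>k<n. \<Sum>i\<le>degree (R k). \<bar>coeff (R k) i\<bar>)"
  have B: "\<bar>coeff (R k) i\<bar> \<le> B" if "k < n" for k i
  proof (cases "i \<le> degree (R k)")
    case True
    have "\<bar>coeff (R k) i\<bar> \<le> (\<Sum>i\<le>degree (R k). \<bar>coeff (R k) i\<bar>)"
      by (rule member_le_sum) (use True in auto)
    also have "\<dots> \<le> B"
      unfolding B_def by (rule member_le_sum[of k "{..<n}" "\<lambda>k. \<Sum>i\<le>degree (R k). \<bar>coeff (R k) i\<bar>"])
        (use that in \<open>auto intro: sum_nonneg\<close>)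
    finally show ?thesis by simp
  next
    case False
    then show ?thesis by (simp add: coeff_eq_0 B_def sum_nonneg)
  qed
  define good where "good k \<longleftrightarrow> (\<forall>h. int_poly_eval h z = 0 \<longrightarrow> int_poly_eval h (z ^ k) = 0)" for k
  have good_mult: "good (k * l)" if "good k" "good l" for k l
    unfolding good_def
  proof (intro allI impI)
    fix h assume "int_poly_eval h z = 0"
    then have "int_poly_eval (pcompose h (monom 1 k)) z = 0" using \<open>good k\<close> by (simp add: good_def)
    then have "int_poly_eval (pcompose h (monom 1 k)) (z ^ l) = 0" using \<open>good l\<close> unfolding good_def by blast
    then show "int_poly_eval h (z ^ (k * l)) = 0" by (simp add: power_mult[symmetric] mult.commute)
  qed
  have good_prime: "good p" if p: "prime p" "int p > B" for p
  proof -
    obtain h where h: "pcompose f (monom 1 p) - f ^ p = [:int p:] * h"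
      using pcompose_monom_prime[OF p(1)] by blast
    obtain s where s: "int_poly_eval s z = int_poly_eval h z" "s = 0 \<or> degree s < degree f"
      using rem by blast
    have "int_poly_eval (pcompose f (monom 1 p) - f ^ p) z = int_poly_eval ([:int p:] * h) z"
      using h by simp
    then have fp: "int_poly_eval f (z ^ p) = of_nat p * int_poly_eval s z"
      using fz s(1) prime_gt_0_nat[OF p(1)] by (simp add: power_0_left)
    have "z ^ p = z ^ (n * (p div n) + p mod n)" by simp
    also have "\<dots> = z ^ (p mod n)" unfolding power_add power_mult z by simp
    finally have zp: "z ^ p = z ^ (p mod n)" .
    have "smult (int p) s = R (p mod n)"
    proof (rule uniq)
      show "int_poly_eval (smult (int p) s) z = int_poly_eval (R (p mod n)) z"
        using fp R(1)[of "p mod n"] zp by simp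
    qed (use s(2) R(2) in auto)
    have "R (p mod n) = 0"
    proof (rule poly_eqI)
      fix i
      have "int p dvd coeff (R (p mod n)) i"
        unfolding \<open>smult (int p) s = R (p mod n)\<close>[symmetric] by simp
      moreover have "\<bar>coeff (R (p mod n)) i\<bar> < int p" using B[of "p mod n" i] n p(2) by fastforce
      ultimately have "coeff (R (p mod n)) i = 0" by (meson dvd_imp_le_int not_le abs_of_nat zdvd_not_zless abs_dvd_iff zero_less_abs_iff dvd_abs_iff)
      then show "coeff (R (p mod n)) i = coeff 0 i" by simp
    qed
    then have "int_poly_eval f (z ^ p) = 0" using R(1)[of "p mod n"] zp by simp
    then show ?thesis
      unfolding good_def using dvd by (metis dvdE int_poly_eval_simps(5) mult_zero_left)
  qed
  have good_all: "good k" if "k > 0" "\<And>p. prime p \<Longrightarrow> p dvd k \<Longrightarrow> int p > B" for k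
    using that
  proof (induction k rule: less_induct)
    case (less k)
    show ?case
    proof (cases "k = 1")
      case True
      then show ?thesis by (simp add: good_def)
    next
      case False
      then obtain p where p: "prime p" "p dvd k" using prime_factor_nat by blast
      then obtain l where l: "k = p * l" by blast
      have "l < k" "l > 0" using l less.prems(1) prime_gt_1_nat[OF p(1)] by auto
      then have "good l" using less.IH less.prems(2) l by (metis dvd_mult)
      moreover have "good p" using good_prime less.prems(2) p by blast
      ultimately show ?thesis using good_mult l by blast
    qed
  qed
  define Q where "Q = {p. prime p \<and> int p \<le> B \<and> \<not> p dvd a}"
  have finQ: "finite Q" unfolding Q_def by (rule finite_subset[of _ "{..nat B}"]) auto
  define a' where "a' = a + n * \<Prod>Q"
  have "good a'"
  proof (rule good_all)
    show "a' > 0" using n finQ by (auto simp: a'_def Q_def prime_gt_0_nat intro!: prod_pos add_pos_pos)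
    fix q assume q: "prime q" "q dvd a'"
    show "int q > B"
    proof (rule ccontr)
      assume "\<not> int q > B"
      show False
      proof (cases "q dvd a")
        case True
        then have "\<not> q dvd n" using cop q(1) by (metis coprime_def not_prime_unit)
        moreover have "q dvd n * \<Prod>Q" using q(2) True unfolding a'_def by (simp add: dvd_add_right_iff)
        ultimately have "q dvd \<Prod>Q" using q(1) by (simp add: prime_dvd_mult_iff)
        then obtain p where "p \<in> Q" "q dvd p" using prime_dvd_prod_iff[OF finQ q(1), of "\<lambda>x. x"] by auto
        then have "q = p" using q(1) unfolding Q_def by (simp add: primes_dvd_imp_eq)
        then show False using \<open>p \<in> Q\<close> True by (simp add: Q_def)
      next
        case False
        then have "q \<in> Q" using q(1) \<open>\<not> int q > B\<close> by (simp add: Q_def)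
        then have "q dvd \<Prod>Q" using finQ by (metis dvd_prod_eqI)
        then have "q dvd a" using q(2) unfolding a'_def by (metis dvd_add_left_iff dvd_mult)
        then show False using False by simp
      qed
    qed
  qed
  moreover have "z ^ a' = z ^ a" unfolding a'_def power_add power_mult z by simp
  ultimately show ?thesis using g by (simp add: good_def)
qed

lemma unity_root_conjugates_rat:
  assumes "n \<ge> 1" "z ^ n = 1" "coprime a n" "poly_over \<rat> p" "poly p z = (0::complex)"
  shows "poly p (z ^ a) = 0"
proof -
  have "\<exists>d::int. d > 0 \<and> of_int d * x \<in> \<int>" if "x \<in> \<rat>" for x :: complex
  proof -
    obtain r where "x = of_rat r" using \<open>x \<in> \<rat>\<close> by (rule Rats_cases)
    obtain u v where "quotient_of r = (u, v)" by (cases "quotient_of r")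
    then have "v > 0" "r = of_int u / of_int v"
      by (auto simp: quotient_of_denom_pos quotient_of_div)
    then have "of_int v * x = of_int u" using \<open>x = of_rat r\<close> by (simp add: of_rat_divide)
    then show ?thesis using \<open>v > 0\<close> by (intro exI[of _ v]) simp
  qed
  then have "\<forall>i. \<exists>d::int. d > 0 \<and> of_int d * coeff p i \<in> \<int>"
    using assms(4) by (simp add: poly_over_def)
  then obtain d where d: "\<And>i. d i > (0::int)" "\<And>i. of_int (d i) * coeff p i \<in> \<int>" by metis
  define D where "D = (\<Prod>i\<le>degree p. d i)"
  have D0: "D > 0" unfolding D_def by (rule prod_pos) (use d in auto)
  have "coeff (smult (of_int D) p) i \<in> \<int>" for i
  proof (cases "i \<le> degree p")
    case True
    then have "D = d i * (\<Prod>j\<in>{..degree p} - {i}. d j)" unfolding D_def by (subst prod.remove) auto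
    then have "of_int D * coeff p i = of_int (\<Prod>j\<in>{..degree p} - {i}. d j) * (of_int (d i) * coeff p i)"
      by (simp add: mult_ac)
    then show ?thesis unfolding coeff_smult by (simp only: Ints_mult[OF Ints_of_int d(2)])
  next
    case False
    then show ?thesis by (simp add: coeff_eq_0)
  qed
  then obtain g where g: "smult (of_int D) p = map_poly of_int g" by (rule intpolyE)
  have gz: "int_poly_eval g x = of_int D * poly p x" for x unfolding g[symmetric] by simp
  have "int_poly_eval g (z ^ a) = 0"
    by (rule unity_root_conjugates_int[OF assms(1-3)]) (simp add: gz assms(5))
  then show ?thesis using D0 by (simp add: gz)
qed

section \<open>The maximal cyclotomic field\<close>

interpretation rat_cx: vector_space "\<lambda>(q::rat) (x::complex). of_rat q * x"
  by unfold_locales (simp_all add: algebra_simps of_rat_add of_rat_mult)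

interpretation rat_cx_pair: vector_space_pair
  "\<lambda>(q::rat) (x::complex). of_rat q * x" "\<lambda>(q::rat) (x::complex). of_rat q * x" ..

abbreviation rat_span :: "complex set \<Rightarrow> complex set" where
  "rat_span \<equiv> rat_cx.span"

definition mult_submonoid :: "complex set \<Rightarrow> bool" where
  "mult_submonoid M \<longleftrightarrow> 1 \<in> M \<and> (\<forall>x\<in>M. \<forall>y\<in>M. x * y \<in> M)"

lemma mult_submonoid_power: "mult_submonoid M \<Longrightarrow> x \<in> M \<Longrightarrow> x ^ n \<in> M"
  by (induction n) (auto simp: mult_submonoid_def)

lemma subfield_set_Rats: "subfield_set (\<rat> :: complex set)"
  by (simp add: subfield_set_def)

lemma Rats_subset_rat_span:
  assumes "mult_submonoid M"
  shows "\<rat> \<subseteq> rat_span M"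
proof
  fix x :: complex assume "x \<in> \<rat>"
  then obtain q where "x = of_rat q" by (rule Rats_cases)
  moreover have "of_rat q * 1 \<in> rat_span M"
    using assms by (intro rat_cx.span_scale rat_cx.span_base) (simp add: mult_submonoid_def)
  ultimately show "x \<in> rat_span M" by simp
qed

lemma subring_set_rat_span:
  assumes M: "mult_submonoid M"
  shows "subring_set (rat_span M)"
proof -
  have 1: "x * y \<in> rat_span M" if "x \<in> M" "y \<in> rat_span M" for x y
    using that(2)
  proof (induction y rule: rat_cx.span_induct_alt)
    case base
    then show ?case by (simp add: rat_cx.span_zero)
  next
    case (step c z y)
    have "x * z \<in> M" using step(1) that(1) M by (simp add: mult_submonoid_def)
    then have "of_rat c * (x * z) + x * y \<in> rat_span M"
      by (rule rat_cx.span_add[OF rat_cx.span_scale[OF rat_cx.span_base] step(2)])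
    then show ?case by (simp add: algebra_simps)
  qed
  have 2: "x * y \<in> rat_span M" if "x \<in> rat_span M" "y \<in> rat_span M" for x y
    using that(1)
  proof (induction x rule: rat_cx.span_induct_alt)
    case base
    then show ?case by (simp add: rat_cx.span_zero)
  next
    case (step c z x)
    have "of_rat c * (z * y) + x * y \<in> rat_span M"
      using step 1 that(2) by (intro rat_cx.span_add rat_cx.span_scale) auto
    then show ?case by (simp add: algebra_simps)
  qed
  show ?thesis
    unfolding subring_set_def
    using M 2 by (auto simp: rat_cx.span_zero rat_cx.span_diff mult_submonoid_def intro: rat_cx.span_base)
qed

lemma rat_span_minimal:
  assumes "subring_set V" "\<rat> \<subseteq> V" "M \<subseteq> V"
  shows "rat_span M \<subseteq> V"
proof
  fix x assume "x \<in> rat_span M"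
  then show "x \<in> V"
  proof (induction x rule: rat_cx.span_induct_alt)
    case base
    show ?case by (rule subring_set_closed(1)[OF assms(1)])
  next
    case (step c x y)
    have "of_rat c \<in> V" using assms(2) by auto
    then show ?case using step assms subring_set_closed(4,6)[OF assms(1)] by blast
  qed
qed

lemma subfield_set_rat_span:
  assumes M: "mult_submonoid M" and rad: "\<And>x. x \<in> M \<Longrightarrow> \<exists>n\<ge>1. x ^ n \<in> \<rat>"
  shows "subfield_set (rat_span M)"
proof -
  note R = subring_set_rat_span[OF M]
  have "inverse y \<in> rat_span M" if y: "y \<in> rat_span M" for y
  proof -
    obtain T c where T: "finite T" "T \<subseteq> M" "y = (\<Sum>a\<in>T. of_rat (c a) * a)"
      using y unfolding rat_cx.span_explicit by blast
    have alg: "algebraic_over \<rat> x" if x: "x \<in> T" for x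
    proof -
      obtain n where "n \<ge> 1" "x ^ n \<in> \<rat>" using rad[of x] x T(2) by auto
      then show ?thesis by (rule algebraic_over_root[OF subfield_set_Rats])
    qed
    have hom_id: "hom_on \<rat> id" by (simp add: hom_on_def)
    obtain E \<sigma> where E: "subfield_set E" "\<rat> \<subseteq> E" "T \<subseteq> E" "hom_on E \<sigma>"
      "\<And>z. z \<in> \<rat> \<Longrightarrow> \<sigma> z = id z"
      "\<And>V. subring_set V \<Longrightarrow> \<rat> \<subseteq> V \<Longrightarrow> T \<subseteq> V \<Longrightarrow> E \<subseteq> V"
      using hom_on_extend_finite[OF subfield_set_Rats hom_id T(1) alg] by metis
    have "y \<in> E" unfolding T(3)
      using E(2,3) by (intro subring_set_sum subring_set_closed(4) subfield_set_imp_subring_set E(1)) auto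
    then have "inverse y \<in> E" using E(1) by (rule subfield_set_inverse[rotated])
    moreover have "E \<subseteq> rat_span M"
      using T(2) rat_cx.span_superset by (intro E(6) R Rats_subset_rat_span M) blast
    ultimately show ?thesis by blast
  qed
  then show ?thesis using R by (simp add: subfield_set_def subring_set_def)
qed

definition preserves_relations :: "complex set \<Rightarrow> (complex \<Rightarrow> complex) \<Rightarrow> bool" where
  "preserves_relations M \<sigma> \<longleftrightarrow> (\<forall>T (c :: complex \<Rightarrow> rat). finite T \<longrightarrow> T \<subseteq> M \<longrightarrow>
     (\<Sum>x\<in>T. of_rat (c x) * x) = 0 \<longrightarrow> (\<Sum>x\<in>T. of_rat (c x) * \<sigma> x) = 0)"

lemma rat_span_hom_exists:
  assumes M: "mult_submonoid M" and \<sigma>1: "\<sigma> 1 = 1"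
    and mult: "\<And>x y. x \<in> M \<Longrightarrow> y \<in> M \<Longrightarrow> \<sigma> (x * y) = \<sigma> x * \<sigma> y"
    and rel: "preserves_relations M \<sigma>"
  obtains f where "hom_on (rat_span M) f" "\<And>x. x \<in> M \<Longrightarrow> f x = \<sigma> x"
    "\<And>q. q \<in> \<rat> \<Longrightarrow> f q = q" "f ` rat_span M = rat_span (\<sigma> ` M)"
proof -
  obtain B where B: "B \<subseteq> M" "rat_cx.independent B" "M \<subseteq> rat_span B"
    by (rule rat_cx.maximal_independent_subset)
  obtain f where f: "Vector_Spaces.linear (\<lambda>(q::rat) (x::complex). of_rat q * x) (\<lambda>(q::rat) (x::complex). of_rat q * x) f"
    "\<forall>x\<in>B. f x = \<sigma> x"
    using rat_cx_pair.linear_independent_extend[OF B(2), of \<sigma>] by blast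
  have add: "f (x + y) = f x + f y" and scale: "f (of_rat c * x) = of_rat c * f x" for x y c
    using f(1) unfolding Vector_Spaces.linear_iff by blast+
  have f0: "f 0 = 0" using scale[of 0 0] by simp
  have fsum: "f (\<Sum>a\<in>T. of_rat (c a) * a) = (\<Sum>a\<in>T. of_rat (c a) * f a)" for T and c :: "complex \<Rightarrow> rat"
    by (induction T rule: infinite_finite_induct) (simp_all add: f0 add scale)
  have fM: "f x = \<sigma> x" if x: "x \<in> M" for x
  proof (cases "x \<in> B")
    case True
    then show ?thesis using f(2) by blast
  next
    case False
    obtain T c where T: "finite T" "T \<subseteq> B" "x = (\<Sum>a\<in>T. of_rat (c a) * a)"
      using x B(3) unfolding rat_cx.span_explicit by blast
    define d where "d = c(x := -1)"
    have xT: "x \<notin> T" using False T(2) by blast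
    have d: "(\<Sum>a\<in>T. of_rat (d a) * g a) = (\<Sum>a\<in>T. of_rat (c a) * g a)" for g :: "complex \<Rightarrow> complex"
      using xT by (intro sum.cong) (auto simp: d_def)
    have "(\<Sum>a\<in>insert x T. of_rat (d a) * a) = 0"
      using T(1,3) xT d[of "\<lambda>a. a"] by (simp add: d_def)
    moreover have "insert x T \<subseteq> M" "finite (insert x T)" using x T(1,2) B(1) by auto
    ultimately have "(\<Sum>a\<in>insert x T. of_rat (d a) * \<sigma> a) = 0"
      using rel unfolding preserves_relations_def by blast
    then have "\<sigma> x = (\<Sum>a\<in>T. of_rat (c a) * \<sigma> a)"
      using T(1) xT d[of \<sigma>] by (simp add: d_def)
    also have "\<dots> = (\<Sum>a\<in>T. of_rat (c a) * f a)" using T(2) f(2) by (intro sum.cong) auto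
    also have "\<dots> = f x" unfolding fsum[symmetric] T(3)[symmetric] ..
    finally show ?thesis by simp
  qed
  have fmult1: "f (x * y) = f x * f y" if "x \<in> M" "y \<in> rat_span M" for x y
    using that(2)
  proof (induction y rule: rat_cx.span_induct_alt)
    case (step c z y)
    have "f (x * (of_rat c * z + y)) = f (of_rat c * (x * z) + x * y)" by (simp add: algebra_simps)
    also have "\<dots> = of_rat c * f (x * z) + f x * f y" by (simp only: add scale step)
    also have "f (x * z) = f x * f z" using fM that(1) step(1) mult M by (simp add: mult_submonoid_def)
    finally have eq: "f (x * (of_rat c * z + y)) = of_rat c * (f x * f z) + f x * f y" .
    show ?case unfolding eq add scale by (simp only: distrib_left mult.left_commute)
  qed (simp add: f0)
  have fmult: "f (x * y) = f x * f y" if "x \<in> rat_span M" "y \<in> rat_span M" for x y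
    using that(1)
  proof (induction x rule: rat_cx.span_induct_alt)
    case (step c z x)
    have "f ((of_rat c * z + x) * y) = f (of_rat c * (z * y) + x * y)" by (simp add: algebra_simps)
    also have "\<dots> = of_rat c * f (z * y) + f x * f y" by (simp only: add scale step)
    also have "f (z * y) = f z * f y" by (rule fmult1[OF step(1) that(2)])
    finally have eq: "f ((of_rat c * z + x) * y) = of_rat c * (f z * f y) + f x * f y" .
    show ?case unfolding eq add scale by (simp only: distrib_right mult.assoc)
  qed (simp add: f0)
  have f1: "f 1 = 1" using fM[of 1] \<sigma>1 M by (simp add: mult_submonoid_def)
  have "hom_on (rat_span M) f" unfolding hom_on_def using f1 add fmult by blast
  moreover have "f q = q" if q: "q \<in> \<rat>" for q
  proof -
    obtain r where "q = of_rat r" using q by (rule Rats_cases)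
    then show ?thesis using scale[of r 1] f1 by simp
  qed
  moreover have "f ` rat_span M = rat_span (f ` M)"
    using rat_cx_pair.linear_span_image[OF f(1)] by simp
  then have "f ` rat_span M = rat_span (\<sigma> ` M)" using fM by (simp cong: image_cong)
  ultimately show ?thesis using that fM by blast
qed

lemma hom_on_rat_span_eq:
  assumes M: "mult_submonoid M" and f: "hom_on (rat_span M) f" "\<And>q. q \<in> \<rat> \<Longrightarrow> f q = q"
    and g: "hom_on (rat_span M) g" "\<And>q. q \<in> \<rat> \<Longrightarrow> g q = q"
    and eq: "\<And>x. x \<in> M \<Longrightarrow> f x = g x" and x: "x \<in> rat_span M"
  shows "f x = g x"
proof -
  have "x \<in> rat_span M \<and> f x = g x"
    using x
  proof (induction x rule: rat_cx.span_induct_alt)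
    case base
    show ?case using f(2)[of 0] g(2)[of 0] by (simp add: rat_cx.span_zero)
  next
    case (step c x y)
    have q: "of_rat c \<in> rat_span M" using Rats_subset_rat_span[OF M] by auto
    have xm: "x \<in> rat_span M" using step(1) by (rule rat_cx.span_base)
    have qx: "of_rat c * x \<in> rat_span M" using xm by (rule rat_cx.span_scale)
    have y: "y \<in> rat_span M" "f y = g y" using step(2) by auto
    have "f (of_rat c * x + y) = of_rat c * f x + f y"
      using hom_on_simps(2)[OF f(1) qx y(1)] hom_on_simps(3)[OF f(1) q xm] f(2)[of "of_rat c"] by simp
    moreover have "g (of_rat c * x + y) = of_rat c * g x + g y"
      using hom_on_simps(2)[OF g(1) qx y(1)] hom_on_simps(3)[OF g(1) q xm] g(2)[of "of_rat c"] by simp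
    ultimately show ?case using eq[OF step(1)] y qx by (simp add: rat_cx.span_add)
  qed
  then show ?thesis by blast
qed

definition unity_zeta :: "nat \<Rightarrow> complex" where
  "unity_zeta n = exp (2 * of_real pi * \<i> / of_nat n)"

lemma unity_zeta_power: "unity_zeta n ^ k = exp (2 * of_real pi * \<i> * of_nat k / of_nat n)"
  unfolding unity_zeta_def exp_of_nat_mult[symmetric] by (simp add: mult_ac)

lemma unity_zeta_power_eq_1_iff: "n \<ge> 1 \<Longrightarrow> unity_zeta n ^ k = 1 \<longleftrightarrow> n dvd k"
  unfolding unity_zeta_power by (rule complex_root_unity_eq_1)

lemma root_unity_zeta_power:
  assumes "n \<ge> 1" "x ^ n = 1"
  obtains k where "x = unity_zeta n ^ k"
proof -
  have "x \<in> {exp(2 * of_real pi * \<i> * of_nat j / of_nat n) | j. j < n}"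
    using complex_roots_unity[OF assms(1)] assms(2) by blast
  then show ?thesis using that unfolding unity_zeta_power by blast
qed

lemma unity_zeta_in: "n \<ge> 1 \<Longrightarrow> unity_zeta n \<in> unity_roots"
  using unity_zeta_power_eq_1_iff[of n n] by (auto simp: unity_roots_def)

lemma finite_unity_roots_common_zeta:
  assumes "finite T" "T \<subseteq> unity_roots"
  obtains n where "n \<ge> 1" "\<And>x. x \<in> T \<Longrightarrow> \<exists>k. x = unity_zeta n ^ k"
proof -
  have "\<exists>n\<ge>1. \<forall>x\<in>T. x ^ n = 1"
    using assms
  proof (induction T rule: finite_induct)
    case empty
    show ?case by auto
  next
    case (insert x T)
    then obtain n where n: "n \<ge> 1" "\<forall>x\<in>T. x ^ n = 1" by blast
    obtain m where m: "m \<ge> 1" "x ^ m = 1" using insert.prems by (auto simp: unity_roots_def)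
    have "x ^ (m * n) = 1" using m(2) by (simp add: power_mult)
    moreover have "\<forall>y\<in>T. y ^ (m * n) = 1" using n(2) by (simp add: mult.commute[of m] power_mult)
    ultimately have "\<forall>y\<in>insert x T. y ^ (m * n) = 1" by blast
    then show ?case using m(1) n(1) by (intro exI[of _ "m * n"]) auto
  qed
  then show ?thesis using that root_unity_zeta_power by metis
qed

lemma mult_submonoid_unity_roots: "mult_submonoid unity_roots"
  unfolding mult_submonoid_def
proof (intro conjI ballI)
  show "1 \<in> unity_roots" by (auto simp: unity_roots_def)
  fix x y assume "x \<in> unity_roots" "y \<in> unity_roots"
  then obtain m n where mn: "m \<ge> 1" "x ^ m = 1" "n \<ge> 1" "y ^ n = 1" by (auto simp: unity_roots_def)
  have "(x * y) ^ (m * n) = (x ^ m) ^ n * (y ^ n) ^ m"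
    by (simp add: power_mult_distrib power_mult[symmetric] mult.commute)
  then show "x * y \<in> unity_roots" using mn unfolding unity_roots_def by (intro CollectI exI[of _ "m * n"]) auto
qed

abbreviation cyclotomic_field :: "complex set" where
  "cyclotomic_field \<equiv> rat_span unity_roots"

lemma subfield_set_cyclotomic: "subfield_set cyclotomic_field"
proof (rule subfield_set_rat_span[OF mult_submonoid_unity_roots])
  fix x assume "x \<in> unity_roots"
  then obtain n where n: "n \<ge> 1" "x ^ n = 1" by (auto simp: unity_roots_def)
  show "\<exists>n\<ge>1. x ^ n \<in> \<rat>" using n by (intro exI[of _ n]) simp
qed

lemma unity_roots_subset_cyclotomic: "unity_roots \<subseteq> cyclotomic_field"
  by (rule rat_cx.span_superset)

lemma unity_roots_preserves_relations:
  assumes mult: "\<And>x y. x \<in> unity_roots \<Longrightarrow> y \<in> unity_roots \<Longrightarrow> \<sigma> (x * y) = \<sigma> x * \<sigma> y"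
    and inj: "inj_on \<sigma> unity_roots" and nz: "\<sigma> 1 \<noteq> 0"
  shows "preserves_relations unity_roots \<sigma>"
  unfolding preserves_relations_def
proof (intro allI impI)
  fix T and c :: "complex \<Rightarrow> rat"
  assume T: "finite T" "T \<subseteq> unity_roots" and sum0: "(\<Sum>x\<in>T. of_rat (c x) * x) = 0"
  note U = mult_submonoid_unity_roots
  have U1: "1 \<in> unity_roots" using U by (simp add: mult_submonoid_def)
  obtain n where n: "n \<ge> 1" "\<And>x. x \<in> T \<Longrightarrow> \<exists>k. x = unity_zeta n ^ k"
    using finite_unity_roots_common_zeta[OF T] by metis
  then obtain k where k: "\<And>x. x \<in> T \<Longrightarrow> x = unity_zeta n ^ k x" by metis
  define z where "z = unity_zeta n"
  have z: "z \<in> unity_roots" unfolding z_def by (rule unity_zeta_in[OF n(1)])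
  have \<sigma>1: "\<sigma> 1 = 1" using mult[OF U1 U1] nz by simp
  have pow: "\<sigma> (z ^ j) = \<sigma> z ^ j" for j
    by (induction j) (simp_all add: \<sigma>1 mult z mult_submonoid_power[OF U])
  have zn: "z ^ n = 1" unfolding z_def using unity_zeta_power_eq_1_iff[OF n(1)] by simp
  then have "\<sigma> z ^ n = 1" using pow[of n] \<sigma>1 by simp
  then obtain a where a: "\<sigma> z = z ^ a" unfolding z_def by (rule root_unity_zeta_power[OF n(1)])
  have "coprime a n"
  proof -
    define d where "d = gcd a n"
    have d: "d dvd a" "d dvd n" "d > 0" using n(1) by (auto simp: d_def)
    obtain a' n' where an: "a = d * a'" "n = d * n'" using d(1,2) by (auto simp: dvd_def)
    have "\<sigma> (z ^ n') = z ^ (a * n')" by (simp add: pow a power_mult)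
    also have "a * n' = n * a'" by (simp add: an)
    also have "z ^ (n * a') = \<sigma> 1" by (simp add: power_mult zn \<sigma>1)
    finally have "z ^ n' = 1"
      using inj z U1 mult_submonoid_power[OF U z] by (meson inj_onD)
    then have "n dvd n'" unfolding z_def using unity_zeta_power_eq_1_iff[OF n(1)] by simp
    then have "d * n' dvd 1 * n'" using an(2) by simp
    moreover have "n' \<noteq> 0" using an(2) n(1) by auto
    ultimately have "d dvd 1" by (simp add: dvd_times_right_cancel_iff)
    then have "gcd a n = 1" unfolding d_def by simp
    then show ?thesis unfolding coprime_iff_gcd_eq_1 .
  qed
  define p where "p = (\<Sum>x\<in>T. monom (of_rat (c x) :: complex) (k x))"
  note R = subfield_set_imp_subring_set[OF subfield_set_Rats]
  have p: "poly_over \<rat> p" unfolding p_def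
    by (intro poly_over_sum R poly_over_intros) auto
  have ev: "poly p y = (\<Sum>x\<in>T. of_rat (c x) * y ^ k x)" for y
    by (simp add: p_def poly_sum poly_monom)
  have "poly p z = (\<Sum>x\<in>T. of_rat (c x) * x)"
    unfolding ev using k by (intro sum.cong) (auto simp: z_def[symmetric])
  then have "poly p (z ^ a) = 0"
    using sum0 by (intro unity_root_conjugates_rat[OF n(1) zn \<open>coprime a n\<close> p]) simp
  moreover have "poly p (z ^ a) = (\<Sum>x\<in>T. of_rat (c x) * \<sigma> x)"
  proof -
    have "\<sigma> x = \<sigma> z ^ k x" if "x \<in> T" for x using pow[of "k x"] k[OF that] unfolding z_def by metis
    then show ?thesis unfolding ev a[symmetric] by (intro sum.cong) auto
  qed
  ultimately show "(\<Sum>x\<in>T. of_rat (c x) * \<sigma> x) = 0" by simp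
qed

text \<open>Conjugation acts on roots of unity as a power map, so it commutes with all automorphisms of the
  cyclotomic field, and these multiply \<open>x\<close> by a root of unity. Hence \<open>x * cnj x\<close> is fixed by all of them.\<close>

lemma cyclotomic_radical_norm_rat:
  assumes x: "x \<in> cyclotomic_field" and xn: "n \<ge> 1" "x ^ n \<in> \<rat>"
  shows "x * cnj x \<in> \<rat>"
proof -
  note R = subfield_set_imp_subring_set[OF subfield_set_Rats]
  obtain T c where T: "finite T" "T \<subseteq> unity_roots" "x = (\<Sum>a\<in>T. of_rat (c a) * a)"
    using x unfolding rat_cx.span_explicit by blast
  obtain N where N: "N \<ge> 1" "\<And>x. x \<in> T \<Longrightarrow> \<exists>k. x = unity_zeta N ^ k"
    using finite_unity_roots_common_zeta[OF T(1,2)] by metis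
  then obtain k where k: "\<And>x. x \<in> T \<Longrightarrow> x = unity_zeta N ^ k x" by metis
  define z where "z = unity_zeta N"
  have zN: "z ^ N = 1" unfolding z_def using unity_zeta_power_eq_1_iff[OF N(1)] by simp
  define h where "h = (\<Sum>a\<in>T. monom (of_rat (c a) :: complex) (k a))"
  have h: "poly_over \<rat> h" unfolding h_def by (intro poly_over_sum R poly_over_intros) auto
  have hz: "poly h z = x"
    unfolding T(3) h_def using k by (simp add: poly_sum poly_monom z_def[symmetric])
  define u where "u = monom (1::complex) N - [:1:]"
  have u: "poly_over \<rat> u" unfolding u_def by (intro poly_over_intros R) auto
  have "poly u z = 0" by (simp add: u_def poly_monom zN)
  have "algebraic_over \<rat> z" by (rule algebraic_over_root[OF subfield_set_Rats N(1)]) (simp add: zN)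
  then obtain m where m: "minimal_poly \<rat> z m" by (rule minimal_poly_exists)
  have m0: "m \<noteq> 0" using m by (simp add: minimal_poly_def)
  have roots: "poly p w = 0" if "poly_over \<rat> p" "poly p z = 0" "poly m w = 0" for p w
    using minimal_poly_dvd[OF subfield_set_Rats m that(1,2)] that(3) by (metis mult_zero_left poly_mult)
  obtain s where s: "u = m * s" using minimal_poly_dvd[OF subfield_set_Rats m u \<open>poly u z = 0\<close>] by blast
  have wN: "w ^ N = 1" if "poly m w = 0" for w
    using roots[OF u \<open>poly u z = 0\<close> that] by (simp add: u_def poly_monom)
  have "rsquarefree m"
    unfolding rsquarefree_roots
  proof (intro allI notI)
    fix a assume a: "poly m a = 0 \<and> poly (pderiv m) a = 0"
    have "poly (pderiv u) a = 0" unfolding s pderiv_mult using a by simp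
    then have "of_nat N * a ^ (N - 1) = 0"
      by (simp add: u_def pderiv_diff pderiv_monom poly_monom pderiv_pCons)
    then have "a = 0" using N(1) by auto
    then show False using wN[of a] a N(1) by (simp add: power_0_left)
  qed
  define D where "D = {w. poly m w = 0}"
  have finD: "finite D" unfolding D_def by (rule poly_roots_finite[OF m0])
  have "degree m = degree (\<Prod>w\<in>D. [:-w, 1:])"
    using complex_poly_decompose_rsquarefree[OF \<open>rsquarefree m\<close>] m0 unfolding D_def
    by (metis degree_smult_eq leading_coeff_0_iff)
  also have "\<dots> = card D" by (subst degree_prod_eq_sum_degree) auto
  finally have cardD: "card D = degree m" by simp
  define H where "H = h * pcompose h (monom 1 (N - 1))"
  have "poly_over \<rat> H" unfolding H_def
    by (intro poly_over_intros poly_over_pcompose R h) auto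
  moreover have "poly_over \<rat> m" using m by (simp add: minimal_poly_def)
  ultimately obtain q r where qr: "poly_over \<rat> q" "poly_over \<rat> r" "H = m * q + r" "r = 0 \<or> degree r < degree m"
    using poly_over_division[OF subfield_set_Rats] m0 by metis
  have Hw: "poly H w = x * cnj x" if w: "poly m w = 0" for w
  proof -
    have "norm w = 1" using wN[OF w] N(1) by (metis norm_one norm_power power_eq_1_iff not_one_le_zero norm_ge_zero)
    then have "w * cnj w = 1" by (simp add: complex_norm_square[symmetric])
    moreover have "w * w ^ (N - 1) = 1" using wN[OF w] N(1) by (simp add: power_eq_if)
    ultimately have "cnj w = w ^ (N - 1)" by (metis mult_cancel_left mult_zero_left zero_neq_one)
    moreover have "cnj (poly h w) = poly h (cnj w)"
    proof -
      have "cnj (of_rat q) = of_rat q" for q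
      proof -
        obtain a b where "quotient_of q = (a, b)" by (cases "quotient_of q")
        then have "q = of_int a / of_int b" by (rule quotient_of_div)
        then show ?thesis by (simp add: of_rat_divide)
      qed
      then show ?thesis unfolding h_def by (simp add: poly_sum poly_monom)
    qed
    ultimately have 1: "poly H w = poly h w * cnj (poly h w)"
      by (simp add: H_def poly_pcompose poly_monom)
    have "poly_over \<rat> (h ^ n - [:x ^ n:])" using xn(2) by (intro poly_over_intros poly_over_power R h)
    moreover have "poly (h ^ n - [:x ^ n:]) z = 0" by (simp add: hz)
    ultimately have "poly (h ^ n - [:x ^ n:]) w = 0" using roots w by blast
    then have "poly h w ^ n = x ^ n" by simp
    then have "norm (poly h w) ^ n = norm x ^ n" by (metis norm_power)
    then have "norm (poly h w) = norm x" using xn(1) by (simp add: power_eq_iff_eq_base)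
    then show ?thesis unfolding 1 by (simp add: complex_norm_square[symmetric])
  qed
  have "r - [:x * cnj x:] = 0"
  proof (rule ccontr)
    assume nz: "r - [:x * cnj x:] \<noteq> 0"
    have "poly (r - [:x * cnj x:]) w = 0" if "w \<in> D" for w
      using Hw[of w] that unfolding D_def qr(3) by simp
    then have "card D \<le> card {w. poly (r - [:x * cnj x:]) w = 0}"
      by (intro card_mono poly_roots_finite[OF nz]) auto
    also have "\<dots> \<le> degree (r - [:x * cnj x:])" by (rule card_poly_roots_bound[OF nz])
    also have "\<dots> \<le> max (degree r) (degree [:x * cnj x:])" by (rule degree_diff_le_max)
    also have "\<dots> < degree m" using qr(4) minimal_poly_degree_pos[OF m] by auto
    finally show False using cardD by simp
  qed
  then have "coeff r 0 = x * cnj x" by simp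
  then show ?thesis using qr(2) unfolding poly_over_def by metis
qed

section \<open>The defect of an automorphism on the radicals in the cyclotomic field\<close>

lemma aut_fixing_rats_carrier:
  assumes "0 \<notin> M"
  shows "\<sigma> \<in> carrier (aut_fixing_rats M) \<longleftrightarrow> \<sigma> \<in> extensional M \<and> bij_betw \<sigma> M M \<and>
    (\<forall>x\<in>M. \<forall>y\<in>M. \<sigma> (x * y) = \<sigma> x * \<sigma> y) \<and> (\<forall>x\<in>M \<inter> \<rat>. \<sigma> x = x)"
  by (auto simp: aut_fixing_rats_def Let_def auto_def hom_def Bij_def ring_of_type_algebra_def
      bij_betw_def)

lemma aut_fixing_rats_mult:
  assumes "\<sigma> \<in> carrier (aut_fixing_rats M)" "\<tau> \<in> carrier (aut_fixing_rats M)"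
  shows "\<sigma> \<otimes>\<^bsub>aut_fixing_rats M\<^esub> \<tau> = compose M \<sigma> \<tau>"
  using assms by (auto simp: aut_fixing_rats_def Let_def auto_def AutoGroup_def BijGroup_def)

lemma aut_fixing_rats_one: "\<one>\<^bsub>aut_fixing_rats M\<^esub> = (\<lambda>x\<in>M. x)"
  by (simp add: aut_fixing_rats_def Let_def AutoGroup_def BijGroup_def)

locale rational_group =
  fixes \<Gamma> :: "complex set"
  assumes zero_notin: "0 \<notin> \<Gamma>" and one_in: "1 \<in> \<Gamma>"
    and mult_in: "\<And>x y. x \<in> \<Gamma> \<Longrightarrow> y \<in> \<Gamma> \<Longrightarrow> x * y \<in> \<Gamma>"
    and inverse_in: "\<And>x. x \<in> \<Gamma> \<Longrightarrow> inverse x \<in> \<Gamma>"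
    and rational: "\<Gamma> \<subseteq> \<rat>"
begin

lemma power_in: "x \<in> \<Gamma> \<Longrightarrow> x ^ n \<in> \<Gamma>"
  by (induction n) (auto intro: one_in mult_in)

abbreviation R :: "complex set" where "R \<equiv> radicals \<Gamma>"

abbreviation RA :: "(complex \<Rightarrow> complex) set" where "RA \<equiv> carrier (aut_fixing_rats R)"

lemma radicals_nonzero: "x \<in> R \<Longrightarrow> x \<noteq> 0"
  by (simp add: radicals_def)

lemma zero_notin_radicals: "0 \<notin> R"
  by (simp add: radicals_def)

lemma radicals_mult:
  assumes "x \<in> R" "y \<in> R"
  shows "x * y \<in> R"
proof -
  obtain m where m: "m \<ge> 1" "x ^ m \<in> \<Gamma>" "x \<noteq> 0" using assms(1) by (auto simp: radicals_def)
  obtain n where n: "n \<ge> 1" "y ^ n \<in> \<Gamma>" "y \<noteq> 0" using assms(2) by (auto simp: radicals_def)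
  have "(x * y) ^ (m * n) = (x ^ m) ^ n * (y ^ n) ^ m"
    by (simp add: power_mult_distrib power_mult[symmetric] mult.commute)
  then have "(x * y) ^ (m * n) \<in> \<Gamma>" using m(2) n(2) by (simp add: mult_in power_in)
  then show ?thesis using m(1,3) n(1,3) unfolding radicals_def
    by (intro CollectI conjI exI[of _ "m * n"]) auto
qed

lemma radicals_inverse: "x \<in> R \<Longrightarrow> inverse x \<in> R"
  by (auto simp: radicals_def power_inverse intro: inverse_in)

lemma radicals_divide: "x \<in> R \<Longrightarrow> y \<in> R \<Longrightarrow> x / y \<in> R"
  by (simp add: divide_inverse radicals_mult radicals_inverse)

lemma unity_roots_subset_radicals: "unity_roots \<subseteq> R"
  using one_in by (auto simp: unity_roots_def radicals_def power_0_left)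

lemma one_in_radicals: "1 \<in> R"
  using unity_roots_subset_radicals mult_submonoid_unity_roots by (auto simp: mult_submonoid_def)

lemma mult_submonoid_radicals: "mult_submonoid R"
  by (simp add: mult_submonoid_def one_in_radicals radicals_mult)

lemma radicals_power: "x \<in> R \<Longrightarrow> x ^ n \<in> R"
  by (rule mult_submonoid_power[OF mult_submonoid_radicals])

lemma subset_radicals: "\<Gamma> \<subseteq> R"
proof
  fix x assume "x \<in> \<Gamma>"
  then show "x \<in> R" using zero_notin unfolding radicals_def by (intro CollectI conjI exI[of _ 1]) auto
qed

lemma radicals_saturated:
  assumes "x \<noteq> 0" "n \<ge> 1" "x ^ n \<in> R"
  shows "x \<in> R"
proof -
  obtain m where "m \<ge> 1" "(x ^ n) ^ m \<in> \<Gamma>" using assms(3) by (auto simp: radicals_def)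
  then show ?thesis using assms(1,2) unfolding radicals_def
    by (intro CollectI conjI exI[of _ "n * m"]) (auto simp: power_mult)
qed

lemma radicals_power_rat:
  assumes "x \<in> R"
  obtains n where "n \<ge> 1" "x ^ n \<in> \<Gamma>" "x ^ n \<in> \<rat>"
  using assms rational by (auto simp: radicals_def)

lemmas RA_iff = aut_fixing_rats_carrier[OF zero_notin_radicals]

lemma RA_D:
  assumes "\<sigma> \<in> RA"
  shows "x \<in> R \<Longrightarrow> \<sigma> x \<in> R" "inj_on \<sigma> R" "\<sigma> ` R = R"
    "x \<in> R \<Longrightarrow> y \<in> R \<Longrightarrow> \<sigma> (x * y) = \<sigma> x * \<sigma> y"
    "x \<in> R \<Longrightarrow> x \<in> \<rat> \<Longrightarrow> \<sigma> x = x" "\<sigma> 1 = 1"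
  using assms one_in_radicals unfolding RA_iff bij_betw_def by auto

lemma RA_power:
  assumes "\<sigma> \<in> RA" "x \<in> R"
  shows "\<sigma> (x ^ n) = \<sigma> x ^ n"
  by (induction n) (simp_all add: RA_D[OF assms(1)] assms(2) radicals_power)

lemma RA_divide:
  assumes "\<sigma> \<in> RA" "x \<in> R" "y \<in> R"
  shows "\<sigma> (x / y) = \<sigma> x / \<sigma> y"
proof -
  have "\<sigma> x = \<sigma> (x / y * y)" using radicals_nonzero[OF assms(3)] by simp
  also have "\<dots> = \<sigma> (x / y) * \<sigma> y"
    by (rule RA_D(4)[OF assms(1) radicals_divide[OF assms(2,3)] assms(3)])
  finally show ?thesis
    using radicals_nonzero[OF RA_D(1)[OF assms(1,3)]] by (simp add: field_simps)
qed

lemma RA_ratio_unity_root: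
  assumes "\<sigma> \<in> RA" "x \<in> R"
  shows "\<sigma> x / x \<in> unity_roots"
proof -
  obtain n where n: "n \<ge> 1" "x ^ n \<in> \<Gamma>" "x ^ n \<in> \<rat>" by (rule radicals_power_rat[OF assms(2)])
  have "\<sigma> x ^ n = x ^ n"
    using RA_power[OF assms, of n] RA_D(5)[OF assms(1) radicals_power[OF assms(2)] n(3)] by simp
  then have "(\<sigma> x / x) ^ n = 1" using radicals_nonzero[OF assms(2)] by (simp add: power_divide)
  then show ?thesis using n(1) by (auto simp: unity_roots_def)
qed

lemma RA_unity_root:
  assumes "\<sigma> \<in> RA" "u \<in> unity_roots"
  shows "\<sigma> u \<in> unity_roots"
proof -
  have "u \<in> R" using assms(2) unity_roots_subset_radicals by blast
  from RA_ratio_unity_root[OF assms(1) this] have "\<sigma> u / u * u \<in> unity_roots"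
    using assms(2) mult_submonoid_unity_roots unfolding mult_submonoid_def by blast
  then show ?thesis using radicals_nonzero[OF \<open>u \<in> R\<close>] by simp
qed

definition cyc_ext :: "(complex \<Rightarrow> complex) \<Rightarrow> complex \<Rightarrow> complex" where
  "cyc_ext \<sigma> = (SOME f. hom_on cyclotomic_field f \<and> (\<forall>x\<in>unity_roots. f x = \<sigma> x) \<and>
     (\<forall>q\<in>\<rat>. f q = q) \<and> f ` cyclotomic_field \<subseteq> cyclotomic_field)"

lemma cyc_ext:
  assumes "\<sigma> \<in> RA"
  shows "hom_on cyclotomic_field (cyc_ext \<sigma>)" "u \<in> unity_roots \<Longrightarrow> cyc_ext \<sigma> u = \<sigma> u"
    "q \<in> \<rat> \<Longrightarrow> cyc_ext \<sigma> q = q" "x \<in> cyclotomic_field \<Longrightarrow> cyc_ext \<sigma> x \<in> cyclotomic_field"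
proof -
  have mult: "\<sigma> (x * y) = \<sigma> x * \<sigma> y" if "x \<in> unity_roots" "y \<in> unity_roots" for x y
    using RA_D(4)[OF assms] unity_roots_subset_radicals that by blast
  have inj: "inj_on \<sigma> unity_roots"
    using RA_D(2)[OF assms] unity_roots_subset_radicals by (rule inj_on_subset)
  have \<sigma>1: "\<sigma> 1 = 1" by (rule RA_D(6)[OF assms])
  have pres: "preserves_relations unity_roots \<sigma>"
    by (rule unity_roots_preserves_relations[OF mult inj]) (simp_all add: \<sigma>1)
  obtain f where f: "hom_on cyclotomic_field f" "\<And>x. x \<in> unity_roots \<Longrightarrow> f x = \<sigma> x"
    "\<And>q. q \<in> \<rat> \<Longrightarrow> f q = q" "f ` cyclotomic_field = rat_span (\<sigma> ` unity_roots)"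
    using rat_span_hom_exists[OF mult_submonoid_unity_roots \<sigma>1 mult pres] by metis
  have "f ` cyclotomic_field \<subseteq> cyclotomic_field"
    unfolding f(4) using RA_unity_root[OF assms] by (intro rat_cx.span_mono) blast
  then have "\<exists>f. hom_on cyclotomic_field f \<and> (\<forall>x\<in>unity_roots. f x = \<sigma> x) \<and>
     (\<forall>q\<in>\<rat>. f q = q) \<and> f ` cyclotomic_field \<subseteq> cyclotomic_field"
    using f by (intro exI[of _ f]) simp
  from someI_ex[OF this, folded cyc_ext_def]
  show "hom_on cyclotomic_field (cyc_ext \<sigma>)" "u \<in> unity_roots \<Longrightarrow> cyc_ext \<sigma> u = \<sigma> u"
    "q \<in> \<rat> \<Longrightarrow> cyc_ext \<sigma> q = q" "x \<in> cyclotomic_field \<Longrightarrow> cyc_ext \<sigma> x \<in> cyclotomic_field"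
    by auto
qed

abbreviation B :: "complex set" where "B \<equiv> R \<inter> cyclotomic_field"

lemma subring_set_cyclotomic: "subring_set cyclotomic_field"
  by (rule subfield_set_imp_subring_set[OF subfield_set_cyclotomic])

lemma B_mult: "x \<in> B \<Longrightarrow> y \<in> B \<Longrightarrow> x * y \<in> B"
  by (simp add: radicals_mult subring_set_closed(4)[OF subring_set_cyclotomic])

lemma unity_roots_subset_B: "unity_roots \<subseteq> B"
  using unity_roots_subset_radicals unity_roots_subset_cyclotomic by blast

lemma rat_subset_B: "R \<inter> \<rat> \<subseteq> B"
  using Rats_subset_rat_span[OF mult_submonoid_unity_roots] by blast

lemma radical_cnj_quotient:
  assumes "x \<in> R"
  shows "x / cnj x \<in> unity_roots"
proof -
  obtain n where n: "n \<ge> 1" "x ^ n \<in> \<Gamma>" "x ^ n \<in> \<rat>" by (rule radicals_power_rat[OF assms])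
  obtain q where q: "x ^ n = of_rat q" using n(3) by (rule Rats_cases)
  obtain a b where "quotient_of q = (a, b)" by (cases "quotient_of q")
  then have "q = of_int a / of_int b" by (rule quotient_of_div)
  then have "cnj (x ^ n) = x ^ n" unfolding q by (simp add: of_rat_divide)
  then have "(x / cnj x) ^ n = 1"
    using radicals_nonzero[OF assms] by (simp add: power_divide)
  then show ?thesis using n(1) by (auto simp: unity_roots_def)
qed

lemma B_norm:
  assumes "b \<in> B"
  shows "b * cnj b \<in> R \<inter> \<rat>"
proof -
  have b: "b \<in> R" "b \<in> cyclotomic_field" using assms by auto
  obtain n where n: "n \<ge> 1" "b ^ n \<in> \<Gamma>" "b ^ n \<in> \<rat>" by (rule radicals_power_rat[OF b(1)])
  have "b * cnj b \<in> \<rat>" by (rule cyclotomic_radical_norm_rat[OF b(2) n(1,3)])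
  moreover have "b / (b / cnj b) \<in> R"
    by (rule radicals_divide[OF b(1) subsetD[OF unity_roots_subset_radicals radical_cnj_quotient[OF b(1)]]])
  then have "b * cnj b \<in> R" using radicals_nonzero[OF b(1)] radicals_mult[OF b(1)] by simp
  ultimately show ?thesis by blast
qed

definition eps :: "(complex \<Rightarrow> complex) \<Rightarrow> complex \<Rightarrow> complex" where
  "eps \<sigma> b = \<sigma> b / cyc_ext \<sigma> b"

lemma cyc_ext_nonzero:
  assumes "\<sigma> \<in> RA" "x \<in> cyclotomic_field" "x \<noteq> 0"
  shows "cyc_ext \<sigma> x \<noteq> 0"
  using hom_on_eq_0_iff[OF subfield_set_cyclotomic cyc_ext(1)[OF assms(1)] assms(2)] assms(3) by simp

lemma cyc_ext_mult:
  assumes "\<sigma> \<in> RA" "x \<in> cyclotomic_field" "y \<in> cyclotomic_field"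
  shows "cyc_ext \<sigma> (x * y) = cyc_ext \<sigma> x * cyc_ext \<sigma> y"
  by (rule hom_on_simps(3)[OF cyc_ext(1)[OF assms(1)] assms(2,3)])

lemma eps_mult:
  assumes "\<sigma> \<in> RA" "x \<in> B" "y \<in> B"
  shows "eps \<sigma> (x * y) = eps \<sigma> x * eps \<sigma> y"
  using assms by (simp add: eps_def RA_D(4) cyc_ext_mult)

lemma eps_unity_root:
  assumes "\<sigma> \<in> RA" "u \<in> unity_roots"
  shows "eps \<sigma> u = 1"
proof -
  have "\<sigma> u \<noteq> 0"
    using RA_unity_root[OF assms] unity_roots_subset_radicals radicals_nonzero by blast
  then show ?thesis by (simp add: eps_def cyc_ext(2)[OF assms])
qed

lemma eps_rat:
  assumes "\<sigma> \<in> RA" "q \<in> R \<inter> \<rat>"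
  shows "eps \<sigma> q = 1"
  using assms radicals_nonzero[of q] by (simp add: eps_def cyc_ext(3) RA_D(5))

lemma eps_square:
  assumes "\<sigma> \<in> RA" "b \<in> B"
  shows "eps \<sigma> b = 1 \<or> eps \<sigma> b = - 1"
proof -
  have b: "b \<in> R" "b \<noteq> 0" using assms(2) radicals_nonzero by auto
  define q where "q = b * cnj b"
  define w where "w = b / cnj b"
  have q: "q \<in> R \<inter> \<rat>" unfolding q_def by (rule B_norm[OF assms(2)])
  have w: "w \<in> unity_roots" unfolding w_def by (rule radical_cnj_quotient[OF b(1)])
  have "b * b = q * w" using b(2) by (simp add: q_def w_def)
  then have "eps \<sigma> b * eps \<sigma> b = eps \<sigma> (q * w)" using eps_mult[OF assms(1,2,2)] by simp
  also have "\<dots> = 1"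
    using eps_mult[OF assms(1), of q w] eps_rat[OF assms(1) q] eps_unity_root[OF assms(1) w]
      q w rat_subset_B unity_roots_subset_B by auto
  finally show ?thesis by (simp add: square_eq_1_iff)
qed

lemma cyc_ext_eq:
  assumes "\<sigma> \<in> RA" "b \<in> B"
  shows "cyc_ext \<sigma> b = eps \<sigma> b * \<sigma> b"
proof -
  have "cyc_ext \<sigma> b \<noteq> 0" using cyc_ext_nonzero[OF assms(1)] assms(2) radicals_nonzero by blast
  then have "\<sigma> b = eps \<sigma> b * cyc_ext \<sigma> b" by (simp add: eps_def)
  then have "eps \<sigma> b * \<sigma> b = (eps \<sigma> b * eps \<sigma> b) * cyc_ext \<sigma> b" by (simp only: mult.assoc)
  moreover have "eps \<sigma> b * eps \<sigma> b = 1" using eps_square[OF assms] by auto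
  ultimately show ?thesis by simp
qed

lemma RA_compose:
  assumes "\<sigma> \<in> RA" "\<tau> \<in> RA"
  shows "compose R \<sigma> \<tau> \<in> RA"
  unfolding RA_iff
proof (intro conjI ballI)
  show "compose R \<sigma> \<tau> \<in> extensional R" by (rule compose_extensional)
  show "bij_betw (compose R \<sigma> \<tau>) R R"
    using assms unfolding RA_iff by (meson bij_betw_compose)
  show "compose R \<sigma> \<tau> (x * y) = compose R \<sigma> \<tau> x * compose R \<sigma> \<tau> y" if "x \<in> R" "y \<in> R" for x y
    using that by (simp add: compose_def radicals_mult RA_D[OF assms(1)] RA_D[OF assms(2)])
  show "compose R \<sigma> \<tau> x = x" if "x \<in> R \<inter> \<rat>" for x
    using that by (simp add: compose_def RA_D[OF assms(1)] RA_D[OF assms(2)])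
qed

lemma RA_B:
  assumes "\<sigma> \<in> RA" "b \<in> B"
  shows "\<sigma> b \<in> B"
proof -
  have "\<sigma> b / b * b \<in> B"
    using RA_ratio_unity_root[OF assms(1)] assms(2) unity_roots_subset_B by (intro B_mult) auto
  then show ?thesis using assms(2) radicals_nonzero by auto
qed

lemma eps_RA:
  assumes "\<sigma> \<in> RA" "\<tau> \<in> RA" "b \<in> B"
  shows "eps \<sigma> (\<tau> b) = eps \<sigma> b"
proof -
  have b: "b \<in> R" "b \<noteq> 0" using assms(3) radicals_nonzero by auto
  have u: "\<tau> b / b \<in> unity_roots" by (rule RA_ratio_unity_root[OF assms(2) b(1)])
  have "eps \<sigma> (\<tau> b / b * b) = eps \<sigma> (\<tau> b / b) * eps \<sigma> b"
    using u unity_roots_subset_B by (intro eps_mult assms) auto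
  then show ?thesis using b(2) eps_unity_root[OF assms(1) u] by simp
qed

lemma eps_compose:
  assumes "\<sigma> \<in> RA" "\<tau> \<in> RA" "b \<in> B"
  shows "eps (compose R \<sigma> \<tau>) b = eps \<sigma> b * eps \<tau> b"
proof -
  note C = RA_compose[OF assms(1,2)]
  have b: "b \<in> R" "b \<in> cyclotomic_field" using assms(3) by auto
  have "cyc_ext (compose R \<sigma> \<tau>) b = cyc_ext \<sigma> (cyc_ext \<tau> b)"
  proof (rule hom_on_rat_span_eq[OF mult_submonoid_unity_roots cyc_ext(1)[OF C] cyc_ext(3)[OF C] _ _ _ b(2)])
    show "hom_on cyclotomic_field (\<lambda>x. cyc_ext \<sigma> (cyc_ext \<tau> x))"
      by (rule hom_on_compose[OF cyc_ext(1)[OF assms(2)] cyc_ext(4)[OF assms(2)] cyc_ext(1)[OF assms(1)]])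
    show "cyc_ext \<sigma> (cyc_ext \<tau> q) = q" if "q \<in> \<rat>" for q
      using that by (simp add: cyc_ext(3) assms)
    fix x assume x: "x \<in> unity_roots"
    then have "x \<in> R" using unity_roots_subset_radicals by blast
    then show "cyc_ext (compose R \<sigma> \<tau>) x = cyc_ext \<sigma> (cyc_ext \<tau> x)"
      using x RA_unity_root[OF assms(2) x] by (simp add: cyc_ext(2) C assms compose_eq)
  qed
  moreover have "cyc_ext \<tau> b = eps \<tau> b * \<tau> b" by (rule cyc_ext_eq[OF assms(2,3)])
  moreover have "cyc_ext \<sigma> (eps \<tau> b * \<tau> b) = eps \<tau> b * cyc_ext \<sigma> (\<tau> b)"
  proof -
    have q: "eps \<tau> b \<in> \<rat>" using eps_square[OF assms(2,3)] by auto
    have "\<tau> b \<in> cyclotomic_field" using RA_B[OF assms(2,3)] by blast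
    then show ?thesis
      using q cyc_ext_mult[OF assms(1), of "eps \<tau> b" "\<tau> b"] cyc_ext(3)[OF assms(1) q]
        Rats_subset_rat_span[OF mult_submonoid_unity_roots] by auto
  qed
  ultimately have eq: "cyc_ext (compose R \<sigma> \<tau>) b = eps \<tau> b * cyc_ext \<sigma> (\<tau> b)" by simp
  have "eps (compose R \<sigma> \<tau>) b = \<sigma> (\<tau> b) / (eps \<tau> b * cyc_ext \<sigma> (\<tau> b))"
    unfolding eps_def[of "compose R \<sigma> \<tau>"] eq using b(1) by (simp add: compose_eq)
  also have "\<dots> = eps \<sigma> (\<tau> b) / eps \<tau> b" by (simp add: eps_def[of \<sigma>])
  also have "\<dots> = eps \<sigma> b * eps \<tau> b"
    using eps_RA[OF assms] eps_square[OF assms(2,3)] by auto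
  finally show ?thesis .
qed

text \<open>A relation splits into relations within the classes modulo \<open>B\<close>. Divided by a representative, each
  of them lies in the cyclotomic field, where \<open>\<sigma>\<close> acts through \<open>cyc_ext \<sigma>\<close>.\<close>

lemma eps_trivial_preserves_relations:
  assumes \<sigma>: "\<sigma> \<in> RA" and eps: "\<And>b. b \<in> B \<Longrightarrow> eps \<sigma> b = 1"
  shows "preserves_relations R \<sigma>"
  unfolding preserves_relations_def
proof (intro allI impI)
  fix T and c :: "complex \<Rightarrow> rat"
  assume T: "finite T" "T \<subseteq> R" and sum0: "(\<Sum>x\<in>T. of_rat (c x) * x) = 0"
  let ?L = cyclotomic_field
  define \<rho> where "\<rho> x = (SOME y. y \<in> T \<and> x / y \<in> ?L)" for x
  have L1: "1 \<in> ?L" by (rule subring_set_closed(2)[OF subring_set_cyclotomic])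
  have nz: "x \<noteq> 0" if "x \<in> T" for x using that T(2) radicals_nonzero by blast
  have \<rho>: "\<rho> x \<in> T \<and> x / \<rho> x \<in> ?L" if "x \<in> T" for x
    unfolding \<rho>_def by (rule someI[of _ x]) (use that nz L1 in simp)
  have \<rho>_eq: "\<rho> x = \<rho> y" if "x \<in> T" "y \<in> T" "x / y \<in> ?L" for x y
  proof -
    have "x / z \<in> ?L \<longleftrightarrow> y / z \<in> ?L" if "z \<in> T" for z
    proof
      assume "x / z \<in> ?L"
      then have "(x / z) / (x / y) \<in> ?L" using \<open>x / y \<in> ?L\<close> by (rule subfield_set_divide[OF subfield_set_cyclotomic])
      then show "y / z \<in> ?L" using nz \<open>x \<in> T\<close> by simp
    next
      assume "y / z \<in> ?L"
      with \<open>x / y \<in> ?L\<close> have "(x / y) * (y / z) \<in> ?L" by (rule subring_set_closed(4)[OF subring_set_cyclotomic])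
      then show "x / z \<in> ?L" using nz \<open>y \<in> T\<close> by simp
    qed
    then show ?thesis unfolding \<rho>_def by (metis (no_types, lifting))
  qed
  have ratL: "of_rat q \<in> ?L" for q
    using Rats_subset_rat_span[OF mult_submonoid_unity_roots] by auto
  define C where "C y = (\<Sum>x | x \<in> T \<and> \<rho> x = y. of_rat (c x) * (x / y))" for y
  have \<rho>T: "\<rho> ` T \<subseteq> T" using \<rho> by blast
  have CL: "C y \<in> ?L" for y
    unfolding C_def using \<rho>
    by (intro subring_set_sum[OF subring_set_cyclotomic] subring_set_closed(4)[OF subring_set_cyclotomic] ratL) auto
  have C0: "C y = 0" if "y \<in> \<rho> ` T" for y
  proof (rule radicals_linear_independent[OF subfield_set_cyclotomic unity_roots_subset_cyclotomic _ _ _ CL _ that])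
    show "finite (\<rho> ` T)" using T(1) by simp
    show "x \<noteq> 0 \<and> (\<exists>n\<ge>1. x ^ n \<in> ?L)" if "x \<in> \<rho> ` T" for x
    proof -
      have "x \<in> R" using that \<rho>T T(2) by blast
      then obtain n where "n \<ge> 1" "x ^ n \<in> \<Gamma>" "x ^ n \<in> \<rat>" by (rule radicals_power_rat)
      then show ?thesis
        using Rats_subset_rat_span[OF mult_submonoid_unity_roots] radicals_nonzero[OF \<open>x \<in> R\<close>] by blast
    qed
    show "x = y" if "x \<in> \<rho> ` T" "y \<in> \<rho> ` T" "x / y \<in> ?L" for x y
    proof -
      have idem: "\<rho> z = z" if z: "z \<in> \<rho> ` T" for z
      proof -
        obtain x where x: "x \<in> T" "z = \<rho> x" using z by blast
        then have "\<rho> x = \<rho> z" using \<rho>_eq[of x z] \<rho>[of x] by simp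
        then show ?thesis using x(2) by simp
      qed
      have "\<rho> x = \<rho> y" using that \<rho>T by (intro \<rho>_eq) auto
      then show ?thesis unfolding idem[OF that(1)] idem[OF that(2)] .
    qed
    have "(\<Sum>y\<in>\<rho> ` T. C y * y) = (\<Sum>y\<in>\<rho> ` T. \<Sum>x | x \<in> T \<and> \<rho> x = y. of_rat (c x) * x)"
    proof (rule sum.cong[OF refl])
      fix y assume "y \<in> \<rho> ` T"
      then have "y \<noteq> 0" using \<rho>T nz by blast
      then show "C y * y = (\<Sum>x | x \<in> T \<and> \<rho> x = y. of_rat (c x) * x)"
        unfolding C_def sum_distrib_right by simp
    qed
    also have "\<dots> = (\<Sum>x\<in>T. of_rat (c x) * x)" by (rule sum.image_gen[OF T(1), symmetric])
    finally show "(\<Sum>y\<in>\<rho> ` T. C y * y) = 0" using sum0 by simp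
  qed
  have "(\<Sum>x | x \<in> T \<and> \<rho> x = y. of_rat (c x) * \<sigma> x) = 0" if y: "y \<in> \<rho> ` T" for y
  proof -
    have yR: "y \<in> R" using y \<rho>T T(2) by blast
    have summand: "of_rat (c x) * \<sigma> x = cyc_ext \<sigma> (of_rat (c x) * (x / y)) * \<sigma> y" if x: "x \<in> T" "\<rho> x = y" for x
    proof -
      have xR: "x \<in> R" using x T(2) by blast
      have xyL: "x / y \<in> ?L" using \<rho>[OF x(1)] x(2) by blast
      then have xyB: "x / y \<in> B" using radicals_divide[OF xR yR] by blast
      have "cyc_ext \<sigma> (of_rat (c x) * (x / y)) = of_rat (c x) * cyc_ext \<sigma> (x / y)"
        using cyc_ext_mult[OF \<sigma> ratL xyL] cyc_ext(3)[OF \<sigma>] by simp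
      also have "cyc_ext \<sigma> (x / y) = \<sigma> x / \<sigma> y"
        using cyc_ext_eq[OF \<sigma> xyB] eps[OF xyB] RA_divide[OF \<sigma> xR yR] by simp
      finally show ?thesis using radicals_nonzero[OF RA_D(1)[OF \<sigma> yR]] by simp
    qed
    have "(\<Sum>x | x \<in> T \<and> \<rho> x = y. of_rat (c x) * \<sigma> x) =
      (\<Sum>x | x \<in> T \<and> \<rho> x = y. cyc_ext \<sigma> (of_rat (c x) * (x / y))) * \<sigma> y"
      unfolding sum_distrib_right using summand by (intro sum.cong) auto
    also have "(\<Sum>x | x \<in> T \<and> \<rho> x = y. cyc_ext \<sigma> (of_rat (c x) * (x / y))) = cyc_ext \<sigma> (C y)"
      unfolding C_def
      by (rule hom_on_sum[OF subring_set_cyclotomic cyc_ext(1)[OF \<sigma>], symmetric],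
          rule subring_set_closed(4)[OF subring_set_cyclotomic ratL]) (use \<rho> in auto)
    also have "\<dots> = 0" using C0[OF y] cyc_ext(3)[OF \<sigma>, of 0] by simp
    finally show ?thesis by simp
  qed
  then have "(\<Sum>y\<in>\<rho> ` T. \<Sum>x | x \<in> T \<and> \<rho> x = y. of_rat (c x) * \<sigma> x) = 0" by simp
  then show "(\<Sum>x\<in>T. of_rat (c x) * \<sigma> x) = 0" unfolding sum.image_gen[OF T(1), of _ \<rho>] .
qed

end

section \<open>The Galois group as a kernel\<close>

lemma complex_field_ops:
  "x \<oplus>\<^bsub>complex_field\<^esub> y = x + y" "x \<otimes>\<^bsub>complex_field\<^esub> y = x * y"
  "\<one>\<^bsub>complex_field\<^esub> = 1" "\<zero>\<^bsub>complex_field\<^esub> = 0" "carrier complex_field = UNIV"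
  by (simp_all add: ring_of_type_algebra_def)

lemma complex_field_minus: "\<ominus>\<^bsub>complex_field\<^esub> x = - x"
proof -
  interpret F: Ring.field complex_field by (rule field_from_type_algebra)
  have "x \<oplus>\<^bsub>complex_field\<^esub> (- x) = \<zero>\<^bsub>complex_field\<^esub>" by (simp add: complex_field_ops)
  then show ?thesis using F.minus_equality[of "- x" x] by (simp add: complex_field_ops)
qed

lemma complex_field_inverse:
  assumes "x \<noteq> 0"
  shows "inv\<^bsub>complex_field\<^esub> x = inverse x"
proof -
  interpret F: Ring.field complex_field by (rule field_from_type_algebra)
  show ?thesis using F.comm_inv_char[of x "inverse x"] assms by (simp add: complex_field_ops)
qed

context rational_group
begin

lemma subfield_set_rat_span_radicals: "subfield_set (rat_span R)"
proof (rule subfield_set_rat_span[OF mult_submonoid_radicals])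
  fix x assume "x \<in> R"
  then obtain n where "n \<ge> 1" "x ^ n \<in> \<Gamma>" "x ^ n \<in> \<rat>" by (rule radicals_power_rat)
  then show "\<exists>n\<ge>1. x ^ n \<in> \<rat>" by blast
qed

lemma generate_field_radicals: "generate_field complex_field R = rat_span R"
proof
  note F = subfield_set_rat_span_radicals
  note S = subfield_set_imp_subring_set[OF F]
  show "generate_field complex_field R \<subseteq> rat_span R"
  proof
    fix x assume "x \<in> generate_field complex_field R"
    then show "x \<in> rat_span R"
    proof (induction rule: generate_field.induct)
      case (m_inv h)
      then show ?case using subfield_set_inverse[OF F] by (simp add: complex_field_ops complex_field_inverse)
    qed (simp_all add: complex_field_ops complex_field_minus subring_set_closed[OF S] rat_cx.span_base)
  qed
  let ?V = "generate_field complex_field R"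
  have closed: "1 \<in> ?V" "x \<in> ?V \<Longrightarrow> - x \<in> ?V" "x \<in> ?V \<Longrightarrow> y \<in> ?V \<Longrightarrow> x + y \<in> ?V"
    "x \<in> ?V \<Longrightarrow> y \<in> ?V \<Longrightarrow> x * y \<in> ?V" "x \<in> ?V \<Longrightarrow> x \<noteq> 0 \<Longrightarrow> inverse x \<in> ?V" for x y
    using generate_field.one[of complex_field R] generate_field.a_inv[of x complex_field R]
      generate_field.eng_add[of x complex_field R y] generate_field.eng_mult[of x complex_field R y]
      generate_field.m_inv[of x complex_field R]
    by (simp_all add: complex_field_ops complex_field_minus complex_field_inverse)
  have zero: "0 \<in> ?V" using closed(3)[OF closed(1) closed(2)[OF closed(1)]] by simp
  have V: "subring_set ?V"
    unfolding subring_set_def using zero closed(1,2,4) closed(3)[of _ "- _"] by simp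
  have nat: "of_nat n \<in> ?V" for n
    by (induction n) (simp_all add: zero closed)
  have int: "of_int i \<in> ?V" for i
    by (cases i) (use nat closed(2) in \<open>simp_all del: of_nat_Suc\<close>)
  have "\<rat> \<subseteq> ?V"
  proof
    fix x :: complex assume "x \<in> \<rat>"
    then obtain q where q: "x = of_rat q" by (rule Rats_cases)
    obtain a b where ab: "quotient_of q = (a, b)" by (cases "quotient_of q")
    then have "q = of_int a / of_int b" "b \<noteq> 0"
      using quotient_of_denom_pos by (blast intro: quotient_of_div, fastforce)
    then have "x = of_int a * inverse (of_int b)" "of_int b \<noteq> (0::complex)"
      unfolding q by (simp_all add: of_rat_mult of_rat_inverse divide_inverse)
    then show "x \<in> ?V" using closed(4,5) int by metis
  qed
  then show "rat_span R \<subseteq> ?V"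
    by (intro rat_span_minimal V) (auto intro: generate_field.incl)
qed

lemma galois_automorphisms_iff:
  "g \<in> galois_automorphisms \<Gamma> \<longleftrightarrow>
     hom_on (rat_span R) g \<and> bij_betw g (rat_span R) (rat_span R) \<and> (\<forall>q\<in>\<rat>. g q = q)"
  by (auto simp: galois_automorphisms_def radical_field_def ring_iso_def ring_hom_def hom_on_def
      complex_field_ops generate_field_radicals bij_betw_def)

lemma cyclotomic_subset_rat_span: "cyclotomic_field \<subseteq> rat_span R"
  by (rule rat_cx.span_mono[OF unity_roots_subset_radicals])

lemma galois_restrict_in_RA:
  assumes "g \<in> galois_automorphisms \<Gamma>"
  shows "restrict g R \<in> RA"
proof -
  note F = subfield_set_rat_span_radicals
  note S = subfield_set_imp_subring_set[OF F]
  have g: "hom_on (rat_span R) g" "inj_on g (rat_span R)" "\<And>q. q \<in> \<rat> \<Longrightarrow> g q = q"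
    using assms unfolding galois_automorphisms_iff bij_betw_def by auto
  have RK: "R \<subseteq> rat_span R" by (rule rat_cx.span_superset)
  have pow: "g x ^ n = x ^ n" if "x \<in> R" "x ^ n \<in> \<rat>" for x n
    using hom_on_power[OF S g(1), of x n] g(3)[OF that(2)] RK that(1) by auto
  have gR: "g x \<in> R" if x: "x \<in> R" for x
  proof -
    obtain n where n: "n \<ge> 1" "x ^ n \<in> \<Gamma>" "x ^ n \<in> \<rat>" by (rule radicals_power_rat[OF x])
    have "g x \<noteq> 0" using hom_on_eq_0_iff[OF F g(1), of x] RK x radicals_nonzero by blast
    then show ?thesis
      using pow[OF x n(3)] n(1,2) unfolding radicals_def by (intro CollectI conjI exI[of _ n]) auto
  qed
  have inj: "inj_on g R" using g(2) RK by (rule inj_on_subset)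
  have "y \<in> g ` R" if y: "y \<in> R" for y
  proof -
    obtain n where n: "n \<ge> 1" "y ^ n \<in> \<Gamma>" "y ^ n \<in> \<rat>" by (rule radicals_power_rat[OF y])
    define Z where "Z = {z. z ^ n = y ^ n}"
    have "finite Z" unfolding Z_def using n(1) by (intro finite_nth_roots) simp
    have ZR: "Z \<subseteq> R"
    proof
      fix z assume "z \<in> Z"
      then have z: "z ^ n = y ^ n" by (simp add: Z_def)
      have "z \<noteq> 0" using z n(1) radicals_nonzero[OF y] by (auto simp: power_0_left)
      then show "z \<in> R" using z n(1) radicals_power[OF y] by (intro radicals_saturated[of z n]) auto
    qed
    have "g ` Z \<subseteq> Z"
    proof
      fix w assume "w \<in> g ` Z"
      then obtain z where z: "z \<in> Z" "w = g z" by blast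
      then have "z ^ n = y ^ n" by (simp add: Z_def)
      then show "w \<in> Z" using pow[of z n] z ZR n(3) by (auto simp: Z_def)
    qed
    from endo_inj_surj[OF \<open>finite Z\<close> this inj_on_subset[OF inj ZR]] have "g ` Z = Z" .
    then show ?thesis using ZR unfolding Z_def by blast
  qed
  then have "bij_betw g R R" unfolding bij_betw_def using inj gR by blast
  then show ?thesis
    unfolding RA_iff using g(3) hom_on_simps(3)[OF g(1)] RK radicals_mult
    by (auto simp: bij_betw_restrict_eq)
qed

lemma galois_on_radicals_eq: "galois_on_radicals \<Gamma> = {\<sigma> \<in> RA. \<forall>b\<in>B. eps \<sigma> b = 1}"
proof (rule Set.set_eqI, rule iffI)
  fix \<sigma> assume "\<sigma> \<in> galois_on_radicals \<Gamma>"
  then obtain g where g: "g \<in> galois_automorphisms \<Gamma>" "\<sigma> = restrict g R"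
    by (auto simp: galois_on_radicals_def)
  have \<sigma>: "\<sigma> \<in> RA" unfolding g(2) by (rule galois_restrict_in_RA[OF g(1)])
  have gh: "hom_on (rat_span R) g" "\<And>q. q \<in> \<rat> \<Longrightarrow> g q = q"
    using g(1) unfolding galois_automorphisms_iff by auto
  have "eps \<sigma> b = 1" if b: "b \<in> B" for b
  proof -
    have "cyc_ext \<sigma> b = g b"
    proof (rule hom_on_rat_span_eq[OF mult_submonoid_unity_roots cyc_ext(1)[OF \<sigma>] cyc_ext(3)[OF \<sigma>] _ gh(2)])
      show "hom_on cyclotomic_field g" by (rule hom_on_subset[OF gh(1) cyclotomic_subset_rat_span])
      show "b \<in> cyclotomic_field" using b by blast
      fix u assume u: "u \<in> unity_roots"
      then have "u \<in> R" using unity_roots_subset_radicals by blast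
      then show "cyc_ext \<sigma> u = g u" using cyc_ext(2)[OF \<sigma> u] by (simp add: g(2))
    qed
    moreover have "\<sigma> b = g b" using b by (simp add: g(2))
    moreover have "cyc_ext \<sigma> b \<noteq> 0" using cyc_ext_nonzero[OF \<sigma>] b radicals_nonzero by blast
    ultimately show ?thesis by (simp add: eps_def)
  qed
  then show "\<sigma> \<in> {\<sigma> \<in> RA. \<forall>b\<in>B. eps \<sigma> b = 1}" using \<sigma> by blast
next
  fix \<sigma> assume "\<sigma> \<in> {\<sigma> \<in> RA. \<forall>b\<in>B. eps \<sigma> b = 1}"
  then have \<sigma>: "\<sigma> \<in> RA" "\<And>b. b \<in> B \<Longrightarrow> eps \<sigma> b = 1" by auto
  obtain f where f: "hom_on (rat_span R) f" "\<And>x. x \<in> R \<Longrightarrow> f x = \<sigma> x"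
    "\<And>q. q \<in> \<rat> \<Longrightarrow> f q = q" "f ` rat_span R = rat_span (\<sigma> ` R)"
    using rat_span_hom_exists[OF mult_submonoid_radicals RA_D(6)[OF \<sigma>(1)] RA_D(4)[OF \<sigma>(1)]
      eps_trivial_preserves_relations[OF \<sigma>]] by metis
  note S = subfield_set_imp_subring_set[OF subfield_set_rat_span_radicals]
  have "inj_on f (rat_span R)"
  proof (rule inj_onI)
    fix x y assume xy: "x \<in> rat_span R" "y \<in> rat_span R" "f x = f y"
    then have "f (x - y) = 0" using hom_on_diff[OF S f(1)] by simp
    then show "x = y"
      using hom_on_eq_0_iff[OF subfield_set_rat_span_radicals f(1)] subring_set_closed(3)[OF S] xy by auto
  qed
  then have "f \<in> galois_automorphisms \<Gamma>"
    unfolding galois_automorphisms_iff bij_betw_def using f RA_D(3)[OF \<sigma>(1)] by simp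
  moreover have "\<sigma> = restrict f R"
    using \<sigma>(1) f(2) unfolding RA_iff by (auto intro!: extensionalityI[of _ R])
  ultimately show "\<sigma> \<in> galois_on_radicals \<Gamma>" by (auto simp: galois_on_radicals_def)
qed

lemma eps_locally_constant:
  assumes "finite I" "I \<subseteq> B"
  obtains E where "finite E" "E \<subseteq> R"
    "\<And>\<sigma> \<tau> i. \<sigma> \<in> RA \<Longrightarrow> \<tau> \<in> RA \<Longrightarrow> \<forall>x\<in>E. \<sigma> x = \<tau> x \<Longrightarrow> i \<in> I \<Longrightarrow> eps \<sigma> i = eps \<tau> i"
proof -
  have "\<forall>b\<in>I. \<exists>T. finite T \<and> T \<subseteq> unity_roots \<and> (\<exists>c. b = (\<Sum>a\<in>T. of_rat (c a) * a))"
  proof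
    fix b assume "b \<in> I"
    then have "b \<in> cyclotomic_field" using assms(2) by blast
    then obtain T c where "finite T" "T \<subseteq> unity_roots" "b = (\<Sum>a\<in>T. of_rat (c a) * a)"
      unfolding rat_cx.span_explicit by blast
    then show "\<exists>T. finite T \<and> T \<subseteq> unity_roots \<and> (\<exists>c. b = (\<Sum>a\<in>T. of_rat (c a) * a))" by blast
  qed
  then obtain T where T: "\<And>b. b \<in> I \<Longrightarrow> finite (T b)" "\<And>b. b \<in> I \<Longrightarrow> T b \<subseteq> unity_roots"
    "\<And>b. b \<in> I \<Longrightarrow> \<exists>c. b = (\<Sum>a\<in>T b. of_rat (c a) * a)" by metis
  define E where "E = I \<union> (\<Union>b\<in>I. T b)"
  have "eps \<sigma> i = eps \<tau> i" if \<sigma>: "\<sigma> \<in> RA" and \<tau>: "\<tau> \<in> RA" and eq: "\<forall>x\<in>E. \<sigma> x = \<tau> x" and i: "i \<in> I" for \<sigma> \<tau> i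
  proof -
    obtain c where c: "i = (\<Sum>a\<in>T i. of_rat (c a) * a)" using T(3)[OF i] by blast
    have ratL: "of_rat q \<in> cyclotomic_field" for q
      using Rats_subset_rat_span[OF mult_submonoid_unity_roots] by auto
    have TL: "a \<in> cyclotomic_field" "a \<in> unity_roots" if "a \<in> T i" for a
      using T(2)[OF i] that unity_roots_subset_cyclotomic by auto
    have ext: "cyc_ext \<sigma> i = (\<Sum>a\<in>T i. of_rat (c a) * \<sigma> a)" if \<sigma>: "\<sigma> \<in> RA" for \<sigma>
    proof -
      have "cyc_ext \<sigma> (\<Sum>a\<in>T i. of_rat (c a) * a) = (\<Sum>a\<in>T i. cyc_ext \<sigma> (of_rat (c a) * a))"
        by (rule hom_on_sum[OF subring_set_cyclotomic cyc_ext(1)[OF \<sigma>]])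
          (intro subring_set_closed(4)[OF subring_set_cyclotomic] ratL TL)
      also have "\<dots> = (\<Sum>a\<in>T i. of_rat (c a) * \<sigma> a)"
        by (rule sum.cong[OF refl])
          (simp add: cyc_ext_mult[OF \<sigma> ratL] TL cyc_ext(3)[OF \<sigma>] cyc_ext(2)[OF \<sigma>])
      finally show ?thesis unfolding c[symmetric] .
    qed
    have "cyc_ext \<sigma> i = cyc_ext \<tau> i"
      unfolding ext[OF \<sigma>] ext[OF \<tau>] using eq i by (intro sum.cong) (auto simp: E_def)
    then show ?thesis using eq i by (simp add: eps_def E_def)
  qed
  moreover have "finite E" using assms(1) T(1) by (simp add: E_def)
  moreover have "E \<subseteq> R"
    unfolding E_def using assms(2) T(2) unity_roots_subset_radicals by blast
  ultimately show ?thesis by (intro that[of E])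
qed

end

definition rational_with_primes :: "nat set \<Rightarrow> complex \<Rightarrow> bool" where
  "rational_with_primes P x \<longleftrightarrow> (\<exists>a b :: int. a \<noteq> 0 \<and> b \<noteq> 0 \<and> x * of_int b = of_int a \<and>
     (\<forall>p. prime p \<longrightarrow> int p dvd a * b \<longrightarrow> p \<in> P))"

lemma rational_with_primes_mult:
  assumes "rational_with_primes P x" "rational_with_primes P y"
  shows "rational_with_primes P (x * y)"
proof -
  obtain a b where ab: "a \<noteq> 0" "b \<noteq> 0" "x * of_int b = of_int a" "\<forall>p. prime p \<longrightarrow> int p dvd a * b \<longrightarrow> p \<in> P"
    using assms(1) by (auto simp: rational_with_primes_def)
  obtain c d where cd: "c \<noteq> 0" "d \<noteq> 0" "y * of_int d = of_int c" "\<forall>p. prime p \<longrightarrow> int p dvd c * d \<longrightarrow> p \<in> P"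
    using assms(2) by (auto simp: rational_with_primes_def)
  have "x * y * of_int (b * d) = (x * of_int b) * (y * of_int d)" by (simp add: mult_ac)
  also have "\<dots> = of_int (a * c)" using ab(3) cd(3) by simp
  finally have "x * y * of_int (b * d) = of_int (a * c)" .
  moreover have "p \<in> P" if "prime p" "int p dvd (a * c) * (b * d)" for p
  proof -
    have "int p dvd (a * b) * (c * d)" using that(2) by (simp add: mult_ac)
    then have "int p dvd a * b \<or> int p dvd c * d" using that(1) by (simp add: prime_dvd_mult_iff)
    then show ?thesis using ab(4) cd(4) that(1) by blast
  qed
  ultimately show ?thesis
    unfolding rational_with_primes_def using ab(1,2) cd(1,2)
    by (intro exI[of _ "a * c"] exI[of _ "b * d"]) auto
qed

lemma rational_with_primes_inverse:
  assumes "rational_with_primes P x"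
  shows "rational_with_primes P (inverse x)"
proof -
  obtain a b where ab: "a \<noteq> 0" "b \<noteq> 0" "x * of_int b = of_int a" "\<forall>p. prime p \<longrightarrow> int p dvd a * b \<longrightarrow> p \<in> P"
    using assms by (auto simp: rational_with_primes_def)
  then have "x \<noteq> 0" by auto
  then have "inverse x * of_int a = of_int b" using ab(3)[symmetric] by (simp add: field_simps)
  then show ?thesis unfolding rational_with_primes_def using ab
    by (intro exI[of _ b] exI[of _ a]) (simp add: mult.commute)
qed

lemma finite_rational_with_primes:
  assumes "finite F" "F \<subseteq> \<rat>" "0 \<notin> F"
  obtains P where "finite P" "\<And>x. x \<in> F \<Longrightarrow> rational_with_primes P x"
proof -
  have "\<forall>x\<in>F. \<exists>P. finite P \<and> rational_with_primes P x"
  proof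
    fix x assume "x \<in> F"
    then have "x \<in> \<rat>" "x \<noteq> 0" using assms by auto
    from this(1) obtain q where q: "x = of_rat q" by (rule Rats_cases)
    obtain a b where ab: "quotient_of q = (a, b)" by (cases "quotient_of q")
    have "b > 0" "q = of_int a / of_int b"
      using ab by (simp_all add: quotient_of_denom_pos quotient_of_div)
    then have "x * of_int b = of_int a" unfolding q by (simp add: of_rat_divide)
    moreover have "a \<noteq> 0" using \<open>x * of_int b = of_int a\<close> \<open>x \<noteq> 0\<close> \<open>b > 0\<close> by auto
    moreover have "finite {p. int p dvd a * b}"
    proof (rule finite_subset)
      show "{p. int p dvd a * b} \<subseteq> {.. nat \<bar>a * b\<bar>}"
      proof
        fix p assume "p \<in> {p. int p dvd a * b}"
        moreover have "a * b \<noteq> 0" using \<open>a \<noteq> 0\<close> \<open>b > 0\<close> by simp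
        ultimately have "int p \<le> \<bar>a * b\<bar>" using dvd_imp_le_int[of "a * b" "int p"] by simp
        then show "p \<in> {.. nat \<bar>a * b\<bar>}" by (simp only: atMost_iff nat_le_iff le_nat_iff abs_ge_zero)
      qed
    qed simp
    ultimately show "\<exists>P. finite P \<and> rational_with_primes P x"
      using \<open>b > 0\<close> unfolding rational_with_primes_def
      by (intro exI[of _ "{p. int p dvd a * b}"] conjI exI[of _ a] exI[of _ b]) auto
  qed
  then obtain P where P: "\<And>x. x \<in> F \<Longrightarrow> finite (P x)" "\<And>x. x \<in> F \<Longrightarrow> rational_with_primes (P x) x" by metis
  have "finite (\<Union>x\<in>F. P x)" using assms(1) P(1) by blast
  moreover have "rational_with_primes (\<Union>x\<in>F. P x) x" if "x \<in> F" for x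
    using P(2)[OF that] that unfolding rational_with_primes_def by blast
  ultimately show ?thesis using that by blast
qed

locale fg_rational_group = rational_group +
  assumes fg: "\<exists>F. finite F \<and> F \<subseteq> \<Gamma> \<and> \<Gamma> = generate complex_units F"
begin

lemma group_with_primes:
  obtains P where "finite P" "\<And>x. x \<in> \<Gamma> \<Longrightarrow> rational_with_primes P x"
proof -
  obtain F where F: "finite F" "F \<subseteq> \<Gamma>" "\<Gamma> = generate complex_units F" using fg by blast
  obtain P where P: "finite P" "\<And>x. x \<in> F \<Longrightarrow> rational_with_primes P x"
    using finite_rational_with_primes[OF F(1)] F(2) rational zero_notin by (metis subset_iff)
  interpret U: group complex_units
    by (rule field.field_mult_group[OF field_from_type_algebra])
  have inv: "inv\<^bsub>complex_units\<^esub> h = inverse h" if "h \<noteq> 0" for h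
    using U.inv_equality[of "inverse h" h] that by (simp add: complex_field_ops)
  have "rational_with_primes P x" if x: "x \<in> generate complex_units F" for x
    using x
  proof (induction rule: generate.induct)
    case one
    show ?case unfolding rational_with_primes_def
      by (intro exI[of _ 1]) (auto simp: complex_field_ops)
  next
    case (incl h)
    then show ?case by (rule P(2))
  next
    case (inv h)
    then have "h \<noteq> 0" using F(2) zero_notin by auto
    then show ?case using rational_with_primes_inverse[OF P(2)[OF inv]] \<open>\<And>h. h \<noteq> 0 \<Longrightarrow> inv\<^bsub>complex_units\<^esub> h = inverse h\<close> by simp
  next
    case (eng h1 h2)
    then show ?case using rational_with_primes_mult by (simp add: complex_field_ops)
  qed
  then show ?thesis using that[OF P(1)] F(3) by blast
qed

text \<open>The class of \<open>b\<close> is determined by the set of primes that occur with odd exponent in the rational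
  number \<open>b * cnj b\<close>, and such primes occur in the generators of \<open>\<Gamma>\<close>.\<close>

lemma finite_B_representatives:
  obtains I where "finite I" "I \<subseteq> B"
    "\<And>b. b \<in> B \<Longrightarrow> \<exists>i\<in>I. \<exists>q\<in>R \<inter> \<rat>. \<exists>w\<in>unity_roots. b = i * q * w"
proof -
  obtain P where P: "finite P" "\<And>x. x \<in> \<Gamma> \<Longrightarrow> rational_with_primes P x" by (rule group_with_primes) blast
  have "\<forall>b\<in>B. \<exists>u v :: nat. u > 0 \<and> v > 0 \<and> b * cnj b * of_nat v = of_nat u"
  proof
    fix b assume b: "b \<in> B"
    have "b * cnj b \<in> \<rat>" using B_norm[OF b] by blast
    then obtain q where q: "b * cnj b = of_rat q" by (rule Rats_cases)
    obtain u v where uv: "quotient_of q = (u, v)" by (cases "quotient_of q")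
    have v: "v > 0" "q = of_int u / of_int v" using uv by (simp_all add: quotient_of_denom_pos quotient_of_div)
    have "of_real (of_rat q) = (of_rat q :: complex)" unfolding v(2) by (simp add: of_rat_divide)
    then have "of_real ((cmod b)\<^sup>2) = (of_real (of_rat q) :: complex)"
      unfolding complex_norm_square using q by simp
    then have "(cmod b)\<^sup>2 = of_rat q" by (simp only: of_real_eq_iff)
    moreover have "(cmod b)\<^sup>2 > 0" using b radicals_nonzero by simp
    ultimately have "(of_rat q :: real) > 0" by simp
    then have q0: "q > 0" by simp
    then have u: "u > 0" using v by (simp add: zero_less_divide_iff)
    have "b * cnj b * of_int v = of_int u" unfolding q v(2) using v(1) by (simp add: of_rat_divide)
    then have "b * cnj b * of_nat (nat v) = of_nat (nat u)" using u v(1) by simp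
    then show "\<exists>u v :: nat. u > 0 \<and> v > 0 \<and> b * cnj b * of_nat v = of_nat u"
      using u v(1) by (intro exI[of _ "nat u"] exI[of _ "nat v"]) simp
  qed
  then obtain u v :: "complex \<Rightarrow> nat" where uv: "\<And>b. b \<in> B \<Longrightarrow> u b > 0" "\<And>b. b \<in> B \<Longrightarrow> v b > 0"
    "\<And>b. b \<in> B \<Longrightarrow> b * cnj b * of_nat (v b) = of_nat (u b)" by metis
  define f where "f b = {p. prime p \<and> odd (multiplicity p (u b * v b))}" for b
  have fP: "f b \<subseteq> P" if b: "b \<in> B" for b
  proof
    fix p assume "p \<in> f b"
    then have p: "prime p" "odd (multiplicity p (u b * v b))" by (auto simp: f_def)
    have "b * cnj b \<in> R" using B_norm[OF b] by blast
    then obtain n where n: "n \<ge> 1" "(b * cnj b) ^ n \<in> \<Gamma>" "(b * cnj b) ^ n \<in> \<rat>" by (rule radicals_power_rat)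
    obtain a d where ad: "a \<noteq> 0" "d \<noteq> 0" "(b * cnj b) ^ n * of_int d = of_int a"
      "\<forall>p. prime p \<longrightarrow> int p dvd a * d \<longrightarrow> p \<in> P"
      using P(2)[OF n(2)] by (auto simp: rational_with_primes_def)
    have "(of_nat (u b) :: complex) ^ n * of_int d = (b * cnj b) ^ n * of_int d * of_nat (v b) ^ n"
      unfolding uv(3)[OF b, symmetric] by (simp add: power_mult_distrib mult_ac)
    also have "\<dots> = of_int a * of_nat (v b) ^ n" using ad(3) by simp
    finally have "(of_int (int (u b) ^ n * d) :: complex) = of_int (a * int (v b) ^ n)" by simp
    then have eq: "int (u b) ^ n * d = a * int (v b) ^ n" by (simp only: of_int_eq_iff)
    define a' where "a' = nat \<bar>a\<bar>"
    define d' where "d' = nat \<bar>d\<bar>"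
    have "nat \<bar>int (u b) ^ n * d\<bar> = nat \<bar>a * int (v b) ^ n\<bar>" using eq by simp
    then have eq': "u b ^ n * d' = a' * v b ^ n"
      by (simp add: nat_abs_mult_distrib power_abs nat_power_eq a'_def d'_def)
    show "p \<in> P"
    proof (rule ccontr)
      assume "p \<notin> P"
      then have "\<not> int p dvd a" "\<not> int p dvd d" using ad(4) p(1) by auto
      then have nd: "\<not> p dvd a'" "\<not> p dvd d'" by (simp_all add: a'_def d'_def dvd_nat_abs_iff)
      have nz: "a' \<noteq> 0" "d' \<noteq> 0" using ad(1,2) by (simp_all add: a'_def d'_def)
      have pp: "prime_elem p" using p(1) by simp
      have "multiplicity p (u b ^ n * d') = n * multiplicity p (u b)"
        using uv(1)[OF b] nz nd(2) pp
        by (simp add: prime_elem_multiplicity_mult_distrib prime_elem_multiplicity_power_distrib not_dvd_imp_multiplicity_0)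
      moreover have "multiplicity p (a' * v b ^ n) = n * multiplicity p (v b)"
        using uv(2)[OF b] nz nd(1) pp
        by (simp add: prime_elem_multiplicity_mult_distrib prime_elem_multiplicity_power_distrib not_dvd_imp_multiplicity_0)
      ultimately have "multiplicity p (u b) = multiplicity p (v b)" using eq' n(1) by simp
      then have "multiplicity p (u b * v b) = 2 * multiplicity p (u b)"
        using uv(1,2)[OF b] p(1) by (simp add: prime_elem_multiplicity_mult_distrib)
      then show False using p(2) by simp
    qed
  qed
  have "f ` B \<subseteq> Pow P" using fP by blast
  then have "finite (f ` B)" using P(1) by (rule finite_subset[OF _ finite_Pow_iff[THEN iffD2]])
  from finite_subset_image[OF this subset_refl]
  obtain I where I: "I \<subseteq> B" "finite I" "f ` B = f ` I" by (elim exE conjE)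
  have "\<exists>i\<in>I. \<exists>q\<in>R \<inter> \<rat>. \<exists>w\<in>unity_roots. b = i * q * w" if b: "b \<in> B" for b
  proof -
    obtain i where i: "i \<in> I" "f b = f i" using I(3) b by (metis image_iff)
    have iB: "i \<in> B" using i(1) I(1) by blast
    have pos: "u b > 0" "v b > 0" "u i > 0" "v i > 0" using uv(1,2) b iB by auto
    have "is_nth_power 2 (u b * v b * (u i * v i))"
      unfolding is_nth_power_conv_multiplicity_nat[OF pos2]
    proof (intro allI impI)
      fix p :: nat assume p: "prime p"
      have "odd (multiplicity p (u b * v b)) \<longleftrightarrow> odd (multiplicity p (u i * v i))"
        using i(2) p unfolding f_def by blast
      then show "2 dvd multiplicity p (u b * v b * (u i * v i))"
        using pos p by (simp add: prime_elem_multiplicity_mult_distrib[of p "u b * v b"])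
    qed
    then obtain s where s: "u b * v b * (u i * v i) = s ^ 2" by (auto simp: is_nth_power_def)
    define t :: complex where "t = of_nat s / of_nat (v b * u i)"
    have tQ: "t \<in> \<rat>" unfolding t_def by simp
    have "t ^ 2 = of_nat (u b * v b * (u i * v i)) / of_nat (v b * u i) ^ 2"
      unfolding s t_def by (simp add: power_divide)
    also have "\<dots> = (of_nat (u b) / of_nat (v b)) / (of_nat (u i) / of_nat (v i))"
      using pos by (simp add: power2_eq_square field_simps)
    also have "\<dots> = (b * cnj b) / (i * cnj i)"
      unfolding uv(3)[OF b, symmetric] uv(3)[OF iB, symmetric] using pos by simp
    finally have t2: "t ^ 2 = (b * cnj b) / (i * cnj i)" .
    have nz: "b \<noteq> 0" "i \<noteq> 0" using b iB radicals_nonzero by auto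
    then have t0: "t \<noteq> 0" using t2 by auto
    have "t ^ 2 \<in> R" unfolding t2 using B_norm[OF b] B_norm[OF iB] by (intro radicals_divide) auto
    then have tR: "t \<in> R" using t0 by (intro radicals_saturated[of t 2]) auto
    define w where "w = b / (i * t)"
    have wR: "w \<in> R" unfolding w_def using b iB tR by (intro radicals_divide radicals_mult) auto
    have "cnj t = t" unfolding t_def by simp
    then have "w * cnj w = 1"
      unfolding w_def using t2 t0 nz by (simp add: power2_eq_square field_simps)
    then have "w / cnj w = w ^ 2" by (metis divide_eq_eq mult.commute mult.left_commute mult_zero_right power2_eq_square mult.right_neutral zero_neq_one)
    then have "w ^ 2 \<in> unity_roots" using radical_cnj_quotient[OF wR] by simp
    then obtain n where "n \<ge> 1" "(w ^ 2) ^ n = 1" by (auto simp: unity_roots_def)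
    then have "w \<in> unity_roots" unfolding unity_roots_def
      by (intro CollectI exI[of _ "2 * n"]) (simp add: power_mult)
    moreover have "b = i * t * w" unfolding w_def using nz t0 by simp
    ultimately show ?thesis using i(1) tQ tR by blast
  qed
  then show ?thesis using that I by blast
qed

lemma finite_eps_criterion:
  obtains I where "finite I" "I \<subseteq> B" "galois_on_radicals \<Gamma> = {\<sigma> \<in> RA. \<forall>i\<in>I. eps \<sigma> i = 1}"
proof -
  obtain I where I: "finite I" "I \<subseteq> B"
    "\<And>b. b \<in> B \<Longrightarrow> \<exists>i\<in>I. \<exists>q\<in>R \<inter> \<rat>. \<exists>w\<in>unity_roots. b = i * q * w"
    using finite_B_representatives by metis
  have "eps \<sigma> b = 1" if \<sigma>: "\<sigma> \<in> RA" and eps: "\<forall>i\<in>I. eps \<sigma> i = 1" and b: "b \<in> B" for \<sigma> b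
  proof -
    obtain i q w where iqw: "i \<in> I" "q \<in> R \<inter> \<rat>" "w \<in> unity_roots" "b = i * q * w" using I(3)[OF b] by blast
    have "i \<in> B" "q \<in> B" "w \<in> B" using iqw I(2) rat_subset_B unity_roots_subset_B by blast+
    then have "eps \<sigma> (i * q * w) = eps \<sigma> i * eps \<sigma> q * eps \<sigma> w"
      using B_mult by (simp add: eps_mult[OF \<sigma>])
    then show ?thesis using eps iqw by (simp add: eps_rat[OF \<sigma>] eps_unity_root[OF \<sigma>])
  qed
  then have "galois_on_radicals \<Gamma> = {\<sigma> \<in> RA. \<forall>i\<in>I. eps \<sigma> i = 1}"
    unfolding galois_on_radicals_eq using I(2) by blast
  then show ?thesis using that I by blast
qed

end

section \<open>Decomposition into prime components\<close>

lemma group_aut_fixing_rats: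
  assumes M: "mult_submonoid M" "0 \<notin> M"
  shows "group (aut_fixing_rats M)"
proof (rule groupI)
  note iff = aut_fixing_rats_carrier[OF M(2)]
  note mult = aut_fixing_rats_mult
  have M1: "1 \<in> M" "x \<in> M \<Longrightarrow> y \<in> M \<Longrightarrow> x * y \<in> M" for x y using M(1) by (auto simp: mult_submonoid_def)
  have D: "x \<in> M \<Longrightarrow> \<sigma> x \<in> M" "inj_on \<sigma> M" "\<sigma> ` M = M" "\<sigma> \<in> extensional M"
    "x \<in> M \<Longrightarrow> y \<in> M \<Longrightarrow> \<sigma> (x * y) = \<sigma> x * \<sigma> y" "x \<in> M \<Longrightarrow> x \<in> \<rat> \<Longrightarrow> \<sigma> x = x"
    if "\<sigma> \<in> carrier (aut_fixing_rats M)" for \<sigma> x y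
    using that unfolding iff bij_betw_def by auto
  have comp: "compose M \<sigma> \<tau> \<in> carrier (aut_fixing_rats M)"
    if \<sigma>: "\<sigma> \<in> carrier (aut_fixing_rats M)" and \<tau>: "\<tau> \<in> carrier (aut_fixing_rats M)" for \<sigma> \<tau>
    unfolding iff
  proof (intro conjI ballI)
    show "bij_betw (compose M \<sigma> \<tau>) M M" using \<sigma> \<tau> unfolding iff by (meson bij_betw_compose)
  qed (simp_all add: compose_def M1 D[OF \<sigma>] D[OF \<tau>])
  then show "\<sigma> \<otimes>\<^bsub>aut_fixing_rats M\<^esub> \<tau> \<in> carrier (aut_fixing_rats M)"
    if "\<sigma> \<in> carrier (aut_fixing_rats M)" "\<tau> \<in> carrier (aut_fixing_rats M)" for \<sigma> \<tau>
    using that by (simp add: mult)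
  show one: "\<one>\<^bsub>aut_fixing_rats M\<^esub> \<in> carrier (aut_fixing_rats M)"
    unfolding iff aut_fixing_rats_one by (auto simp: M1 bij_betw_def inj_on_def)
  show "\<sigma> \<otimes>\<^bsub>aut_fixing_rats M\<^esub> \<tau> \<otimes>\<^bsub>aut_fixing_rats M\<^esub> \<rho> =
      \<sigma> \<otimes>\<^bsub>aut_fixing_rats M\<^esub> (\<tau> \<otimes>\<^bsub>aut_fixing_rats M\<^esub> \<rho>)"
    if "\<sigma> \<in> carrier (aut_fixing_rats M)" "\<tau> \<in> carrier (aut_fixing_rats M)" "\<rho> \<in> carrier (aut_fixing_rats M)"
    for \<sigma> \<tau> \<rho>
    unfolding mult[OF that(1,2)] mult[OF that(2,3)] mult[OF comp[OF that(1,2)] that(3)]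
      mult[OF that(1) comp[OF that(2,3)]]
    by (auto simp: compose_def D(1)[OF that(3)])
  show "\<one>\<^bsub>aut_fixing_rats M\<^esub> \<otimes>\<^bsub>aut_fixing_rats M\<^esub> \<sigma> = \<sigma>"
    if \<sigma>: "\<sigma> \<in> carrier (aut_fixing_rats M)" for \<sigma>
    unfolding mult[OF one \<sigma>] unfolding aut_fixing_rats_one
    by (rule extensionalityI[of _ M]) (simp_all add: compose_def D[OF \<sigma>])
  show "\<exists>\<tau>\<in>carrier (aut_fixing_rats M). \<tau> \<otimes>\<^bsub>aut_fixing_rats M\<^esub> \<sigma> = \<one>\<^bsub>aut_fixing_rats M\<^esub>"
    if \<sigma>: "\<sigma> \<in> carrier (aut_fixing_rats M)" for \<sigma>
  proof
    let ?t = "restrict (inv_into M \<sigma>) M"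
    have inv: "inv_into M \<sigma> (\<sigma> x) = x" if "x \<in> M" for x using D(2)[OF \<sigma>] that by (rule inv_into_f_f)
    have bij: "bij_betw \<sigma> M M" using \<sigma> unfolding iff by blast
    show t: "?t \<in> carrier (aut_fixing_rats M)"
      unfolding iff
    proof (intro conjI ballI)
      show "?t \<in> extensional M" by simp
      show "bij_betw ?t M M" using bij_betw_inv_into[OF bij] by (simp add: bij_betw_restrict_eq)
      show "?t (x * y) = ?t x * ?t y" if xy: "x \<in> M" "y \<in> M" for x y
      proof -
        obtain u where u: "u \<in> M" "x = \<sigma> u" using xy(1) D(3)[OF \<sigma>] by (metis imageE)
        obtain v where v: "v \<in> M" "y = \<sigma> v" using xy(2) D(3)[OF \<sigma>] by (metis imageE)
        have "x * y = \<sigma> (u * v)" unfolding u(2) v(2) by (rule D(5)[OF \<sigma> u(1) v(1), symmetric])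
        then have "inv_into M \<sigma> (x * y) = u * v" by (simp only: inv M1(2) u(1) v(1))
        moreover have "inv_into M \<sigma> x = u" "inv_into M \<sigma> y = v"
          unfolding u(2) v(2) by (rule inv, fact)+
        ultimately show ?thesis using M1(2)[OF xy] xy by simp
      qed
      show "?t x = x" if "x \<in> M \<inter> \<rat>" for x
        using that inv[of x] D(6)[OF \<sigma>, of x] by auto
    qed
    show "?t \<otimes>\<^bsub>aut_fixing_rats M\<^esub> \<sigma> = \<one>\<^bsub>aut_fixing_rats M\<^esub>"
      unfolding mult[OF t \<sigma>] aut_fixing_rats_one
      by (rule extensionalityI[of _ M]) (simp_all add: compose_def D(1)[OF \<sigma>] inv)
  qed
qed

context rational_group
begin

abbreviation Rp :: "nat \<Rightarrow> complex set" where "Rp \<equiv> p_radicals \<Gamma>"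

lemma Rp_nonzero: "x \<in> Rp p \<Longrightarrow> x \<noteq> 0"
  by (simp add: p_radicals_def)

lemma Rp_mult:
  assumes "x \<in> Rp p" "y \<in> Rp p"
  shows "x * y \<in> Rp p"
proof -
  obtain m where m: "m \<ge> 1" "x ^ p ^ m \<in> \<Gamma>" "x \<noteq> 0" using assms(1) by (auto simp: p_radicals_def)
  obtain n where n: "n \<ge> 1" "y ^ p ^ n \<in> \<Gamma>" "y \<noteq> 0" using assms(2) by (auto simp: p_radicals_def)
  have "(x * y) ^ p ^ (m + n) = (x ^ p ^ m) ^ p ^ n * (y ^ p ^ n) ^ p ^ m"
    by (simp add: power_mult_distrib power_mult[symmetric] power_add[symmetric] add.commute)
  then have "(x * y) ^ p ^ (m + n) \<in> \<Gamma>" using m(2) n(2) by (simp add: mult_in power_in)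
  then show ?thesis using m(1,3) n(1,3) unfolding p_radicals_def
    by (intro CollectI conjI exI[of _ "m + n"]) auto
qed

lemma Rp_inverse: "x \<in> Rp p \<Longrightarrow> inverse x \<in> Rp p"
  by (auto simp: p_radicals_def power_inverse intro: inverse_in)

lemma Rp_divide: "x \<in> Rp p \<Longrightarrow> y \<in> Rp p \<Longrightarrow> x / y \<in> Rp p"
  by (simp add: divide_inverse Rp_mult Rp_inverse)

lemma subset_Rp: "\<Gamma> \<subseteq> Rp p"
proof
  fix x assume "x \<in> \<Gamma>"
  then show "x \<in> Rp p" using zero_notin power_in[of x p] unfolding p_radicals_def
    by (intro CollectI conjI exI[of _ 1]) auto
qed

lemma one_in_Rp: "1 \<in> Rp p"
  using one_in subset_Rp by blast

lemma zero_notin_Rp: "0 \<notin> Rp p"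
  using Rp_nonzero by blast

lemma mult_submonoid_Rp: "mult_submonoid (Rp p)"
  by (simp add: mult_submonoid_def one_in_Rp Rp_mult)

lemma Rp_subset: "prime p \<Longrightarrow> Rp p \<subseteq> R"
proof
  fix x assume "prime p" "x \<in> Rp p"
  then obtain n where "n \<ge> 1" "x ^ p ^ n \<in> \<Gamma>" "x \<noteq> 0" by (auto simp: p_radicals_def)
  then show "x \<in> R" unfolding radicals_def using prime_gt_0_nat[OF \<open>prime p\<close>]
    by (intro CollectI conjI exI[of _ "p ^ n"]) auto
qed

lemma Gamma_power_int: "x \<in> \<Gamma> \<Longrightarrow> x powi k \<in> \<Gamma>"
  unfolding power_int_def by (simp add: power_in inverse_in)

lemma Gamma_coprime_powers:
  assumes "x \<noteq> 0" "x ^ m \<in> \<Gamma>" "x ^ n \<in> \<Gamma>" "coprime m n"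
  shows "x \<in> \<Gamma>"
proof -
  have "coprime (int m) (int n)" using assms(4) by simp
  then obtain s t where st: "s * int m + t * int n = 1"
    using bezout_int[of "int m" "int n"] coprime_imp_gcd_eq_1 by metis
  have "x = x powi (s * int m + t * int n)" using st by simp
  also have "\<dots> = (x ^ m) powi s * (x ^ n) powi t"
    using assms(1) by (simp add: power_int_add power_int_mult mult.commute[of s] mult.commute[of t])
  also have "\<dots> \<in> \<Gamma>" using assms(2,3) by (simp add: mult_in Gamma_power_int)
  finally show ?thesis .
qed

definition decomp :: "complex \<Rightarrow> nat set \<Rightarrow> (nat \<Rightarrow> complex) \<Rightarrow> bool" where
  "decomp x P c \<longleftrightarrow> finite P \<and> (\<forall>p\<in>P. prime p \<and> c p \<in> Rp p) \<and> x = (\<Prod>p\<in>P. c p)"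

text \<open>The factor \<open>c p\<close> has a power of \<open>p\<close>-power exponent in \<open>\<Gamma>\<close>, and, being the inverse of the product
  of the other factors, also one of exponent prime to \<open>p\<close>.\<close>

lemma decomp_1_in:
  assumes "decomp 1 P c" "p \<in> P"
  shows "c p \<in> \<Gamma>"
proof -
  have P: "finite P" "\<And>q. q \<in> P \<Longrightarrow> prime q" "\<And>q. q \<in> P \<Longrightarrow> c q \<in> Rp q" "(\<Prod>p\<in>P. c p) = 1"
    using assms(1) by (auto simp: decomp_def)
  have "\<forall>q\<in>P. \<exists>k. c q ^ q ^ k \<in> \<Gamma>" using P(3) by (auto simp: p_radicals_def)
  then obtain k where k: "\<And>q. q \<in> P \<Longrightarrow> c q ^ q ^ k q \<in> \<Gamma>" by metis
  define m where "m = (\<Prod>q\<in>P - {p}. q ^ k q)"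
  have nz: "c q \<noteq> 0" if "q \<in> P" for q using P(3)[OF that] by (rule Rp_nonzero)
  have "c p * (\<Prod>q\<in>P - {p}. c q) = 1" using P(1,4) assms(2) by (simp add: prod.remove)
  then have "c p = inverse (\<Prod>q\<in>P - {p}. c q)" by (metis inverse_unique mult.commute)
  moreover have "(\<Prod>q\<in>P - {p}. c q) ^ m \<in> \<Gamma>"
  proof -
    have "(c q) ^ m \<in> \<Gamma>" if q: "q \<in> P - {p}" for q
    proof -
      have "m = q ^ k q * (\<Prod>r\<in>P - {p} - {q}. r ^ k r)" unfolding m_def using q P(1) by (simp add: prod.remove)
      then show ?thesis using k[of q] q by (simp add: power_mult power_in)
    qed
    then have "(\<Prod>q\<in>Q. c q ^ m) \<in> \<Gamma>" if "Q \<subseteq> P - {p}" for Q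
      using that by (induction Q rule: infinite_finite_induct) (auto simp: one_in mult_in)
    then show ?thesis by (simp add: prod_power_distrib)
  qed
  ultimately have "c p ^ m \<in> \<Gamma>" by (simp add: power_inverse inverse_in)
  moreover have "coprime (p ^ k p) m"
    unfolding m_def
  proof (rule prod_coprime_right)
    fix q assume "q \<in> P - {p}"
    then show "coprime (p ^ k p) (q ^ k q)"
      using P(2) assms(2) primes_coprime[of p q] by simp
  qed
  ultimately show ?thesis using Gamma_coprime_powers nz k assms(2) by blast
qed

lemma decomp_exists:
  assumes "x \<in> R"
  shows "\<exists>P c. decomp x P c \<and> (x \<in> \<rat> \<longrightarrow> (\<forall>p\<in>P. c p \<in> \<rat>))"
proof -
  obtain n where n: "n \<ge> 1" "x ^ n \<in> \<Gamma>" "x \<noteq> 0" using assms by (auto simp: radicals_def)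
  have "\<forall>x. x \<noteq> 0 \<longrightarrow> x ^ n \<in> \<Gamma> \<longrightarrow> (\<exists>P c. decomp x P c \<and> (x \<in> \<rat> \<longrightarrow> (\<forall>p\<in>P. c p \<in> \<rat>)))"
    using n(1)
  proof (induction n rule: less_induct)
    case (less n)
    show ?case
    proof (intro allI impI)
      fix x assume x: "x \<noteq> 0" "x ^ n \<in> \<Gamma>"
      show "\<exists>P c. decomp x P c \<and> (x \<in> \<rat> \<longrightarrow> (\<forall>p\<in>P. c p \<in> \<rat>))"
      proof (cases "n = 1")
        case True
        then have "x \<in> Rp 2" using x subset_Rp by auto
        then show ?thesis by (intro exI[of _ "{2}"] exI[of _ "\<lambda>_. x"]) (simp add: decomp_def)
      next
        case False
        then obtain p where p: "prime p" "p dvd n" using prime_factor_nat by blast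
        obtain m where m: "n = p ^ multiplicity p n * m" "\<not> p dvd m"
        proof (rule multiplicity_decompose'[of n p])
          show "n \<noteq> 0" using less.prems by simp
          show "\<not> is_unit p" using p(1) not_prime_unit by blast
        qed
        define k where "k = multiplicity p n"
        have mk: "n = p ^ k * m" unfolding k_def by (rule m(1))
        have k: "k \<ge> 1"
        proof (rule ccontr)
          assume "\<not> k \<ge> 1"
          then have "k = 0" by simp
          then have "n = m" by (subst mk) simp
          then show False using p(2) m(2) by blast
        qed
        have m0: "m \<ge> 1" using m(2) by (cases m) auto
        have "p ^ 1 \<le> p ^ k" using k prime_gt_0_nat[OF p(1)] by (intro power_increasing) auto
        then have "m * 2 \<le> m * p ^ k" using prime_ge_2_nat[OF p(1)] by (intro mult_le_mono2) simp
        then have "m * 2 \<le> n" by (subst mk) (simp only: mult.commute)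
        then have mn: "m < n" using m0 by linarith
        have "coprime (p ^ k) m" using p(1) m(2) by (simp add: prime_imp_coprime)
        then have "coprime (int (p ^ k)) (int m)" by (simp only: coprime_int_iff)
        then obtain s t where st: "s * int (p ^ k) + t * int m = 1"
          using bezout_int[of "int (p ^ k)" "int m"] coprime_imp_gcd_eq_1 by metis
        define y where "y = (x ^ p ^ k) powi s"
        define z where "z = (x ^ m) powi t"
        have "x = x powi (s * int (p ^ k) + t * int m)" using st by simp
        also have "\<dots> = y * z"
          unfolding y_def z_def power_int_add[OF disjI1[OF x(1)]]
          by (simp only: power_int_mult power_int_of_nat mult.commute[of s] mult.commute[of t])
        finally have xyz: "x = y * z" .
        have "y ^ m = (x ^ n) powi s"
        proof -
          have "y ^ m = (x ^ p ^ k) powi (s * int m)" unfolding y_def by (simp add: power_int_mult)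
          also have "\<dots> = ((x ^ p ^ k) ^ m) powi s" by (simp only: mult.commute[of s] power_int_mult power_int_of_nat)
          also have "(x ^ p ^ k) ^ m = x ^ n" by (subst mk) (simp only: power_mult)
          finally show ?thesis .
        qed
        then have ym: "y ^ m \<in> \<Gamma>" using x(2) Gamma_power_int by simp
        have "y \<noteq> 0" unfolding y_def using x(1) by simp
        with ym less.IH[OF mn m0] obtain P c where Pc: "decomp y P c" "y \<in> \<rat> \<longrightarrow> (\<forall>p\<in>P. c p \<in> \<rat>)" by blast
        have "z ^ p ^ k = (x ^ n) powi t"
        proof -
          have "z ^ p ^ k = (x ^ m) powi (t * int (p ^ k))" unfolding z_def by (simp only: power_int_mult power_int_of_nat)
          also have "\<dots> = ((x ^ m) ^ p ^ k) powi t" by (simp only: mult.commute[of t] power_int_mult power_int_of_nat)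
          also have "(x ^ m) ^ p ^ k = x ^ n" by (subst mk) (simp only: power_mult[symmetric] mult.commute)
          finally show ?thesis .
        qed
        then have "z ^ p ^ k \<in> \<Gamma>" using x(2) Gamma_power_int by simp
        moreover have "z \<noteq> 0" unfolding z_def using x(1) by simp
        ultimately have zp: "z \<in> Rp p" using k unfolding p_radicals_def by blast
        define c' where "c' q = (if q \<in> P then c q else 1) * (if q = p then z else 1)" for q
        have fin: "finite P" using Pc(1) by (simp add: decomp_def)
        have "decomp x (insert p P) c'"
          unfolding decomp_def
        proof (intro conjI ballI)
          show "finite (insert p P)" using fin by simp
          fix q assume q: "q \<in> insert p P"
          show "prime q" using q p(1) Pc(1) by (auto simp: decomp_def)
          show "c' q \<in> Rp q"
            unfolding c'_def using q zp Pc(1) by (intro Rp_mult) (auto simp: decomp_def one_in_Rp)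
        next
          have "(\<Prod>q\<in>insert p P. c' q) =
              (\<Prod>q\<in>insert p P. if q \<in> P then c q else 1) * (\<Prod>q\<in>insert p P. if q = p then z else 1)"
            unfolding c'_def by (rule prod.distrib)
          also have "(\<Prod>q\<in>insert p P. if q \<in> P then c q else 1) = (\<Prod>q\<in>P. c q)"
            using fin by (intro prod.mono_neutral_cong_right) auto
          also have "(\<Prod>q\<in>insert p P. if q = p then z else 1) = z" using fin by simp
          finally show "x = (\<Prod>q\<in>insert p P. c' q)" using Pc(1) xyz by (simp add: decomp_def)
        qed
        moreover have "c' q \<in> \<rat>" if "x \<in> \<rat>" "q \<in> insert p P" for q
        proof -
          have "y \<in> \<rat>" "z \<in> \<rat>" unfolding y_def z_def power_int_def using that(1) by auto
          then show ?thesis unfolding c'_def using Pc(2) by auto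
        qed
        ultimately show ?thesis by blast
      qed
    qed
  qed
  then show ?thesis using n by blast
qed

abbreviation A :: "(nat \<Rightarrow> complex \<Rightarrow> complex) set" where "A \<equiv> carrier (global_aut \<Gamma>)"

abbreviation Ap :: "nat \<Rightarrow> (complex \<Rightarrow> complex) set" where "Ap p \<equiv> carrier (local_aut \<Gamma> p)"

abbreviation gmult (infixl "\<cdot>" 70) where "a \<cdot> b \<equiv> a \<otimes>\<^bsub>global_aut \<Gamma>\<^esub> b"

abbreviation ginv where "ginv a \<equiv> inv\<^bsub>global_aut \<Gamma>\<^esub> a"

lemma A_iff: "a \<in> A \<longleftrightarrow> a \<in> (\<Pi>\<^sub>E p\<in>{p. prime p}. Ap p)"
  by (simp add: global_aut_def)

lemma local_aut_iff: "\<sigma> \<in> Ap p \<longleftrightarrow> \<sigma> \<in> extensional (Rp p) \<and> bij_betw \<sigma> (Rp p) (Rp p) \<and>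
    (\<forall>x\<in>Rp p. \<forall>y\<in>Rp p. \<sigma> (x * y) = \<sigma> x * \<sigma> y) \<and> (\<forall>x\<in>Rp p \<inter> \<rat>. \<sigma> x = x)"
  unfolding local_aut_def by (rule aut_fixing_rats_carrier[OF zero_notin_Rp])

lemma A_D:
  assumes "a \<in> A" "prime p"
  shows "x \<in> Rp p \<Longrightarrow> a p x \<in> Rp p" "inj_on (a p) (Rp p)" "a p ` Rp p = Rp p"
    "x \<in> Rp p \<Longrightarrow> y \<in> Rp p \<Longrightarrow> a p (x * y) = a p x * a p y"
    "x \<in> Rp p \<Longrightarrow> x \<in> \<rat> \<Longrightarrow> a p x = x" "a p 1 = 1" "a p \<in> extensional (Rp p)"
    "x \<in> Rp p \<Longrightarrow> y \<in> Rp p \<Longrightarrow> a p (x / y) = a p x / a p y"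
proof -
  have "a p \<in> Ap p" using assms unfolding A_iff by blast
  then have *: "x \<in> Rp p \<Longrightarrow> a p x \<in> Rp p" "inj_on (a p) (Rp p)" "a p ` Rp p = Rp p"
    "x \<in> Rp p \<Longrightarrow> y \<in> Rp p \<Longrightarrow> a p (x * y) = a p x * a p y"
    "x \<in> Rp p \<Longrightarrow> x \<in> \<rat> \<Longrightarrow> a p x = x" "a p 1 = 1" "a p \<in> extensional (Rp p)" for x y
    unfolding local_aut_iff bij_betw_def using one_in_Rp by auto
  show "x \<in> Rp p \<Longrightarrow> a p x \<in> Rp p" "inj_on (a p) (Rp p)" "a p ` Rp p = Rp p"
    "x \<in> Rp p \<Longrightarrow> y \<in> Rp p \<Longrightarrow> a p (x * y) = a p x * a p y"
    "x \<in> Rp p \<Longrightarrow> x \<in> \<rat> \<Longrightarrow> a p x = x" "a p 1 = 1" "a p \<in> extensional (Rp p)"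
    by (fact *)+
  show "a p (x / y) = a p x / a p y" if xy: "x \<in> Rp p" "y \<in> Rp p"
  proof -
    have "a p (x / y * y) = a p (x / y) * a p y" by (rule *(4)[OF Rp_divide[OF xy] xy(2)])
    moreover have "a p y \<noteq> 0" "y \<noteq> 0" using *(1)[OF xy(2)] xy(2) Rp_nonzero by auto
    ultimately show ?thesis by (simp add: field_simps)
  qed
qed

definition glue :: "(nat \<Rightarrow> complex \<Rightarrow> complex) \<Rightarrow> complex \<Rightarrow> complex" where
  "glue a = (\<lambda>x\<in>R. SOME z. \<exists>P c. decomp x P c \<and> z = (\<Prod>p\<in>P. a p (c p)))"

lemma decomp_extend:
  assumes "decomp x P c" "P \<subseteq> Q" "finite Q" "\<And>q. q \<in> Q \<Longrightarrow> prime q" "\<And>p. prime p \<Longrightarrow> f p 1 = (1 :: complex)"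
  shows "decomp x Q (\<lambda>p. if p \<in> P then c p else 1)"
    "(\<Prod>p\<in>Q. f p (if p \<in> P then c p else 1)) = (\<Prod>p\<in>P. f p (c p))"
proof -
  have "(\<Prod>p\<in>Q. if p \<in> P then c p else 1) = (\<Prod>p\<in>P. c p)"
    using assms(2,3) by (intro prod.mono_neutral_cong_right) auto
  then show "decomp x Q (\<lambda>p. if p \<in> P then c p else 1)"
    using assms by (auto simp: decomp_def one_in_Rp)
  show "(\<Prod>p\<in>Q. f p (if p \<in> P then c p else 1)) = (\<Prod>p\<in>P. f p (c p))"
    using assms(2-5) by (intro prod.mono_neutral_cong_right) auto
qed

lemma decomp_mult:
  assumes "decomp x P c" "decomp y P d"
  shows "decomp (x * y) P (\<lambda>p. c p * d p)"
  using assms by (simp add: decomp_def Rp_mult prod.distrib)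

lemma decomp_divide:
  assumes "decomp x P c" "decomp y P d"
  shows "decomp (x / y) P (\<lambda>p. c p / d p)"
  using assms by (simp add: decomp_def Rp_divide prod_dividef)

lemma decomp_A:
  assumes "a \<in> A" "decomp x P c"
  shows "decomp (\<Prod>p\<in>P. a p (c p)) P (\<lambda>p. a p (c p))"
  using assms A_D(1)[OF assms(1)] by (simp add: decomp_def)

lemma decomp_in_R:
  assumes "decomp x P c"
  shows "x \<in> R"
proof -
  have "c p \<in> R" if "p \<in> P" for p using assms that Rp_subset unfolding decomp_def by blast
  then have "(\<Prod>p\<in>Q. c p) \<in> R" if "Q \<subseteq> P" for Q
    using that
    by (induction Q rule: infinite_finite_induct) (auto simp: one_in_radicals intro!: radicals_mult)
  then show ?thesis using assms by (auto simp: decomp_def)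
qed

lemma decomp_common:
  assumes "decomp x P c" "decomp y Q d"
  shows "\<exists>S c' d'. decomp x S c' \<and> decomp y S d' \<and>
    (\<forall>a\<in>A. (\<Prod>p\<in>S. a p (c' p)) = (\<Prod>p\<in>P. a p (c p)) \<and> (\<Prod>p\<in>S. a p (d' p)) = (\<Prod>p\<in>Q. a p (d p)))"
proof -
  have S: "P \<subseteq> P \<union> Q" "Q \<subseteq> P \<union> Q" "finite (P \<union> Q)" "\<And>q. q \<in> P \<union> Q \<Longrightarrow> prime q"
    using assms by (auto simp: decomp_def)
  let ?c = "\<lambda>p. if p \<in> P then c p else 1" and ?d = "\<lambda>p. if p \<in> Q then d p else 1"
  have "decomp x (P \<union> Q) ?c"
    by (rule decomp_extend(1)[OF assms(1) S(1,3), of "\<lambda>_ _. 1"]) (use S(4) in auto)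
  moreover have "decomp y (P \<union> Q) ?d"
    by (rule decomp_extend(1)[OF assms(2) S(2,3), of "\<lambda>_ _. 1"]) (use S(4) in auto)
  moreover have "(\<Prod>p\<in>P \<union> Q. a p (?c p)) = (\<Prod>p\<in>P. a p (c p))" if a: "a \<in> A" for a
    by (rule decomp_extend(2)[OF assms(1) S(1,3)]) (use S(4) A_D(6)[OF a] in auto)
  moreover have "(\<Prod>p\<in>P \<union> Q. a p (?d p)) = (\<Prod>p\<in>Q. a p (d p))" if a: "a \<in> A" for a
    by (rule decomp_extend(2)[OF assms(2) S(2,3)]) (use S(4) A_D(6)[OF a] in auto)
  ultimately show ?thesis by (intro exI[of _ "P \<union> Q"] exI[of _ ?c] exI[of _ ?d] conjI ballI)
qed

lemma prod_A_unique:
  assumes a: "a \<in> A" and "decomp x P c" "decomp x Q d"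
  shows "(\<Prod>p\<in>P. a p (c p)) = (\<Prod>p\<in>Q. a p (d p))"
proof -
  obtain S c' d' where S: "decomp x S c'" "decomp x S d'"
    "\<forall>a\<in>A. (\<Prod>p\<in>S. a p (c' p)) = (\<Prod>p\<in>P. a p (c p)) \<and> (\<Prod>p\<in>S. a p (d' p)) = (\<Prod>p\<in>Q. a p (d p))"
    using decomp_common[OF assms(2,3)] by (elim exE conjE)
  have p: "prime p" "c' p \<in> Rp p" "d' p \<in> Rp p" if "p \<in> S" for p
    using S(1,2) that by (auto simp: decomp_def)
  have "x \<noteq> 0" using radicals_nonzero[OF decomp_in_R[OF S(1)]] .
  then have 1: "decomp 1 S (\<lambda>p. c' p / d' p)" using decomp_divide[OF S(1,2)] by simp
  have "a p (c' p) / a p (d' p) = c' p / d' p" if "p \<in> S" for p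
  proof -
    have "c' p / d' p \<in> \<Gamma>" by (rule decomp_1_in[OF 1 that])
    then have "a p (c' p / d' p) = c' p / d' p"
      using A_D(5)[OF a p(1)[OF that]] subset_Rp rational by blast
    then show ?thesis using A_D(8)[OF a p[OF that]] by simp
  qed
  then have "(\<Prod>p\<in>S. a p (c' p) / a p (d' p)) = (\<Prod>p\<in>S. c' p / d' p)" by (rule prod.cong[OF refl])
  also have "\<dots> = 1" using 1 by (simp add: decomp_def)
  finally have "(\<Prod>p\<in>S. a p (c' p)) / (\<Prod>p\<in>S. a p (d' p)) = 1" by (simp add: prod_dividef)
  then have "(\<Prod>p\<in>S. a p (c' p)) = (\<Prod>p\<in>S. a p (d' p))" by (simp add: divide_eq_1_iff)
  then show ?thesis using bspec[OF S(3) a] by simp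
qed

lemma glue_eq:
  assumes "a \<in> A" "decomp x P c"
  shows "glue a x = (\<Prod>p\<in>P. a p (c p))"
proof -
  have "\<exists>P' c'. decomp x P' c' \<and> glue a x = (\<Prod>p\<in>P'. a p (c' p))"
    unfolding glue_def using decomp_in_R[OF assms(2)]
      someI_ex[of "\<lambda>z. \<exists>P c. decomp x P c \<and> z = (\<Prod>p\<in>P. a p (c p))"] assms(2) by auto
  then show ?thesis using prod_A_unique[OF assms(1) _ assms(2)] by metis
qed

lemma glue_Rp:
  assumes "a \<in> A" "prime p" "x \<in> Rp p"
  shows "glue a x = a p x"
  using glue_eq[OF assms(1), of x "{p}" "\<lambda>_. x"] assms(2,3) by (simp add: decomp_def)

lemma glue_mult:
  assumes a: "a \<in> A" and xy: "x \<in> R" "y \<in> R"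
  shows "glue a (x * y) = glue a x * glue a y"
proof -
  obtain P c where Pc: "decomp x P c" using decomp_exists[OF xy(1)] by blast
  obtain Q d where Qd: "decomp y Q d" using decomp_exists[OF xy(2)] by blast
  obtain S c' d' where S: "decomp x S c'" "decomp y S d'"
    using decomp_common[OF Pc Qd] by (elim exE conjE)
  have "glue a (x * y) = (\<Prod>p\<in>S. a p (c' p * d' p))" by (rule glue_eq[OF a decomp_mult[OF S]])
  also have "\<dots> = (\<Prod>p\<in>S. a p (c' p) * a p (d' p))"
    using S by (intro prod.cong A_D(4)[OF a]) (auto simp: decomp_def)
  also have "\<dots> = glue a x * glue a y" by (simp add: prod.distrib glue_eq[OF a S(1)] glue_eq[OF a S(2)])
  finally show ?thesis .
qed

lemma glue_in_R: "a \<in> A \<Longrightarrow> x \<in> R \<Longrightarrow> glue a x \<in> R"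
  using decomp_exists[of x] glue_eq decomp_in_R[OF decomp_A] by metis

lemma glue_in_RA:
  assumes a: "a \<in> A"
  shows "glue a \<in> RA"
  unfolding RA_iff
proof (intro conjI ballI)
  show "glue a \<in> extensional R" by (simp add: glue_def)
  show "glue a (x * y) = glue a x * glue a y" if "x \<in> R" "y \<in> R" for x y by (rule glue_mult[OF a that])
  show "glue a x = x" if x: "x \<in> R \<inter> \<rat>" for x
  proof -
    obtain P c where Pc: "decomp x P c" "x \<in> \<rat> \<longrightarrow> (\<forall>p\<in>P. c p \<in> \<rat>)" using decomp_exists[of x] x by blast
    have "glue a x = (\<Prod>p\<in>P. a p (c p))" by (rule glue_eq[OF a Pc(1)])
    also have "\<dots> = (\<Prod>p\<in>P. c p)"
      using Pc x by (intro prod.cong A_D(5)[OF a]) (auto simp: decomp_def)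
    finally show ?thesis using Pc(1) by (simp add: decomp_def)
  qed
  have ker: "x = 1" if x: "x \<in> R" "glue a x = 1" for x
  proof -
    obtain P c where Pc: "decomp x P c" using decomp_exists[OF x(1)] by blast
    have "decomp 1 P (\<lambda>p. a p (c p))" using decomp_A[OF a Pc] glue_eq[OF a Pc] x(2) by simp
    then have \<Gamma>: "a p (c p) \<in> \<Gamma>" if "p \<in> P" for p using decomp_1_in that by blast
    have "a p (c p) = c p" if p: "p \<in> P" for p
    proof -
      have pp: "prime p" "c p \<in> Rp p" using Pc p by (auto simp: decomp_def)
      have "a p (a p (c p)) = a p (c p)"
        using \<Gamma>[OF p] A_D(5)[OF a pp(1)] subset_Rp rational by blast
      then show ?thesis using A_D(1,2)[OF a pp(1)] pp(2) by (meson inj_onD)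
    qed
    then have "(\<Prod>p\<in>P. a p (c p)) = (\<Prod>p\<in>P. c p)" by (rule prod.cong[OF refl])
    then show ?thesis using glue_eq[OF a Pc] x(2) Pc by (simp add: decomp_def)
  qed
  show "bij_betw (glue a) R R"
    unfolding bij_betw_def
  proof
    show "inj_on (glue a) R"
    proof (rule inj_onI)
      fix x y assume xy: "x \<in> R" "y \<in> R" "glue a x = glue a y"
      have "glue a (x / y * y) = glue a (x / y) * glue a y"
        by (rule glue_mult[OF a radicals_divide[OF xy(1,2)] xy(2)])
      then have "glue a (x / y) = 1"
        using xy(3) radicals_nonzero[OF xy(2)] radicals_nonzero[OF glue_in_R[OF a xy(2)]] by simp
      then have "x / y = 1" by (rule ker[OF radicals_divide[OF xy(1,2)]])
      then show "x = y" by (simp add: divide_eq_1_iff)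
    qed
    have "y \<in> glue a ` R" if y: "y \<in> R" for y
    proof -
      obtain P d where Pd: "decomp y P d" using decomp_exists[OF y] by blast
      have "\<forall>p\<in>P. \<exists>c\<in>Rp p. a p c = d p"
      proof
        fix p assume "p \<in> P"
        then have "prime p" "d p \<in> Rp p" using Pd by (auto simp: decomp_def)
        then show "\<exists>c\<in>Rp p. a p c = d p" using A_D(3)[OF a \<open>prime p\<close>] by (metis image_iff)
      qed
      then obtain c where c: "\<And>p. p \<in> P \<Longrightarrow> c p \<in> Rp p" "\<And>p. p \<in> P \<Longrightarrow> a p (c p) = d p" by metis
      have dc: "decomp (\<Prod>p\<in>P. c p) P c" using Pd c(1) by (simp add: decomp_def)
      have "glue a (\<Prod>p\<in>P. c p) = (\<Prod>p\<in>P. a p (c p))" by (rule glue_eq[OF a dc])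
      also have "\<dots> = y" using Pd c(2) by (simp add: decomp_def)
      finally show ?thesis using decomp_in_R[OF dc] by blast
    qed
    then show "glue a ` R = R" using glue_in_R[OF a] by blast
  qed
qed

lemma prime_components_glue:
  assumes "a \<in> A"
  shows "prime_components \<Gamma> (glue a) = a"
proof (rule extensionalityI)
  show "prime_components \<Gamma> (glue a) \<in> extensional {p. prime p}" by (simp add: prime_components_def)
  show "a \<in> extensional {p. prime p}" using assms unfolding A_iff by (simp add: PiE_def)
  fix p :: nat assume p: "p \<in> {p. prime p}"
  then have "restrict (glue a) (Rp p) = a p"
    using A_D(7)[OF assms] glue_Rp[OF assms] by (intro extensionalityI[of _ "Rp p"]) auto
  then show "prime_components \<Gamma> (glue a) p = a p" using p by (simp add: prime_components_def)
qed

lemma prime_components_in_A: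
  assumes \<sigma>: "\<sigma> \<in> RA"
  shows "prime_components \<Gamma> \<sigma> \<in> A"
proof -
  have "restrict \<sigma> (Rp p) \<in> Ap p" if p: "prime p" for p
  proof -
    have sub: "Rp p \<subseteq> R" by (rule Rp_subset[OF p])
    have Rp: "\<sigma> x \<in> Rp p \<longleftrightarrow> x \<in> Rp p" if x: "x \<in> R" for x
    proof -
      have "\<sigma> x ^ p ^ n \<in> \<Gamma> \<longleftrightarrow> x ^ p ^ n \<in> \<Gamma>" for n
      proof
        assume *: "\<sigma> x ^ p ^ n \<in> \<Gamma>"
        then have "\<sigma> (\<sigma> x ^ p ^ n) = \<sigma> x ^ p ^ n" using subset_radicals rational RA_D(5)[OF \<sigma>] by blast
        also have "\<dots> = \<sigma> (x ^ p ^ n)" by (rule RA_power[OF \<sigma> x, symmetric])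
        finally have "\<sigma> x ^ p ^ n = x ^ p ^ n"
          using RA_D(2)[OF \<sigma>] x by (meson inj_onD radicals_power RA_D(1)[OF \<sigma>])
        then show "x ^ p ^ n \<in> \<Gamma>" using * by simp
      next
        assume *: "x ^ p ^ n \<in> \<Gamma>"
        then have "\<sigma> (x ^ p ^ n) = x ^ p ^ n" using subset_radicals rational RA_D(5)[OF \<sigma>] by blast
        then show "\<sigma> x ^ p ^ n \<in> \<Gamma>" using * RA_power[OF \<sigma> x] by simp
      qed
      then show ?thesis
        using radicals_nonzero[OF x] radicals_nonzero[OF RA_D(1)[OF \<sigma> x]] by (simp add: p_radicals_def)
    qed
    have "\<sigma> ` Rp p = Rp p"
    proof
      show "\<sigma> ` Rp p \<subseteq> Rp p" using Rp sub by blast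
      show "Rp p \<subseteq> \<sigma> ` Rp p"
      proof
        fix y assume y: "y \<in> Rp p"
        then obtain x where "x \<in> R" "y = \<sigma> x" using sub RA_D(3)[OF \<sigma>] by blast
        then show "y \<in> \<sigma> ` Rp p" using Rp y by blast
      qed
    qed
    then have "bij_betw \<sigma> (Rp p) (Rp p)"
      unfolding bij_betw_def using inj_on_subset[OF RA_D(2)[OF \<sigma>] sub] by blast
    moreover have "\<sigma> (x * y) = \<sigma> x * \<sigma> y" if "x \<in> Rp p" "y \<in> Rp p" for x y
      by (rule RA_D(4)[OF \<sigma> subsetD[OF sub that(1)] subsetD[OF sub that(2)]])
    moreover have "\<sigma> x = x" if "x \<in> Rp p" "x \<in> \<rat>" for x
      by (rule RA_D(5)[OF \<sigma> subsetD[OF sub that(1)] that(2)])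
    ultimately show ?thesis unfolding local_aut_iff by (simp add: Rp_mult)
  qed
  then show ?thesis unfolding A_iff prime_components_def by (simp add: restrict_PiE_iff)
qed

lemma glue_prime_components:
  assumes \<sigma>: "\<sigma> \<in> RA"
  shows "glue (prime_components \<Gamma> \<sigma>) = \<sigma>"
proof (rule extensionalityI)
  show "glue (prime_components \<Gamma> \<sigma>) \<in> extensional R" by (simp add: glue_def)
  show "\<sigma> \<in> extensional R" using \<sigma> unfolding RA_iff by blast
  fix x assume "x \<in> R"
  then obtain P c where Pc: "decomp x P c" using decomp_exists by blast
  have "\<sigma> (\<Prod>p\<in>Q. c p) = (\<Prod>p\<in>Q. \<sigma> (c p)) \<and> (\<Prod>p\<in>Q. c p) \<in> R" if "Q \<subseteq> P" for Q
    using that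
  proof (induction Q rule: infinite_finite_induct)
    case (insert p Q)
    then have "p \<in> P" by simp
    then have "c p \<in> R" using Pc Rp_subset unfolding decomp_def by blast
    then show ?case using insert RA_D(4)[OF \<sigma>] by (simp add: radicals_mult)
  qed (simp_all add: RA_D(6)[OF \<sigma>] one_in_radicals)
  then have "\<sigma> x = (\<Prod>p\<in>P. \<sigma> (c p))" using Pc by (simp add: decomp_def)
  also have "\<dots> = (\<Prod>p\<in>P. prime_components \<Gamma> \<sigma> p (c p))"
    using Pc by (intro prod.cong) (auto simp: decomp_def prime_components_def)
  also have "\<dots> = glue (prime_components \<Gamma> \<sigma>) x"
    by (rule glue_eq[OF prime_components_in_A[OF \<sigma>] Pc, symmetric])
  finally show "glue (prime_components \<Gamma> \<sigma>) x = \<sigma> x" by simp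
qed

lemma galois_subgroup_iff: "a \<in> galois_subgroup \<Gamma> \<longleftrightarrow> a \<in> A \<and> glue a \<in> galois_on_radicals \<Gamma>"
proof
  assume "a \<in> galois_subgroup \<Gamma>"
  then obtain \<sigma> where \<sigma>: "\<sigma> \<in> galois_on_radicals \<Gamma>" "a = prime_components \<Gamma> \<sigma>"
    by (auto simp: galois_subgroup_def)
  then have "\<sigma> \<in> RA" by (simp add: galois_on_radicals_eq)
  then show "a \<in> A \<and> glue a \<in> galois_on_radicals \<Gamma>"
    using \<sigma> prime_components_in_A glue_prime_components by simp
next
  assume "a \<in> A \<and> glue a \<in> galois_on_radicals \<Gamma>"
  then show "a \<in> galois_subgroup \<Gamma>"
    unfolding galois_subgroup_def using prime_components_glue by (metis imageI)
qed

lemma group_local_aut: "group (local_aut \<Gamma> p)"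
  unfolding local_aut_def by (rule group_aut_fixing_rats[OF mult_submonoid_Rp zero_notin_Rp])

lemma group_global_aut: "group (global_aut \<Gamma>)"
  unfolding global_aut_def by (rule product_group) (rule group_local_aut)

lemma global_aut_mult:
  assumes "a \<in> A" "b \<in> A"
  shows "a \<cdot> b = (\<lambda>p\<in>{p. prime p}. compose (Rp p) (a p) (b p))"
proof -
  have "a p \<otimes>\<^bsub>local_aut \<Gamma> p\<^esub> b p = compose (Rp p) (a p) (b p)" if "prime p" for p
    using assms that unfolding A_iff local_aut_def by (intro aut_fixing_rats_mult) auto
  then show ?thesis unfolding global_aut_def mult_product_group by (auto intro: restrict_ext)
qed

lemma glue_global_mult:
  assumes a: "a \<in> A" and b: "b \<in> A"
  shows "glue (a \<cdot> b) = compose R (glue a) (glue b)"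
proof (rule extensionalityI)
  interpret G: group "global_aut \<Gamma>" by (rule group_global_aut)
  have ab: "a \<cdot> b \<in> A" using a b by (rule G.m_closed)
  show "glue (a \<cdot> b) \<in> extensional R" by (simp add: glue_def)
  show "compose R (glue a) (glue b) \<in> extensional R" by (rule compose_extensional)
  fix x assume x: "x \<in> R"
  then obtain P c where Pc: "decomp x P c" using decomp_exists by blast
  have "glue (a \<cdot> b) x = (\<Prod>p\<in>P. (a \<cdot> b) p (c p))"
    by (rule glue_eq[OF ab Pc])
  also have "\<dots> = (\<Prod>p\<in>P. a p (b p (c p)))"
    unfolding global_aut_mult[OF a b] using Pc by (intro prod.cong) (auto simp: decomp_def compose_def)
  also have "\<dots> = glue a (glue b x)"
    using glue_eq[OF a decomp_A[OF b Pc]] glue_eq[OF b Pc] by simp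
  finally show "glue (a \<cdot> b) x = compose R (glue a) (glue b) x" using x by (simp add: compose_eq)
qed

end

section \<open>Characters of the quotient\<close>

lemma finite_image_factor:
  assumes "finite (g ` D)" "\<And>a b. a \<in> D \<Longrightarrow> b \<in> D \<Longrightarrow> g a = g b \<Longrightarrow> f a = f b"
  shows "finite (f ` D)"
proof (rule finite_surj[OF assms(1)])
  show "f ` D \<subseteq> (\<lambda>t. f (SOME a. a \<in> D \<and> g a = t)) ` (g ` D)"
  proof
    fix y assume "y \<in> f ` D"
    then obtain a where a: "a \<in> D" "y = f a" by blast
    have "(SOME b. b \<in> D \<and> g b = g a) \<in> D \<and> g (SOME b. b \<in> D \<and> g b = g a) = g a"
      by (rule someI[of _ a]) (use a in simp)
    then have "f (SOME b. b \<in> D \<and> g b = g a) = y" using assms(2) a by blast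
    then show "y \<in> (\<lambda>t. f (SOME a. a \<in> D \<and> g a = t)) ` (g ` D)" using a(1) by blast
  qed
qed

context rational_group
begin

definition agree :: "nat set \<Rightarrow> (nat \<Rightarrow> complex set) \<Rightarrow> (nat \<Rightarrow> complex \<Rightarrow> complex) \<Rightarrow> (nat \<Rightarrow> complex \<Rightarrow> complex) \<Rightarrow> bool" where
  "agree P E a b \<longleftrightarrow> (\<forall>p\<in>P. \<forall>z\<in>E p. a p z = b p z)"

lemma glue_locally_constant:
  assumes "finite E" "E \<subseteq> R"
  shows "\<exists>P D. finite P \<and> (\<forall>p\<in>P. prime p) \<and> (\<forall>p. finite (D p) \<and> D p \<subseteq> Rp p) \<and>
    (\<forall>a\<in>A. \<forall>b\<in>A. agree P D a b \<longrightarrow> (\<forall>x\<in>E. glue a x = glue b x))"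
proof -
  have "\<forall>x\<in>E. \<exists>Pc. decomp x (fst Pc) (snd Pc)"
    using decomp_exists assms(2) by (metis fst_conv snd_conv subsetD)
  then obtain Pc where Pc: "\<And>x. x \<in> E \<Longrightarrow> decomp x (fst (Pc x)) (snd (Pc x))" by metis
  define P where "P = (\<Union>x\<in>E. fst (Pc x))"
  define D where "D p = (\<lambda>x. snd (Pc x) p) ` {x \<in> E. p \<in> fst (Pc x)}" for p
  have 1: "finite P" "\<forall>p\<in>P. prime p" using Pc assms(1) by (auto simp: P_def decomp_def)
  have 2: "\<forall>p. finite (D p) \<and> D p \<subseteq> Rp p" using Pc assms(1) by (auto simp: D_def decomp_def)
  have 3: "glue a x = glue b x" if a: "a \<in> A" and b: "b \<in> A" and ag: "agree P D a b" and x: "x \<in> E" for a b x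
  proof -
    have "a p (snd (Pc x) p) = b p (snd (Pc x) p)" if p: "p \<in> fst (Pc x)" for p
    proof -
      have "p \<in> P" "snd (Pc x) p \<in> D p" using p x by (auto simp: P_def D_def)
      then show ?thesis using ag by (simp add: agree_def)
    qed
    then show ?thesis
      unfolding glue_eq[OF a Pc[OF x]] glue_eq[OF b Pc[OF x]] by (rule prod.cong[OF refl])
  qed
  show ?thesis by (intro exI[of _ P] exI[of _ D] conjI 1 2 ballI impI) (rule 3)
qed

lemma local_aut_subset_PiE: "Ap p \<subseteq> (\<Pi>\<^sub>E z\<in>Rp p. Rp p)"
proof
  fix x assume "x \<in> Ap p"
  then have "x \<in> extensional (Rp p)" "x ` Rp p = Rp p" unfolding local_aut_iff bij_betw_def by blast+
  then show "x \<in> (\<Pi>\<^sub>E z\<in>Rp p. Rp p)" unfolding PiE_def by blast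
qed

lemma topspace_local_topology: "topspace (local_topology \<Gamma> p) = Ap p"
proof -
  have "Ap p \<subseteq> (\<Pi>\<^sub>E z\<in>Rp p. Rp p)" by (rule local_aut_subset_PiE)
  then show ?thesis unfolding local_topology_def by auto
qed

lemma openin_local_topology_agree:
  assumes D: "finite D" "D \<subseteq> Rp p" and x: "x \<in> Ap p"
  shows "openin (local_topology \<Gamma> p) {y \<in> Ap p. \<forall>z\<in>D. y z = x z}"
proof -
  have xR: "x z \<in> Rp p" if "z \<in> Rp p" for z using x that unfolding local_aut_iff bij_betw_def by blast
  note sub = local_aut_subset_PiE
  define U where "U z = (if z \<in> D then {x z} else Rp p)" for z
  have "openin (product_topology (\<lambda>_. discrete_topology (Rp p)) (Rp p)) (PiE (Rp p) U)"
    unfolding openin_PiE_gen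
  proof (rule disjI2, intro conjI ballI)
    show "finite {i \<in> Rp p. U i \<noteq> topspace (discrete_topology (Rp p))}"
      by (rule finite_subset[OF _ D(1)]) (auto simp: U_def)
    show "openin (discrete_topology (Rp p)) (U i)" if "i \<in> Rp p" for i
      using that xR by (auto simp: U_def)
  qed
  then have "openin (local_topology \<Gamma> p) (Ap p \<inter> PiE (Rp p) U)"
    unfolding local_topology_def by (rule openin_subtopology_Int2)
  moreover have "Ap p \<inter> PiE (Rp p) U = {y \<in> Ap p. \<forall>z\<in>D. y z = x z}"
  proof (intro equalityI subsetI)
    fix y assume "y \<in> Ap p \<inter> PiE (Rp p) U"
    then show "y \<in> {y \<in> Ap p. \<forall>z\<in>D. y z = x z}"
      using D(2) by (auto simp: U_def PiE_def Pi_def split: if_splits)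
  next
    fix y assume y: "y \<in> {y \<in> Ap p. \<forall>z\<in>D. y z = x z}"
    then have "y \<in> (\<Pi>\<^sub>E z\<in>Rp p. Rp p)" using sub by blast
    then show "y \<in> Ap p \<inter> PiE (Rp p) U"
      using y by (auto simp: U_def PiE_def Pi_def)
  qed
  ultimately show ?thesis by simp
qed

end

lemma mu2_simps [simp]: "carrier mu2 = {1, -1}" "x \<otimes>\<^bsub>mu2\<^esub> y = x * y" "\<one>\<^bsub>mu2\<^esub> = 1"
  by (simp_all add: mu2_def)

context fg_rational_group
begin

abbreviation G :: "(nat \<Rightarrow> complex \<Rightarrow> complex) set" where "G \<equiv> galois_subgroup \<Gamma>"

abbreviation coset where "coset a \<equiv> G #>\<^bsub>global_aut \<Gamma>\<^esub> a"

lemma galois_subgroup_characters: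
  "\<exists>\<Phi> P D. finite \<Phi> \<and> \<Phi> \<subseteq> hom (global_aut \<Gamma>) mu2 \<and> G = {a \<in> A. \<forall>f\<in>\<Phi>. f a = 1} \<and>
     finite P \<and> (\<forall>p\<in>P. prime p) \<and> (\<forall>p. finite (D p) \<and> D p \<subseteq> Rp p) \<and>
     (\<forall>a\<in>A. \<forall>b\<in>A. agree P D a b \<longrightarrow> (\<forall>f\<in>\<Phi>. f a = f b))"
proof -
  obtain I where I: "finite I" "I \<subseteq> B" "galois_on_radicals \<Gamma> = {\<sigma> \<in> RA. \<forall>i\<in>I. eps \<sigma> i = 1}"
    by (rule finite_eps_criterion)
  obtain E where E: "finite E" "E \<subseteq> R"
    "\<And>\<sigma> \<tau> i. \<sigma> \<in> RA \<Longrightarrow> \<tau> \<in> RA \<Longrightarrow> \<forall>x\<in>E. \<sigma> x = \<tau> x \<Longrightarrow> i \<in> I \<Longrightarrow> eps \<sigma> i = eps \<tau> i"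
    using eps_locally_constant[OF I(1,2)] by metis
  obtain P D where PD: "finite P" "\<forall>p\<in>P. prime p" "\<forall>p. finite (D p) \<and> D p \<subseteq> Rp p"
    "\<forall>a\<in>A. \<forall>b\<in>A. agree P D a b \<longrightarrow> (\<forall>x\<in>E. glue a x = glue b x)"
    using glue_locally_constant[OF E(1,2)] by (elim exE conjE)
  define f where "f i a = Re (eps (glue a) i)" for i a
  have val: "eps (glue a) i = 1 \<and> f i a = 1 \<or> eps (glue a) i = -1 \<and> f i a = -1" if "a \<in> A" "i \<in> I" for a i
  proof -
    have "i \<in> B" using that(2) I(2) by blast
    from eps_square[OF glue_in_RA[OF that(1)] this] show ?thesis unfolding f_def by auto
  qed
  have "f i \<in> hom (global_aut \<Gamma>) mu2" if i: "i \<in> I" for i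
  proof (rule homI)
    show "f i a \<in> carrier mu2" if "a \<in> A" for a using val[OF that i] by auto
    fix a b assume ab: "a \<in> A" "b \<in> A"
    have iB: "i \<in> B" using i I(2) by blast
    have "f i (a \<cdot> b) = Re (eps (glue a) i * eps (glue b) i)"
      unfolding f_def glue_global_mult[OF ab] eps_compose[OF glue_in_RA[OF ab(1)] glue_in_RA[OF ab(2)] iB] ..
    then show "f i (a \<cdot> b) = f i a \<otimes>\<^bsub>mu2\<^esub> f i b"
      using val[OF ab(1) i] val[OF ab(2) i] by auto
  qed
  then have 1: "finite (f ` I)" "f ` I \<subseteq> hom (global_aut \<Gamma>) mu2" using I(1) by auto
  have 2: "G = {a \<in> A. \<forall>g\<in>f ` I. g a = 1}"
  proof (intro equalityI subsetI)
    fix a assume "a \<in> G"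
    then have "a \<in> A" "\<forall>i\<in>I. eps (glue a) i = 1" unfolding galois_subgroup_iff I(3) by auto
    then show "a \<in> {a \<in> A. \<forall>g\<in>f ` I. g a = 1}" by (simp add: f_def)
  next
    fix a assume a: "a \<in> {a \<in> A. \<forall>g\<in>f ` I. g a = 1}"
    then have "eps (glue a) i = 1" if "i \<in> I" for i using val[of a i] that by auto
    then show "a \<in> G" unfolding galois_subgroup_iff I(3) using a glue_in_RA by blast
  qed
  have 3: "\<forall>a\<in>A. \<forall>b\<in>A. agree P D a b \<longrightarrow> (\<forall>g\<in>f ` I. g a = g b)"
  proof (intro ballI impI)
    fix a b g assume ab: "a \<in> A" "b \<in> A" "agree P D a b" "g \<in> f ` I"
    then obtain i where i: "i \<in> I" "g = f i" by blast
    have "eps (glue a) i = eps (glue b) i"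
      by (rule E(3)[OF glue_in_RA[OF ab(1)] glue_in_RA[OF ab(2)] _ i(1)]) (use PD(4) ab in blast)
    then show "g a = g b" by (simp add: i(2) f_def)
  qed
  show ?thesis by (intro exI[of _ "f ` I"] exI[of _ P] exI[of _ D] conjI 1 2 3 PD(1-3))
qed

lemma hom_mu2_inv:
  assumes "group H" "f \<in> hom H mu2" "a \<in> carrier H"
  shows "f (inv\<^bsub>H\<^esub> a) = f a" "f \<one>\<^bsub>H\<^esub> = 1"
proof -
  interpret H: group H by (rule assms(1))
  have mult: "f (x \<otimes>\<^bsub>H\<^esub> y) = f x * f y" "f x \<in> {1, -1}" if "x \<in> carrier H" "y \<in> carrier H" for x y
    using hom_mult[OF assms(2) that] hom_carrier[OF assms(2)] that by auto
  show one: "f \<one>\<^bsub>H\<^esub> = 1"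
    using mult(1)[OF H.one_closed H.one_closed] mult(2)[OF H.one_closed H.one_closed] by auto
  have "f (inv\<^bsub>H\<^esub> a) * f a = 1"
    using mult(1)[OF H.inv_closed[OF assms(3)] assms(3)] one assms(3) by simp
  then show "f (inv\<^bsub>H\<^esub> a) = f a"
    using mult(2)[OF assms(3,3)] by auto
qed

lemma normal_galois_subgroup: "G \<lhd> global_aut \<Gamma>"
proof -
  interpret H: group "global_aut \<Gamma>" by (rule group_global_aut)
  obtain \<Phi> where \<Phi>: "\<Phi> \<subseteq> hom (global_aut \<Gamma>) mu2" "G = {a \<in> A. \<forall>f\<in>\<Phi>. f a = 1}"
    using galois_subgroup_characters by (elim exE conjE)
  have mult: "f (a \<cdot> b) = f a * f b" if "f \<in> \<Phi>" "a \<in> A" "b \<in> A" for f a b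
    using hom_mult[OF subsetD[OF \<Phi>(1) that(1)] that(2,3)] by simp
  have inv: "f (ginv a) = f a" "f \<one>\<^bsub>global_aut \<Gamma>\<^esub> = 1" if "f \<in> \<Phi>" "a \<in> A" for f a
    using hom_mu2_inv[OF group_global_aut subsetD[OF \<Phi>(1) that(1)] that(2)] .
  have sq: "f a * f a = 1" if "f \<in> \<Phi>" "a \<in> A" for f a
    using mult[OF that(1) H.inv_closed[OF that(2)] that(2)] inv[OF that] that(2) by simp
  show ?thesis
    unfolding H.normal_inv_iff
  proof (intro conjI ballI)
    show "subgroup G (global_aut \<Gamma>)"
    proof (rule H.subgroupI)
      show "G \<subseteq> A" unfolding \<Phi>(2) by blast
      show "G \<noteq> {}" unfolding \<Phi>(2) using inv(2) H.one_closed by blast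
    next
      fix a assume "a \<in> G"
      then have a: "a \<in> A" "\<And>f. f \<in> \<Phi> \<Longrightarrow> f a = 1" unfolding \<Phi>(2) by blast+
      have "f (ginv a) = 1" if "f \<in> \<Phi>" for f
        using inv(1)[OF that a(1)] a(2)[OF that] by simp
      then show "ginv a \<in> G" unfolding \<Phi>(2) using H.inv_closed[OF a(1)] by blast
      fix b assume "b \<in> G"
      then have b: "b \<in> A" "\<And>f. f \<in> \<Phi> \<Longrightarrow> f b = 1" unfolding \<Phi>(2) by blast+
      have "f (a \<cdot> b) = 1" if "f \<in> \<Phi>" for f
        using mult[OF that a(1) b(1)] a(2)[OF that] b(2)[OF that] by simp
      then show "a \<cdot> b \<in> G" unfolding \<Phi>(2) using H.m_closed[OF a(1) b(1)] by blast
    qed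
    fix x h assume x: "x \<in> A" and h: "h \<in> G"
    then have "h \<in> A" "\<forall>f\<in>\<Phi>. f h = 1" by (auto simp: \<Phi>(2))
    then have "f (x \<cdot> h \<cdot> ginv x) = 1" if "f \<in> \<Phi>" for f
      using mult[OF that H.m_closed[OF x \<open>h \<in> A\<close>] H.inv_closed[OF x]] mult[OF that x \<open>h \<in> A\<close>]
        inv(1)[OF that x] sq[OF that x] bspec[OF \<open>\<forall>f\<in>\<Phi>. f h = 1\<close> that] by simp
    then show "x \<cdot> h \<cdot> ginv x \<in> G"
      using x \<open>h \<in> A\<close> by (simp add: \<Phi>(2))
  qed
qed

lemma coset_eq_iff:
  assumes "a \<in> A" "b \<in> A"
  shows "coset a = coset b \<longleftrightarrow> a \<cdot> ginv b \<in> G"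
proof -
  interpret N: normal G "global_aut \<Gamma>" by (rule normal_galois_subgroup)
  show ?thesis
  proof
    assume "coset a = coset b"
    then have "a \<in> coset b" using N.rcos_self[OF assms(1) N.subgroup_axioms] by simp
    then obtain g where g: "g \<in> G" "a = g \<cdot> b" by (auto simp: r_coset_def)
    then show "a \<cdot> ginv b \<in> G"
      using assms(2) N.subset by (simp add: N.m_assoc subset_iff)
  next
    assume g: "a \<cdot> ginv b \<in> G"
    have "a = (a \<cdot> ginv b) \<cdot> b"
      using assms by (simp add: N.m_assoc)
    then have "a \<in> coset b" using g by (auto simp: r_coset_def)
    then show "coset a = coset b"
      using N.repr_independence[OF _ assms(2) N.subgroup_axioms] by metis
  qed
qed

abbreviation Q where "Q \<equiv> global_aut \<Gamma> Mod G"

abbreviation Chars where "Chars \<equiv> quotient_characters \<Gamma>"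

lemma carrier_Q: "carrier Q = coset ` A"
  by (auto simp: FactGroup_def RCOSETS_def)

lemma Chars_iff: "chi \<in> Chars \<longleftrightarrow> chi \<in> hom Q mu2 \<and> chi \<in> extensional (carrier Q)"
  by (simp add: quotient_characters_def Let_def)

lemma Q_mult:
  assumes "a \<in> A" "b \<in> A"
  shows "(coset a) \<otimes>\<^bsub>Q\<^esub> (coset b) = coset (a \<cdot> b)"
  using normal.rcos_sum[OF normal_galois_subgroup assms] by (simp add: FactGroup_def)

lemma inflate_hom:
  assumes "chi \<in> Chars"
  shows "inflate \<Gamma> chi \<in> hom (global_aut \<Gamma>) mu2"
proof (rule homI)
  have h: "chi \<in> hom Q mu2" using assms by (simp add: Chars_iff)
  show "inflate \<Gamma> chi a \<in> carrier mu2" if "a \<in> A" for a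
    unfolding inflate_def using hom_carrier[OF h] that by (auto simp: carrier_Q)
  show "inflate \<Gamma> chi (a \<cdot> b) = inflate \<Gamma> chi a \<otimes>\<^bsub>mu2\<^esub> inflate \<Gamma> chi b" if "a \<in> A" "b \<in> A" for a b
    unfolding inflate_def Q_mult[OF that, symmetric] by (rule hom_mult[OF h]) (use that in \<open>auto simp: carrier_Q\<close>)
qed

lemma inflate_eq:
  assumes "a \<in> A" "b \<in> A" "a \<cdot> ginv b \<in> G"
  shows "inflate \<Gamma> chi a = inflate \<Gamma> chi b"
  unfolding inflate_def using coset_eq_iff[OF assms(1,2)] assms(3) by simp

lemma inflate_galois:
  assumes "chi \<in> Chars" "a \<in> G"
  shows "inflate \<Gamma> chi a = 1"
proof -
  interpret N: normal G "global_aut \<Gamma>" by (rule normal_galois_subgroup)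
  have a: "a \<in> A" using assms(2) N.subset by blast
  have "inflate \<Gamma> chi a = inflate \<Gamma> chi \<one>\<^bsub>global_aut \<Gamma>\<^esub>"
    by (rule inflate_eq) (use a assms(2) in simp_all)
  also have "\<dots> = 1" by (rule hom_mu2_inv(2)[OF group_global_aut inflate_hom[OF assms(1)] a])
  finally show ?thesis .
qed

lemma quotient_character_exists:
  assumes f: "f \<in> hom (global_aut \<Gamma>) mu2" "\<And>a. a \<in> G \<Longrightarrow> f a = 1"
  obtains chi where "chi \<in> Chars" "\<And>a. a \<in> A \<Longrightarrow> inflate \<Gamma> chi a = f a"
proof -
  interpret N: normal G "global_aut \<Gamma>" by (rule normal_galois_subgroup)
  define chi where "chi = (\<lambda>C\<in>carrier Q. f (SOME a. a \<in> A \<and> coset a = C))"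
  have eq: "chi (coset a) = f a" if a: "a \<in> A" for a
  proof -
    define b where "b = (SOME b. b \<in> A \<and> coset b = coset a)"
    have b: "b \<in> A \<and> coset b = coset a"
      unfolding b_def by (rule someI[of _ a]) (use a in simp)
    have g: "b \<cdot> ginv a \<in> G"
      using b coset_eq_iff a by blast
    have "f b = f ((b \<cdot> ginv a) \<cdot> a)"
      using a b by (simp add: N.m_assoc)
    also have "\<dots> = f (b \<cdot> ginv a) * f a"
      using hom_mult[OF f(1)] a b by simp
    finally have "f b = f a" using f(2)[OF g] by simp
    moreover have "chi (coset a) = f b"
      unfolding chi_def b_def using a by (simp add: carrier_Q)
    ultimately show ?thesis by simp
  qed
  have "chi \<in> hom Q mu2"
  proof (rule homI)
    fix C assume "C \<in> carrier Q"
    then show "chi C \<in> carrier mu2" using eq hom_carrier[OF f(1)] by (auto simp: carrier_Q)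
  next
    fix C C' assume "C \<in> carrier Q" "C' \<in> carrier Q"
    then obtain a b where ab: "a \<in> A" "b \<in> A" "C = coset a" "C' = coset b"
      by (auto simp: carrier_Q)
    have "chi (C \<otimes>\<^bsub>Q\<^esub> C') = f (a \<cdot> b)"
      unfolding ab(3,4) Q_mult[OF ab(1,2)] by (rule eq[OF N.m_closed[OF ab(1,2)]])
    then show "chi (C \<otimes>\<^bsub>Q\<^esub> C') = chi C \<otimes>\<^bsub>mu2\<^esub> chi C'"
      using hom_mult[OF f(1) ab(1,2)] eq[OF ab(1)] eq[OF ab(2)] ab(3,4) by simp
  qed
  then have "chi \<in> Chars" unfolding Chars_iff by (simp add: chi_def)
  then show ?thesis using that eq by (simp add: inflate_def)
qed

lemma quotient_character_eqI:
  assumes "chi \<in> Chars" "chi' \<in> Chars" "\<And>a. a \<in> A \<Longrightarrow> inflate \<Gamma> chi a = inflate \<Gamma> chi' a"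
  shows "chi = chi'"
proof (rule extensionalityI[of _ "carrier Q"])
  show "chi \<in> extensional (carrier Q)" "chi' \<in> extensional (carrier Q)"
    using assms(1,2) by (simp_all only: Chars_iff)
  show "chi C = chi' C" if "C \<in> carrier Q" for C
    using that assms(3) unfolding carrier_Q inflate_def by blast
qed

lemma finite_Chars: "finite Chars"
proof -
  interpret N: normal G "global_aut \<Gamma>" by (rule normal_galois_subgroup)
  obtain \<Phi> where \<Phi>: "finite \<Phi>" "\<Phi> \<subseteq> hom (global_aut \<Gamma>) mu2" "G = {a \<in> A. \<forall>f\<in>\<Phi>. f a = 1}"
    using galois_subgroup_characters by (elim exE conjE)
  have mult: "f (a \<cdot> b) = f a * f b" "f a \<in> {1, -1}" if "f \<in> \<Phi>" "a \<in> A" "b \<in> A" for f a b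
    using hom_mult[OF subsetD[OF \<Phi>(2) that(1)] that(2,3)] hom_carrier[OF subsetD[OF \<Phi>(2) that(1)]] that(2) by auto
  have fin: "finite ((\<lambda>a. \<lambda>f\<in>\<Phi>. f a) ` A)"
  proof (rule finite_subset)
    show "(\<lambda>a. \<lambda>f\<in>\<Phi>. f a) ` A \<subseteq> (\<Pi>\<^sub>E f\<in>\<Phi>. {1, -1})"
    proof
      fix t assume "t \<in> (\<lambda>a. \<lambda>f\<in>\<Phi>. f a) ` A"
      then obtain a where a: "a \<in> A" "t = (\<lambda>f\<in>\<Phi>. f a)" by blast
      have "f a \<in> {1, -1}" if "f \<in> \<Phi>" for f by (rule mult(2)[OF that a(1) a(1)])
      then show "t \<in> (\<Pi>\<^sub>E f\<in>\<Phi>. {1, -1})" unfolding a(2) restrict_PiE_iff by blast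
    qed
    show "finite (\<Pi>\<^sub>E f\<in>\<Phi>. {1, -1 :: real})" using \<Phi>(1) by (intro finite_PiE) auto
  qed
  have "finite (carrier Q)"
    unfolding carrier_Q
  proof (rule finite_image_factor[OF fin])
    fix a b assume ab: "a \<in> A" "b \<in> A" and eq: "(\<lambda>f\<in>\<Phi>. f a) = (\<lambda>f\<in>\<Phi>. f b)"
    have "f (a \<cdot> ginv b) = 1" if f: "f \<in> \<Phi>" for f
    proof -
      have "f a = f b" using fun_cong[OF eq, of f] f by simp
      then show ?thesis
        using mult(1)[OF f ab(1) N.inv_closed[OF ab(2)]] hom_mu2_inv(1)[OF group_global_aut subsetD[OF \<Phi>(2) f] ab(2)]
          mult(2)[OF f ab(2,2)] by auto
    qed
    then have "a \<cdot> ginv b \<in> G"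
      unfolding \<Phi>(3) using N.m_closed[OF ab(1) N.inv_closed[OF ab(2)]] by blast
    then show "coset a = coset b" using coset_eq_iff ab by blast
  qed
  moreover have "Chars \<subseteq> (\<Pi>\<^sub>E C\<in>carrier Q. {1, -1})"
  proof
    fix chi assume "chi \<in> Chars"
    then have "chi \<in> hom Q mu2" "chi \<in> extensional (carrier Q)" unfolding Chars_iff by auto
    then show "chi \<in> (\<Pi>\<^sub>E C\<in>carrier Q. {1, -1})" using hom_carrier[of chi Q mu2] by (auto simp: PiE_def)
  qed
  ultimately show ?thesis by (meson finite_PiE finite.emptyI finite.insertI finite_subset)
qed

lemma trivial_character_in_Chars: "(\<lambda>C\<in>carrier Q. 1) \<in> Chars"
  unfolding Chars_iff
proof
  interpret N: normal G "global_aut \<Gamma>" by (rule normal_galois_subgroup)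
  interpret FQ: group Q by (rule N.factorgroup_is_group)
  show "(\<lambda>C\<in>carrier Q. 1) \<in> hom Q mu2"
  proof (rule homI)
    fix C C' assume C: "C \<in> carrier Q" "C' \<in> carrier Q"
    have "C \<otimes>\<^bsub>Q\<^esub> C' \<in> carrier Q" by (rule FQ.m_closed[OF C])
    then show "(\<lambda>C\<in>carrier Q. 1) (C \<otimes>\<^bsub>Q\<^esub> C') = (\<lambda>C\<in>carrier Q. 1) C \<otimes>\<^bsub>mu2\<^esub> (\<lambda>C\<in>carrier Q. 1) C'"
      using C by (simp del: mult_FactGroup carrier_FactGroup)
  qed simp
qed simp

lemma sum_inflate:
  assumes a: "a \<in> A"
  shows "(\<Sum>chi\<in>Chars. inflate \<Gamma> chi a) = (if a \<in> G then of_nat (card Chars) else 0)"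
proof (cases "a \<in> G")
  case True
  then show ?thesis by (simp add: inflate_galois)
next
  case False
  obtain \<Phi> where \<Phi>: "\<Phi> \<subseteq> hom (global_aut \<Gamma>) mu2" "G = {a \<in> A. \<forall>f\<in>\<Phi>. f a = 1}"
    using galois_subgroup_characters by (elim exE conjE)
  then obtain f where f: "f \<in> \<Phi>" "f a \<noteq> 1" using False a by auto
  have fh: "f \<in> hom (global_aut \<Gamma>) mu2" using f(1) \<Phi>(1) by blast
  then have "f a \<in> {1, -1}" using hom_carrier[of f "global_aut \<Gamma>" mu2] a by auto
  then have fa: "f a = -1" using f(2) by simp
  obtain chi0 where chi0: "chi0 \<in> Chars" "\<And>a. a \<in> A \<Longrightarrow> inflate \<Gamma> chi0 a = f a"
    using quotient_character_exists[OF fh] f(1) \<Phi>(2) by blast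
  define tw where "tw chi = (\<lambda>C\<in>carrier Q. chi C * chi0 C)" for chi
  have tw_Chars: "tw chi \<in> Chars" if chi: "chi \<in> Chars" for chi
    unfolding Chars_iff
  proof
    interpret N: normal G "global_aut \<Gamma>" by (rule normal_galois_subgroup)
    interpret FQ: group Q by (rule N.factorgroup_is_group)
    have h: "chi \<in> hom Q mu2" "chi0 \<in> hom Q mu2" using chi chi0(1) by (simp_all only: Chars_iff)
    show "tw chi \<in> hom Q mu2"
    proof (rule homI)
      fix C assume C: "C \<in> carrier Q"
      have "chi C \<in> {1, -1}" "chi0 C \<in> {1, -1}"
        using hom_carrier[OF h(1)] hom_carrier[OF h(2)] C by auto
      then show "tw chi C \<in> carrier mu2" using C unfolding tw_def by auto
    next
      fix C C' assume C: "C \<in> carrier Q" "C' \<in> carrier Q"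
      have "C \<otimes>\<^bsub>Q\<^esub> C' \<in> carrier Q" by (rule FQ.m_closed[OF C])
      then show "tw chi (C \<otimes>\<^bsub>Q\<^esub> C') = tw chi C \<otimes>\<^bsub>mu2\<^esub> tw chi C'"
        using C hom_mult[OF h(1) C] hom_mult[OF h(2) C]
        by (simp add: tw_def del: mult_FactGroup carrier_FactGroup)
    qed
    show "tw chi \<in> extensional (carrier Q)" by (simp add: tw_def)
  qed
  have twv: "inflate \<Gamma> (tw chi) b = inflate \<Gamma> chi b * f b" if "b \<in> A" for chi b
    using chi0(2)[OF that] that by (simp add: inflate_def tw_def carrier_Q)
  have sq: "f b * f b = 1" if "b \<in> A" for b
    using hom_carrier[OF fh] that by fastforce
  have "bij_betw tw Chars Chars"
  proof (rule bij_betw_byWitness[where f' = tw])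
    have "tw (tw chi) = chi" if "chi \<in> Chars" for chi
      by (rule quotient_character_eqI[OF tw_Chars[OF tw_Chars[OF that]] that]) (simp add: twv sq mult.assoc)
    then show "\<forall>chi\<in>Chars. tw (tw chi) = chi" "\<forall>chi\<in>Chars. tw (tw chi) = chi" by blast+
  qed (use tw_Chars in blast)+
  then have "(\<Sum>chi\<in>Chars. inflate \<Gamma> chi a) = (\<Sum>chi\<in>Chars. inflate \<Gamma> (tw chi) a)"
    by (rule sum.reindex_bij_betw[symmetric])
  also have "\<dots> = - (\<Sum>chi\<in>Chars. inflate \<Gamma> chi a)"
    by (simp add: twv[OF a] fa sum_negf)
  finally show ?thesis using False by simp
qed

definition embed :: "nat \<Rightarrow> (complex \<Rightarrow> complex) \<Rightarrow> nat \<Rightarrow> complex \<Rightarrow> complex" where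
  "embed p x = (\<lambda>q\<in>{q. prime q}. if q = p then x else \<one>\<^bsub>local_aut \<Gamma> q\<^esub>)"

lemma local_aut_one_closed: "\<one>\<^bsub>local_aut \<Gamma> p\<^esub> \<in> Ap p"
  by (rule monoid.one_closed[OF group.is_monoid[OF group_local_aut]])

lemma embed_in_A: "x \<in> Ap p \<Longrightarrow> embed p x \<in> A"
  unfolding A_iff embed_def by (auto simp: restrict_PiE_iff local_aut_one_closed)

lemma embed_mult:
  assumes "x \<in> Ap p" "y \<in> Ap p"
  shows "embed p (x \<otimes>\<^bsub>local_aut \<Gamma> p\<^esub> y) = embed p x \<cdot> embed p y"
  unfolding global_aut_def mult_product_group embed_def
  by (intro restrict_ext) (auto intro!: monoid.l_one[symmetric] group.is_monoid group_local_aut local_aut_one_closed)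

definition local_component :: "((nat \<Rightarrow> complex \<Rightarrow> complex) set \<Rightarrow> real) \<Rightarrow> nat \<Rightarrow> (complex \<Rightarrow> complex) \<Rightarrow> real" where
  "local_component chi = (\<lambda>p\<in>{p. prime p}. \<lambda>x\<in>Ap p. inflate \<Gamma> chi (embed p x))"

lemma character_decomposition_local_component:
  assumes chi: "chi \<in> Chars"
  shows "character_decomposition \<Gamma> (inflate \<Gamma> chi) (local_component chi)"
proof -
  obtain \<Phi> P D where \<Phi>: "\<Phi> \<subseteq> hom (global_aut \<Gamma>) mu2" "G = {a \<in> A. \<forall>f\<in>\<Phi>. f a = 1}"
     and P: "finite P" "\<forall>p\<in>P. prime p" and D: "\<forall>p. finite (D p) \<and> D p \<subseteq> Rp p"
     and agree: "\<forall>a\<in>A. \<forall>b\<in>A. agree P D a b \<longrightarrow> (\<forall>f\<in>\<Phi>. f a = f b)"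
    using galois_subgroup_characters by (elim exE conjE)
  interpret H: group "global_aut \<Gamma>" by (rule group_global_aut)
  note h = inflate_hom[OF chi]
  have infl: "inflate \<Gamma> chi a = inflate \<Gamma> chi b" if ab: "a \<in> A" "b \<in> A" "agree P D a b" for a b
  proof (rule inflate_eq[OF ab(1,2)])
    have "f (a \<cdot> ginv b) = 1" if f: "f \<in> \<Phi>" for f
    proof -
      have fh: "f \<in> hom (global_aut \<Gamma>) mu2" using f \<Phi>(1) by blast
      have "f a = f b" using agree ab f by blast
      moreover have "f b \<in> {1, -1}" using hom_carrier[OF fh] ab(2) by auto
      ultimately show ?thesis
        using hom_mult[OF fh ab(1) H.inv_closed[OF ab(2)]] hom_mu2_inv(1)[OF group_global_aut fh ab(2)] by auto
    qed
    then show "a \<cdot> ginv b \<in> G"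
      unfolding \<Phi>(2) using H.m_closed[OF ab(1) H.inv_closed[OF ab(2)]] by blast
  qed
  let ?\<psi> = "local_component chi"
  have \<psi>: "?\<psi> p x = inflate \<Gamma> chi (embed p x)" if "prime p" "x \<in> Ap p" for p x
    using that by (simp add: local_component_def)
  have val: "inflate \<Gamma> chi a \<in> {1, -1}" if "a \<in> A" for a using hom_carrier[OF h] that by auto
  have "?\<psi> p \<in> local_characters \<Gamma> p" if p: "prime p" for p
    unfolding local_characters_def
  proof (intro CollectI conjI IntI)
    show "?\<psi> p \<in> hom (local_aut \<Gamma> p) mu2"
    proof (rule homI)
      show "?\<psi> p x \<in> carrier mu2" if "x \<in> Ap p" for x
        using \<psi>[OF p that] val[OF embed_in_A[OF that]] by simp
      fix x y assume xy: "x \<in> Ap p" "y \<in> Ap p"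
      have "x \<otimes>\<^bsub>local_aut \<Gamma> p\<^esub> y \<in> Ap p"
        by (rule monoid.m_closed[OF group.is_monoid[OF group_local_aut] xy])
      then show "?\<psi> p (x \<otimes>\<^bsub>local_aut \<Gamma> p\<^esub> y) = ?\<psi> p x \<otimes>\<^bsub>mu2\<^esub> ?\<psi> p y"
        using hom_mult[OF h embed_in_A[OF xy(1)] embed_in_A[OF xy(2)]]
        by (simp add: \<psi>[OF p] xy embed_mult)
    qed
    show "?\<psi> p \<in> extensional (Ap p)" using p by (simp add: local_component_def)
    show "continuous_map (local_topology \<Gamma> p) (discrete_topology (carrier mu2)) (?\<psi> p)"
      unfolding continuous_map_def topspace_local_topology
    proof (intro conjI allI impI)
      show "?\<psi> p \<in> Ap p \<rightarrow> topspace (discrete_topology (carrier mu2))"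
        using \<psi>[OF p] val[OF embed_in_A] by auto
      fix U assume "openin (discrete_topology (carrier mu2)) U"
      show "openin (local_topology \<Gamma> p) {x \<in> Ap p. ?\<psi> p x \<in> U}"
      proof (subst openin_subopen, intro ballI)
        fix x assume x: "x \<in> {x \<in> Ap p. ?\<psi> p x \<in> U}"
        define N where "N = {y \<in> Ap p. \<forall>z\<in>D p. y z = x z}"
        have "openin (local_topology \<Gamma> p) N"
          unfolding N_def by (rule openin_local_topology_agree) (use D x in auto)
        moreover have "x \<in> N" using x by (simp add: N_def)
        moreover have "N \<subseteq> {x \<in> Ap p. ?\<psi> p x \<in> U}"
        proof
          fix y assume y: "y \<in> N"
          then have yc: "y \<in> Ap p" by (simp add: N_def)
          have xc: "x \<in> Ap p" using x by simp
          have "agree P D (embed p y) (embed p x)"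
            using y P(2) by (auto simp: agree_def embed_def N_def)
          then have "?\<psi> p y = ?\<psi> p x"
            unfolding \<psi>[OF p yc] \<psi>[OF p xc] by (intro infl embed_in_A yc xc)
          then show "y \<in> {x \<in> Ap p. ?\<psi> p x \<in> U}" using x yc by simp
        qed
        ultimately show "\<exists>T. openin (local_topology \<Gamma> p) T \<and> x \<in> T \<and> T \<subseteq> {x \<in> Ap p. ?\<psi> p x \<in> U}"
          by blast
      qed
    qed
  qed
  then have 1: "?\<psi> \<in> (\<Pi>\<^sub>E p\<in>{p. prime p}. local_characters \<Gamma> p)"
    by (auto simp: PiE_def local_component_def)
  define P' where "P' = {p. prime p \<and> (\<exists>a\<in>Ap p. ?\<psi> p a \<noteq> 1)}"
  have one: "inflate \<Gamma> chi \<one>\<^bsub>global_aut \<Gamma>\<^esub> = 1"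
    by (rule hom_mu2_inv(2)[OF group_global_aut h H.one_closed])
  have P'P: "P' \<subseteq> P"
  proof
    fix p assume "p \<in> P'"
    then obtain x where p: "prime p" and x: "x \<in> Ap p" "?\<psi> p x \<noteq> 1" by (auto simp: P'_def)
    show "p \<in> P"
    proof (rule ccontr)
      assume "p \<notin> P"
      then have "agree P D (embed p x) \<one>\<^bsub>global_aut \<Gamma>\<^esub>"
        using P(2) by (auto simp: agree_def embed_def global_aut_def)
      then have "?\<psi> p x = 1" unfolding \<psi>[OF p x(1)] one[symmetric] by (intro infl embed_in_A x H.one_closed)
      then show False using x(2) by simp
    qed
  qed
  have "inflate \<Gamma> chi a = (\<Prod>p\<in>P'. ?\<psi> p (a p))" if a: "a \<in> A" for a
  proof -
    define cut where "cut S = (\<lambda>q\<in>{q. prime q}. if q \<in> S then a q else \<one>\<^bsub>local_aut \<Gamma> q\<^esub>)" for S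
    have ac: "a p \<in> Ap p" if "prime p" for p using a that unfolding A_iff by blast
    have cutA: "cut S \<in> A" for S
      unfolding A_iff cut_def by (auto simp: restrict_PiE_iff local_aut_one_closed ac)
    have "inflate \<Gamma> chi (cut S) = (\<Prod>p\<in>S. ?\<psi> p (a p))" if "finite S" "S \<subseteq> P" for S
      using that
    proof (induction S rule: finite_induct)
      case empty
      have "cut {} = \<one>\<^bsub>global_aut \<Gamma>\<^esub>" by (simp add: cut_def global_aut_def)
      then show ?case using one by simp
    next
      case (insert p S)
      then have p: "prime p" using P(2) by blast
      have "cut (insert p S) = cut S \<cdot> embed p (a p)"
        unfolding global_aut_def mult_product_group cut_def embed_def
      proof (intro restrict_ext)
        fix q :: nat assume "q \<in> {q. prime q}"
        interpret L: group "local_aut \<Gamma> q" by (rule group_local_aut)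
        interpret Lp: group "local_aut \<Gamma> p" by (rule group_local_aut)
        have "a q \<in> Ap q" using ac \<open>q \<in> {q. prime q}\<close> by simp
        then show "(if q \<in> insert p S then a q else \<one>\<^bsub>local_aut \<Gamma> q\<^esub>) =
          (\<lambda>q\<in>{q. prime q}. if q \<in> S then a q else \<one>\<^bsub>local_aut \<Gamma> q\<^esub>) q \<otimes>\<^bsub>local_aut \<Gamma> q\<^esub>
          (\<lambda>q\<in>{q. prime q}. if q = p then a p else \<one>\<^bsub>local_aut \<Gamma> q\<^esub>) q"
          using insert.hyps(2) \<open>q \<in> {q. prime q}\<close> by auto
      qed
      then have "inflate \<Gamma> chi (cut (insert p S)) = inflate \<Gamma> chi (cut S) * ?\<psi> p (a p)"
        using hom_mult[OF h cutA embed_in_A[OF ac[OF p]]] by (simp add: \<psi>[OF p ac[OF p]])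
      then show ?case using insert by (simp add: mult.commute)
    qed
    then have "inflate \<Gamma> chi (cut P) = (\<Prod>p\<in>P. ?\<psi> p (a p))" using P(1) by blast
    moreover have "inflate \<Gamma> chi (cut P) = inflate \<Gamma> chi a"
      by (rule infl[OF cutA a]) (use P(2) in \<open>auto simp: agree_def cut_def\<close>)
    moreover have "(\<Prod>p\<in>P'. ?\<psi> p (a p)) = (\<Prod>p\<in>P. ?\<psi> p (a p))"
    proof (rule prod.mono_neutral_left[OF P(1) P'P])
      show "\<forall>p\<in>P - P'. ?\<psi> p (a p) = 1" using P(2) ac by (auto simp: P'_def)
    qed
    ultimately show ?thesis by simp
  qed
  then show ?thesis
    unfolding character_decomposition_def Let_def P'_def[symmetric]
    using 1 finite_subset[OF P'P P(1)] by blast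
qed

lemma character_decomposition_unique:
  assumes chi: "chi \<in> Chars" and \<psi>: "character_decomposition \<Gamma> (inflate \<Gamma> chi) \<psi>"
  shows "\<psi> = local_component chi"
proof (rule extensionalityI[of _ "{p. prime p}"])
  define P where "P = {p. prime p \<and> (\<exists>a\<in>Ap p. \<psi> p a \<noteq> 1)}"
  have d: "\<psi> \<in> (\<Pi>\<^sub>E p\<in>{p. prime p}. local_characters \<Gamma> p)" "finite P"
    "\<forall>a\<in>A. inflate \<Gamma> chi a = (\<Prod>p\<in>P. \<psi> p (a p))"
    using \<psi> unfolding character_decomposition_def Let_def P_def by blast+
  show "\<psi> \<in> extensional {p. prime p}" using d(1) by (simp add: PiE_def)
  show "local_component chi \<in> extensional {p. prime p}" by (simp add: local_component_def)
  have lc: "\<psi> p \<in> hom (local_aut \<Gamma> p) mu2" "\<psi> p \<in> extensional (Ap p)" if "prime p" for p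
    using PiE_mem[OF d(1), of p] that by (simp_all add: local_characters_def)
  fix p :: nat assume "p \<in> {p. prime p}"
  then have p: "prime p" by simp
  show "\<psi> p = local_component chi p"
  proof (rule extensionalityI[of _ "Ap p"])
    show "\<psi> p \<in> extensional (Ap p)" by (rule lc(2)[OF p])
    show "local_component chi p \<in> extensional (Ap p)"
      using p by (simp add: local_component_def)
    fix x assume x: "x \<in> Ap p"
    have o: "\<psi> q (embed p x q) = (if q = p then \<psi> p x else 1)" if "prime q" for q
      using hom_mu2_inv(2)[OF group_local_aut lc(1)[OF that] local_aut_one_closed] that by (simp add: embed_def)
    have "local_component chi p x = (\<Prod>q\<in>P. \<psi> q (embed p x q))"
      using d(3) embed_in_A[OF x] x p by (simp add: local_component_def)
    also have "\<dots> = (\<Prod>q\<in>P. if q = p then \<psi> p x else 1)"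
      using o by (intro prod.cong) (auto simp: P_def)
    also have "\<dots> = (if p \<in> P then \<psi> p x else 1)" using d(2) by simp
    also have "\<dots> = \<psi> p x" using x p by (auto simp: P_def)
    finally show "\<psi> p x = local_component chi p x" by simp
  qed
qed

lemma character_component_eq:
  assumes "chi \<in> Chars"
  shows "character_component \<Gamma> (inflate \<Gamma> chi) = local_component chi"
  unfolding character_component_def
  using character_decomposition_local_component[OF assms] character_decomposition_unique[OF assms]
  by (rule the_equality)

end

section \<open>Integrals over boxes in product spaces\<close>

lemma integral_prod_PiM:
  fixes f :: "'i \<Rightarrow> 'a \<Rightarrow> real"
  assumes M: "\<And>i. i \<in> I \<Longrightarrow> prob_space (M i)" and J: "finite J" "J \<subseteq> I"
    and f: "\<And>i. i \<in> J \<Longrightarrow> integrable (M i) (f i)"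
  shows "(\<integral>x. (\<Prod>i\<in>J. f i (x i)) \<partial>PiM I M) = (\<Prod>i\<in>J. \<integral>x. f i x \<partial>M i)"
proof -
  define N where "N i = (if i \<in> I then M i else return (count_space UNIV) undefined)" for i
  have N: "prob_space (N i)" for i
    using M by (auto simp: N_def intro: prob_space_return)
  interpret product_prob_space N I by (intro product_prob_spaceI N)
  have NM: "N i = M i" if "i \<in> I" for i using that by (simp add: N_def)
  have fN: "integrable (N i) (f i)" if "i \<in> J" for i using f[OF that] J(2) that NM[of i] by auto
  have "PiM I M = PiM I N" by (rule PiM_cong) (simp_all add: NM)
  then have "(\<integral>x. (\<Prod>i\<in>J. f i (x i)) \<partial>PiM I M) = (\<integral>x. (\<Prod>i\<in>J. f i (x i)) \<partial>PiM I N)" by simp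
  also have "\<dots> = (\<integral>x. (\<Prod>i\<in>J. f i (restrict x J i)) \<partial>PiM I N)"
    by (intro Bochner_Integration.integral_cong prod.cong) auto
  also have "\<dots> = (\<integral>x. (\<Prod>i\<in>J. f i (x i)) \<partial>distr (PiM I N) (PiM J N) (\<lambda>x. restrict x J))"
  proof (rule integral_distr[symmetric])
    show "(\<lambda>x. restrict x J) \<in> PiM I N \<rightarrow>\<^sub>M PiM J N" by (rule measurable_restrict_subset[OF J(2)])
    have "f i \<in> borel_measurable (N i)" if "i \<in> J" for i using fN[OF that] by simp
    then show "(\<lambda>x. \<Prod>i\<in>J. f i (x i)) \<in> borel_measurable (PiM J N)"
      by (intro borel_measurable_prod) (auto intro: measurable_compose[OF measurable_component_singleton])
  qed
  also have "\<dots> = (\<integral>x. (\<Prod>i\<in>J. f i (x i)) \<partial>PiM J N)"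
    unfolding distr_PiM_restrict_finite[OF J] ..
  also have "\<dots> = (\<Prod>i\<in>J. \<integral>x. f i x \<partial>N i)"
    by (rule product_integral_prod[OF J(1) fN])
  also have "\<dots> = (\<Prod>i\<in>J. \<integral>x. f i x \<partial>M i)"
    using J(2) by (intro prod.cong) (auto simp: NM)
  finally show ?thesis .
qed

lemma prob_space_PiM_on:
  assumes "\<And>i. i \<in> I \<Longrightarrow> prob_space (M i)"
  shows "prob_space (PiM I M)"
proof -
  define N where "N i = (if i \<in> I then M i else return (count_space UNIV) undefined)" for i
  have "prob_space (N i)" for i
    using assms by (auto simp: N_def intro: prob_space_return)
  then have "prob_space (PiM I N)" by (rule prob_space_PiM)
  moreover have "PiM I M = PiM I N" by (rule PiM_cong) (simp_all add: N_def)
  ultimately show ?thesis by simp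
qed

text \<open>As \<open>I\<close> may be infinite, the box is approximated by cylinders over finite sets \<open>J n\<close>, and the
  measures of the boxes appear as limits of finite products.\<close>

lemma integral_prod_box_PiM:
  fixes f :: "'i::countable \<Rightarrow> 'a \<Rightarrow> real"
  assumes M: "\<And>i. i \<in> I \<Longrightarrow> prob_space (M i)" and T: "finite T" "T \<subseteq> I"
    and S: "\<And>i. i \<in> I \<Longrightarrow> S i \<in> sets (M i)" "\<And>i. i \<in> I \<Longrightarrow> measure (M i) (S i) > 0"
    and f: "\<And>i. i \<in> T \<Longrightarrow> f i \<in> borel_measurable (M i)" "\<And>i x. i \<in> T \<Longrightarrow> x \<in> space (M i) \<Longrightarrow> \<bar>f i x\<bar> \<le> 1"
  shows "(\<integral>x. indicat_real (PiE I S) x * (\<Prod>i\<in>T. f i (x i)) \<partial>PiM I M) =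
    measure (PiM I M) (PiE I S) *
      (\<Prod>i\<in>T. (\<integral>x. indicat_real (S i) x * f i x \<partial>M i) / measure (M i) (S i))"
proof -
  define J where "J n = T \<union> {i \<in> I. to_nat i < n}" for n
  have J: "finite (J n)" "J n \<subseteq> I" "T \<subseteq> J n" for n
  proof -
    have "finite (to_nat -` {..<n} :: 'i set)" by (intro finite_vimageI) auto
    then have "finite {i \<in> I. to_nat i < n}" by (rule finite_subset[rotated]) auto
    then show "finite (J n)" using T(1) by (simp add: J_def)
  qed (use T(2) in \<open>auto simp: J_def\<close>)
  interpret PM: prob_space "PiM I M" by (rule prob_space_PiM_on[OF M])
  have lim: "(\<lambda>n. \<Prod>i\<in>J n. \<integral>x. indicat_real (S i) x * g i x \<partial>M i) \<longlonglongrightarrow>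
      (\<integral>x. indicat_real (PiE I S) x * (\<Prod>i\<in>T. g i (x i)) \<partial>PiM I M)"
    if g: "\<And>i. i \<in> I \<Longrightarrow> g i \<in> borel_measurable (M i)" "\<And>i x. i \<in> I \<Longrightarrow> x \<in> space (M i) \<Longrightarrow> \<bar>g i x\<bar> \<le> 1"
      "\<And>i x. i \<in> I - T \<Longrightarrow> g i x = 1"
    for g :: "'i \<Rightarrow> 'a \<Rightarrow> real"
  proof -
    define h where "h n x = (\<Prod>i\<in>J n. indicat_real (S i) (x i) * g i (x i))" for n x
    have int: "integrable (M i) (\<lambda>x. indicat_real (S i) x * g i x)" if "i \<in> I" for i
    proof -
      interpret prob_space "M i" by (rule M[OF that])
      have "AE x in M i. norm (indicat_real (S i) x * g i x) \<le> 1"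
        using g(2)[OF that] by (auto simp: indicator_def)
      then show ?thesis
        using g(1)[OF that] S(1)[OF that] by (intro integrable_const_bound[where B = 1]) auto
    qed
    have eq: "(\<Prod>i\<in>J n. \<integral>x. indicat_real (S i) x * g i x \<partial>M i) = (\<integral>x. h n x \<partial>PiM I M)" for n
      unfolding h_def using J(2)[of n] int
      by (intro integral_prod_PiM[OF M J(1,2), symmetric]) auto
    have meas: "h n \<in> borel_measurable (PiM I M)" for n
    proof -
      have "(\<lambda>x. indicat_real (S i) x * g i x) \<in> borel_measurable (M i)" if "i \<in> I" for i
        using int[OF that] by simp
      then show ?thesis unfolding h_def using J(2)[of n]
        by (intro borel_measurable_prod measurable_compose[OF measurable_component_singleton]) auto
    qed
    have "(\<lambda>n. \<integral>x. h n x \<partial>PiM I M) \<longlonglongrightarrow>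
      (\<integral>x. indicat_real (PiE I S) x * (\<Prod>i\<in>T. g i (x i)) \<partial>PiM I M)"
    proof (rule integral_dominated_convergence[where w = "\<lambda>_. 1"])
      have "PiE I S \<in> sets (PiM I M)" using S(1) by (intro sets_PiM_I_countable) auto
      moreover have "(\<lambda>x. g i (x i)) \<in> borel_measurable (PiM I M)" if "i \<in> T" for i
      proof -
        have "i \<in> I" using that T(2) by blast
        then show ?thesis
          using measurable_compose[OF measurable_component_singleton[OF \<open>i \<in> I\<close>], of "g i" M borel] g(1)
          by simp
      qed
      ultimately show "(\<lambda>x. indicat_real (PiE I S) x * (\<Prod>i\<in>T. g i (x i))) \<in> borel_measurable (PiM I M)"
        by (intro borel_measurable_times borel_measurable_prod) auto
      show "AE x in PiM I M. (\<lambda>n. h n x) \<longlonglongrightarrow> indicat_real (PiE I S) x * (\<Prod>i\<in>T. g i (x i))"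
      proof (rule AE_I2)
        fix x assume x: "x \<in> space (PiM I M)"
        have hn: "h n x = (\<Prod>i\<in>J n. indicat_real (S i) (x i)) * (\<Prod>i\<in>T. g i (x i))" for n
        proof -
          have "(\<Prod>i\<in>J n. g i (x i)) = (\<Prod>i\<in>T. g i (x i))"
            using J g(3) by (intro prod.mono_neutral_right) blast+
          then show ?thesis unfolding h_def by (simp add: prod.distrib)
        qed
        have "eventually (\<lambda>n. (\<Prod>i\<in>J n. indicat_real (S i) (x i)) = indicat_real (PiE I S) x) sequentially"
        proof (cases "x \<in> PiE I S")
          case True
          then have "(\<Prod>i\<in>J n. indicat_real (S i) (x i)) = 1" for n
            using J(2)[of n] by (intro prod.neutral ballI) (simp add: PiE_mem subset_iff)
          then show ?thesis using True by simp
        next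
          case False
          then obtain i where i: "i \<in> I" "x i \<notin> S i" using x by (auto simp: space_PiM PiE_def Pi_def)
          have "(\<Prod>i\<in>J n. indicat_real (S i) (x i)) = 0" if "n > to_nat i" for n
          proof (rule prod_zero[OF J(1)])
            show "\<exists>a\<in>J n. indicat_real (S a) (x a) = 0"
              using i that by (intro bexI[of _ i]) (auto simp: J_def)
          qed
          then show ?thesis using False unfolding eventually_sequentially
            by (intro exI[of _ "Suc (to_nat i)"]) auto
        qed
        then have "eventually (\<lambda>n. h n x = indicat_real (PiE I S) x * (\<Prod>i\<in>T. g i (x i))) sequentially"
          by eventually_elim (simp add: hn)
        then show "(\<lambda>n. h n x) \<longlonglongrightarrow> indicat_real (PiE I S) x * (\<Prod>i\<in>T. g i (x i))"
          by (rule tendsto_eventually)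
      qed
      show "AE x in PiM I M. norm (h n x) \<le> 1" for n
      proof (rule AE_I2)
        fix x assume x: "x \<in> space (PiM I M)"
        have xi: "x i \<in> space (M i)" if "i \<in> J n" for i
          using x J(2)[of n] that by (auto simp: space_PiM)
        have "norm (h n x) = (\<Prod>i\<in>J n. \<bar>indicat_real (S i) (x i) * g i (x i)\<bar>)"
          unfolding h_def by (simp add: abs_prod)
        also have "\<dots> \<le> 1"
          using g(2)[OF subsetD[OF J(2)] xi] by (intro prod_le_1) (auto simp: indicator_def)
        finally show "norm (h n x) \<le> 1" .
      qed
    qed (use meas in auto)
    then show ?thesis unfolding eq .
  qed
  define g where "g i = (if i \<in> T then f i else (\<lambda>_. 1))" for i
  have l1: "(\<lambda>n. \<Prod>i\<in>J n. \<integral>x. indicat_real (S i) x * g i x \<partial>M i) \<longlonglongrightarrow>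
      (\<integral>x. indicat_real (PiE I S) x * (\<Prod>i\<in>T. g i (x i)) \<partial>PiM I M)"
    by (rule lim) (use f in \<open>auto simp: g_def\<close>)
  have l2: "(\<lambda>n. \<Prod>i\<in>J n. \<integral>x. indicat_real (S i) x * 1 \<partial>M i) \<longlonglongrightarrow>
      (\<integral>x. indicat_real (PiE I S) x * (\<Prod>i\<in>T. 1) \<partial>PiM I M)"
    by (rule lim) auto
  have mS: "(\<integral>x. indicat_real (S i) x \<partial>M i) = measure (M i) (S i)" if "i \<in> I" for i
    using S(1)[OF that] sets.sets_into_space by (simp add: Int_absorb2)
  have "PiE I S \<in> sets (PiM I M)" using S(1) by (intro sets_PiM_I_countable) auto
  then have "(\<integral>x. indicat_real (PiE I S) x \<partial>PiM I M) = measure (PiM I M) (PiE I S)"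
    using sets.sets_into_space by (simp add: Int_absorb2)
  with l2 have l2: "(\<lambda>n. \<Prod>i\<in>J n. \<integral>x. indicat_real (S i) x \<partial>M i) \<longlonglongrightarrow> measure (PiM I M) (PiE I S)" by simp
  let ?c = "\<Prod>i\<in>T. (\<integral>x. indicat_real (S i) x * f i x \<partial>M i) / measure (M i) (S i)"
  have "(\<Prod>i\<in>J n. \<integral>x. indicat_real (S i) x * g i x \<partial>M i) = (\<Prod>i\<in>J n. \<integral>x. indicat_real (S i) x \<partial>M i) * ?c" for n
  proof -
    have "(\<Prod>i\<in>J n. \<integral>x. indicat_real (S i) x * g i x \<partial>M i) =
      (\<Prod>i\<in>J n. (\<integral>x. indicat_real (S i) x \<partial>M i) *
        (if i \<in> T then (\<integral>x. indicat_real (S i) x * f i x \<partial>M i) / measure (M i) (S i) else 1))"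
    proof (rule prod.cong[OF refl])
      fix i assume "i \<in> J n"
      then have i: "i \<in> I" using J(2) by blast
      have "measure (M i) (S i) \<noteq> 0" using S(2)[OF i] by simp
      then show "(\<integral>x. indicat_real (S i) x * g i x \<partial>M i) = (\<integral>x. indicat_real (S i) x \<partial>M i) *
        (if i \<in> T then (\<integral>x. indicat_real (S i) x * f i x \<partial>M i) / measure (M i) (S i) else 1)"
        using mS[OF i] by (cases "i \<in> T") (simp_all add: g_def)
    qed
    also have "\<dots> = (\<Prod>i\<in>J n. \<integral>x. indicat_real (S i) x \<partial>M i) *
        (\<Prod>i\<in>J n. if i \<in> T then (\<integral>x. indicat_real (S i) x * f i x \<partial>M i) / measure (M i) (S i) else 1)"
      by (rule prod.distrib)
    also have "(\<Prod>i\<in>J n. if i \<in> T then (\<integral>x. indicat_real (S i) x * f i x \<partial>M i) / measure (M i) (S i) else 1) = ?c"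
      using J by (intro prod.mono_neutral_cong_right) auto
    finally show ?thesis .
  qed
  then have "(\<lambda>n. \<Prod>i\<in>J n. \<integral>x. indicat_real (S i) x * g i x \<partial>M i) \<longlonglongrightarrow> measure (PiM I M) (PiE I S) * ?c"
    using tendsto_mult_right[OF l2] by simp
  from LIMSEQ_unique[OF l1 this] show ?thesis by (simp add: g_def cong: prod.cong)
qed

section \<open>The density formula\<close>

lemma normalized_haar_measure_facts:
  assumes "normalized_haar_measure H U \<nu>"
  shows "prob_space \<nu>" "space \<nu> = carrier H" "openin U W \<Longrightarrow> W \<in> sets \<nu>"
    "g \<in> carrier H \<Longrightarrow> openin U W \<Longrightarrow> openin U (g <#\<^bsub>H\<^esub> W) \<Longrightarrow>
      measure \<nu> (g <#\<^bsub>H\<^esub> W) = measure \<nu> W"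
proof -
  obtain \<mu> where \<mu>: "space \<mu> = carrier H" "sets \<mu> = sigma_sets (carrier H) {U'. openin U U'}"
    "emeasure \<mu> (carrier H) = 1" "\<forall>g\<in>carrier H. \<forall>B\<in>sets \<mu>. emeasure \<mu> (g <#\<^bsub>H\<^esub> B) = emeasure \<mu> B"
    "\<nu> = completion \<mu>"
    using assms unfolding normalized_haar_measure_def by blast
  have "prob_space \<mu>" by (rule prob_spaceI) (simp add: \<mu>(1,3))
  then show "prob_space \<nu>" unfolding \<mu>(5) by (rule prob_space.prob_space_completion)
  show "space \<nu> = carrier H" by (simp add: \<mu>(1,5))
  have op: "W \<in> sets \<mu>" if "openin U W" for W unfolding \<mu>(2) using that by blast
  show "openin U W \<Longrightarrow> W \<in> sets \<nu>" using op unfolding \<mu>(5) by blast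
  show "measure \<nu> (g <#\<^bsub>H\<^esub> W) = measure \<nu> W" if "g \<in> carrier H" "openin U W" "openin U (g <#\<^bsub>H\<^esub> W)"
    using \<mu>(4) that op[OF that(2)] op[OF that(3)] unfolding \<mu>(5) measure_def by simp
qed

context rational_group
begin

lemma local_character_facts:
  assumes haar: "normalized_haar_measure (local_aut \<Gamma> p) (local_topology \<Gamma> p) \<nu>"
    and \<psi>: "\<psi> \<in> local_characters \<Gamma> p"
  shows "\<psi> \<in> borel_measurable \<nu>" "x \<in> space \<nu> \<Longrightarrow> \<psi> x \<in> {1, -1}"
    "\<exists>a\<in>Ap p. \<psi> a \<noteq> 1 \<Longrightarrow> (\<integral>x. \<psi> x \<partial>\<nu>) = 0"
proof -
  note H = normalized_haar_measure_facts[OF haar]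
  interpret prob_space \<nu> by (rule H(1))
  interpret L: group "local_aut \<Gamma> p" by (rule group_local_aut)
  have hom: "\<psi> \<in> hom (local_aut \<Gamma> p) mu2"
    and cont: "continuous_map (local_topology \<Gamma> p) (discrete_topology (carrier mu2)) \<psi>"
    using \<psi> by (auto simp: local_characters_def)
  have val: "\<psi> x \<in> {1, -1}" if "x \<in> Ap p" for x
    using hom_carrier[OF hom] that by auto
  then show "x \<in> space \<nu> \<Longrightarrow> \<psi> x \<in> {1, -1}" by (simp only: H(2))
  define W where "W c = {x \<in> Ap p. \<psi> x = c}" for c
  have op: "openin (local_topology \<Gamma> p) (W c)" if "c \<in> {1, -1}" for c
  proof -
    have "openin (local_topology \<Gamma> p) {x \<in> topspace (local_topology \<Gamma> p). \<psi> x \<in> {c}}"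
      by (rule openin_continuous_map_preimage[OF cont]) (use that in auto)
    then show ?thesis by (simp add: W_def topspace_local_topology)
  qed
  have W: "W 1 \<in> sets \<nu>" "W (-1) \<in> sets \<nu>" using H(3) op by simp_all
  have eq: "\<psi> x = indicat_real (W 1) x - indicat_real (W (-1)) x" if "x \<in> space \<nu>" for x
    using val[of x] that unfolding H(2) by (auto simp: W_def indicator_def)
  have "(\<lambda>x. indicat_real (W 1) x - indicat_real (W (-1)) x) \<in> borel_measurable \<nu>" using W by simp
  moreover have "\<psi> \<in> borel_measurable \<nu> \<longleftrightarrow> (\<lambda>x. indicat_real (W 1) x - indicat_real (W (-1)) x) \<in> borel_measurable \<nu>"
    by (rule measurable_cong) (rule eq)
  ultimately show "\<psi> \<in> borel_measurable \<nu>" by blast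
  assume "\<exists>a\<in>Ap p. \<psi> a \<noteq> 1"
  then obtain g where g: "g \<in> Ap p" "\<psi> g = -1" using val by blast
  have inv: "\<psi> (inv\<^bsub>local_aut \<Gamma> p\<^esub> g) = -1"
    using g(2) hom_mult[OF hom L.inv_closed[OF g(1)] g(1)] L.l_inv[OF g(1)]
      hom_mult[OF hom L.one_closed L.one_closed] val[OF L.one_closed] by auto
  have "g <#\<^bsub>local_aut \<Gamma> p\<^esub> W 1 = W (-1)"
  proof (intro equalityI subsetI)
    fix y assume "y \<in> g <#\<^bsub>local_aut \<Gamma> p\<^esub> W 1"
    then obtain h where h: "h \<in> W 1" "y = g \<otimes>\<^bsub>local_aut \<Gamma> p\<^esub> h" by (auto simp: l_coset_def)
    then show "y \<in> W (-1)" using g hom_mult[OF hom g(1), of h] by (simp add: W_def)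
  next
    fix y assume y: "y \<in> W (-1)"
    then have yc: "y \<in> Ap p" "\<psi> y = -1" by (auto simp: W_def)
    have "inv\<^bsub>local_aut \<Gamma> p\<^esub> g \<otimes>\<^bsub>local_aut \<Gamma> p\<^esub> y \<in> W 1"
      using hom_mult[OF hom L.inv_closed[OF g(1)] yc(1)] inv yc g(1) by (simp add: W_def)
    moreover have "y = g \<otimes>\<^bsub>local_aut \<Gamma> p\<^esub> (inv\<^bsub>local_aut \<Gamma> p\<^esub> g \<otimes>\<^bsub>local_aut \<Gamma> p\<^esub> y)"
      using g(1) yc(1) by (simp add: L.m_assoc[symmetric])
    ultimately show "y \<in> g <#\<^bsub>local_aut \<Gamma> p\<^esub> W 1" unfolding l_coset_def by blast
  qed
  then have "measure \<nu> (W (-1)) = measure \<nu> (W 1)"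
    using H(4)[OF g(1) op[of 1]] op[of "-1"] by simp
  moreover have "(\<integral>x. \<psi> x \<partial>\<nu>) = (\<integral>x. indicat_real (W 1) x - indicat_real (W (-1)) x \<partial>\<nu>)"
    by (rule Bochner_Integration.integral_cong[OF refl eq])
  moreover have "\<dots> = measure \<nu> (W 1) - measure \<nu> (W (-1))"
    using W sets.sets_into_space[OF W(1)] sets.sets_into_space[OF W(2)]
    by (subst Bochner_Integration.integral_diff) (auto simp: Int_absorb2 emeasure_eq_measure)
  ultimately show "(\<integral>x. \<psi> x \<partial>\<nu>) = 0" by simp
qed

end

context fg_rational_group
begin

definition ramified :: "((nat \<Rightarrow> complex \<Rightarrow> complex) set \<Rightarrow> real) \<Rightarrow> nat set" where
  "ramified chi = {p. prime p \<and> (\<exists>a\<in>Ap p. local_component chi p a \<noteq> 1)}"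

lemma local_component_facts:
  assumes "chi \<in> Chars"
  shows "finite (ramified chi)" "prime p \<Longrightarrow> local_component chi p \<in> local_characters \<Gamma> p"
    "a \<in> A \<Longrightarrow> inflate \<Gamma> chi a = (\<Prod>p\<in>ramified chi. local_component chi p (a p))"
proof -
  note d = character_decomposition_local_component[OF assms,
      unfolded character_decomposition_def Let_def, folded ramified_def]
  show "finite (ramified chi)" using d by blast
  show "prime p \<Longrightarrow> local_component chi p \<in> local_characters \<Gamma> p" using d by (blast dest: PiE_mem)
  show "a \<in> A \<Longrightarrow> inflate \<Gamma> chi a = (\<Prod>p\<in>ramified chi. local_component chi p (a p))" using d by blast
qed

lemma ramified_prime: "p \<in> ramified chi \<Longrightarrow> prime p"
  by (simp add: ramified_def)

lemma galois_box_measure: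
  fixes S :: "nat \<Rightarrow> (complex \<Rightarrow> complex) set"
  assumes haar: "\<And>p. prime p \<Longrightarrow> normalized_haar_measure (local_aut \<Gamma> p) (local_topology \<Gamma> p) (\<nu> p)"
    and S: "\<And>p. prime p \<Longrightarrow> S p \<in> sets (\<nu> p)" "\<And>p. prime p \<Longrightarrow> measure (\<nu> p) (S p) > 0"
  defines "N \<equiv> PiM {p. prime p} \<nu>" and "Box \<equiv> PiE {p. prime p} S"
  shows "of_nat (card Chars) * measure N (G \<inter> Box) = (\<Sum>chi\<in>Chars. measure N Box *
    (\<Prod>p\<in>ramified chi. (\<integral>x. indicat_real (S p) x * local_component chi p x \<partial>\<nu> p) / measure (\<nu> p) (S p)))"
    (is "_ = (\<Sum>chi\<in>Chars. ?V chi)")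
proof -
  let ?I = "{p :: nat. prime p}"
  have prob: "prob_space (\<nu> p)" if "p \<in> ?I" for p using normalized_haar_measure_facts(1)[OF haar] that by blast
  interpret N: prob_space N unfolding N_def by (rule prob_space_PiM_on[OF prob])
  have spaceN: "space N = A"
    unfolding N_def space_PiM
    by (rule Set.set_eqI, unfold A_iff) (simp add: PiE_iff normalized_haar_measure_facts(2)[OF haar])
  have Box: "Box \<in> sets N" unfolding N_def Box_def using S(1) by (intro sets_PiM_I_countable) auto
  have F: "(\<integral>x. indicat_real Box x * inflate \<Gamma> chi x \<partial>N) = ?V chi"
    "integrable N (\<lambda>x. indicat_real Box x * inflate \<Gamma> chi x)" if chi: "chi \<in> Chars" for chi
  proof -
    note L = local_component_facts[OF chi]
    have meas: "local_component chi p \<in> borel_measurable (\<nu> p)" if "p \<in> ramified chi" for p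
      using local_character_facts(1)[OF haar L(2)] ramified_prime[OF that] by blast
    have bound: "\<bar>local_component chi p x\<bar> \<le> 1" if "p \<in> ramified chi" "x \<in> space (\<nu> p)" for p x
      using local_character_facts(2)[OF haar[OF ramified_prime[OF that(1)]] L(2)[OF ramified_prime[OF that(1)]] that(2)]
      by auto
    have eq: "indicat_real Box x * inflate \<Gamma> chi x = indicat_real Box x * (\<Prod>p\<in>ramified chi. local_component chi p (x p))"
      if "x \<in> space N" for x using L(3)[of x] that spaceN by simp
    have "(\<integral>x. indicat_real Box x * inflate \<Gamma> chi x \<partial>N) =
      (\<integral>x. indicat_real Box x * (\<Prod>p\<in>ramified chi. local_component chi p (x p)) \<partial>N)"
      by (rule Bochner_Integration.integral_cong[OF refl eq])
    also have "\<dots> = ?V chi"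
      unfolding N_def Box_def
      by (rule integral_prod_box_PiM[OF prob L(1) _ _ _ meas bound]) (use S ramified_prime in auto)
    finally show "(\<integral>x. indicat_real Box x * inflate \<Gamma> chi x \<partial>N) = ?V chi" .
    have "(\<lambda>x. local_component chi p (x p)) \<in> borel_measurable N" if p: "p \<in> ramified chi" for p
    proof -
      have "p \<in> ?I" using ramified_prime[OF p] by simp
      then show ?thesis unfolding N_def
        using measurable_compose[OF measurable_component_singleton[of p ?I \<nu>] meas[OF p]] by simp
    qed
    then have "(\<lambda>x. indicat_real Box x * (\<Prod>p\<in>ramified chi. local_component chi p (x p))) \<in> borel_measurable N"
      using Box by (intro borel_measurable_times borel_measurable_prod) auto
    moreover have "(\<lambda>x. indicat_real Box x * inflate \<Gamma> chi x) \<in> borel_measurable N \<longleftrightarrow>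
        (\<lambda>x. indicat_real Box x * (\<Prod>p\<in>ramified chi. local_component chi p (x p))) \<in> borel_measurable N"
      by (rule measurable_cong) (rule eq)
    ultimately have m: "(\<lambda>x. indicat_real Box x * inflate \<Gamma> chi x) \<in> borel_measurable N" by blast
    have "\<bar>inflate \<Gamma> chi x\<bar> = 1" if "x \<in> space N" for x
      using hom_carrier[OF inflate_hom[OF chi]] that spaceN by fastforce
    then show "integrable N (\<lambda>x. indicat_real Box x * inflate \<Gamma> chi x)"
      using m by (intro N.integrable_const_bound[where B = 1] AE_I2) (auto simp: indicator_def)
  qed
  have card0: "card Chars > 0" using finite_Chars trivial_character_in_Chars by (auto simp: card_gt_0_iff)
  have ind: "(\<Sum>chi\<in>Chars. indicat_real Box x * inflate \<Gamma> chi x) = of_nat (card Chars) * indicat_real (G \<inter> Box) x"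
    if "x \<in> space N" for x
    unfolding sum_distrib_left[symmetric] using sum_inflate[of x] that spaceN by (auto simp: indicator_def)
  have int: "integrable N (\<lambda>x. \<Sum>chi\<in>Chars. indicat_real Box x * inflate \<Gamma> chi x)"
    using F(2) by (rule Bochner_Integration.integrable_sum)
  have "G \<subseteq> A" by (auto simp: galois_subgroup_iff)
  have "G \<inter> Box = (\<lambda>x. \<Sum>chi\<in>Chars. indicat_real Box x * inflate \<Gamma> chi x) -` {of_nat (card Chars)} \<inter> space N"
  proof (intro equalityI subsetI)
    fix x assume x: "x \<in> G \<inter> Box"
    then have "x \<in> space N" using \<open>G \<subseteq> A\<close> spaceN by blast
    then show "x \<in> (\<lambda>x. \<Sum>chi\<in>Chars. indicat_real Box x * inflate \<Gamma> chi x) -` {of_nat (card Chars)} \<inter> space N"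
      using ind[of x] x by simp
  next
    fix x assume x: "x \<in> (\<lambda>x. \<Sum>chi\<in>Chars. indicat_real Box x * inflate \<Gamma> chi x) -` {of_nat (card Chars)} \<inter> space N"
    then have "of_nat (card Chars) * indicat_real (G \<inter> Box) x = of_nat (card Chars)" using ind[of x] by auto
    then show "x \<in> G \<inter> Box" using card0 by (simp add: indicator_def split: if_splits)
  qed
  then have GB: "G \<inter> Box \<in> sets N"
    using borel_measurable_integrable[OF int] by (simp add: measurable_sets)
  have "of_nat (card Chars) * measure N (G \<inter> Box) = (\<integral>x. of_nat (card Chars) * indicat_real (G \<inter> Box) x \<partial>N)"
    using GB sets.sets_into_space[OF GB] by (simp add: Int_absorb2)
  also have "\<dots> = (\<integral>x. (\<Sum>chi\<in>Chars. indicat_real Box x * inflate \<Gamma> chi x) \<partial>N)"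
    by (rule Bochner_Integration.integral_cong[OF refl ind[symmetric]])
  also have "\<dots> = (\<Sum>chi\<in>Chars. ?V chi)"
    using F by (subst Bochner_Integration.integral_sum) auto
  finally show ?thesis .
qed

lemma galois_measure:
  assumes haar: "\<And>p. prime p \<Longrightarrow> normalized_haar_measure (local_aut \<Gamma> p) (local_topology \<Gamma> p) (\<nu> p)"
  shows "of_nat (card Chars) * measure (PiM {p. prime p} \<nu>) G = 1"
    and "measure (PiM {p. prime p} \<nu>) A = 1"
proof -
  let ?N = "PiM {p. prime p} \<nu>"
  have prob: "prob_space (\<nu> p)" if "prime p" for p using normalized_haar_measure_facts(1)[OF haar[OF that]] .
  interpret N: prob_space ?N using prob by (intro prob_space_PiM_on) simp
  have box: "PiE {p. prime p} (\<lambda>p. space (\<nu> p)) = A"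
    by (rule Set.set_eqI, unfold A_iff) (simp add: PiE_iff normalized_haar_measure_facts(2)[OF haar])
  then have "space ?N = A" by (simp add: space_PiM)
  then show A1: "measure ?N A = 1" using N.prob_space by simp
  have GA: "G \<inter> A = G" by (auto simp: galois_subgroup_iff)
  have V: "(\<Prod>p\<in>ramified chi. (\<integral>x. indicat_real (space (\<nu> p)) x * local_component chi p x \<partial>\<nu> p) / measure (\<nu> p) (space (\<nu> p))) =
      (if chi = (\<lambda>C\<in>carrier Q. 1) then 1 else 0)" (is "?P = _") if chi: "chi \<in> Chars" for chi
  proof (cases "ramified chi = {}")
    case True
    then have 1: "inflate \<Gamma> chi a = 1" if "a \<in> A" for a using local_component_facts(3)[OF chi that] by simp
    have "chi = (\<lambda>C\<in>carrier Q. 1)"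
    proof (rule quotient_character_eqI[OF chi trivial_character_in_Chars])
      fix a assume "a \<in> A"
      then show "inflate \<Gamma> chi a = inflate \<Gamma> (\<lambda>C\<in>carrier Q. 1) a"
        using 1 unfolding inflate_def by (auto simp: carrier_Q)
    qed
    then show ?thesis using True by simp
  next
    case False
    then obtain p where p: "p \<in> ramified chi" by blast
    note pp = ramified_prime[OF p]
    have "(\<integral>x. indicat_real (space (\<nu> p)) x * local_component chi p x \<partial>\<nu> p) = (\<integral>x. local_component chi p x \<partial>\<nu> p)"
      by (rule Bochner_Integration.integral_cong) auto
    also have "\<dots> = 0"
      by (rule local_character_facts(3)[OF haar[OF pp] local_component_facts(2)[OF chi pp]])
        (use p in \<open>simp add: ramified_def\<close>)
    finally have "?P = 0" using p local_component_facts(1)[OF chi] by (intro prod_zero bexI[of _ p]) auto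
    moreover have "chi \<noteq> (\<lambda>C\<in>carrier Q. 1)"
    proof
      assume triv: "chi = (\<lambda>C\<in>carrier Q. 1)"
      obtain a where a: "a \<in> Ap p" "local_component chi p a \<noteq> 1"
        using p by (auto simp: ramified_def)
      have "inflate \<Gamma> chi (embed p a) = 1"
        unfolding inflate_def triv using embed_in_A[OF a(1)] by (auto simp: carrier_Q)
      then show False using a pp by (simp add: local_component_def)
    qed
    ultimately show ?thesis by simp
  qed
  have "of_nat (card Chars) * measure ?N (G \<inter> PiE {p. prime p} (\<lambda>p. space (\<nu> p))) =
    (\<Sum>chi\<in>Chars. measure ?N (PiE {p. prime p} (\<lambda>p. space (\<nu> p))) * (if chi = (\<lambda>C\<in>carrier Q. 1) then 1 else 0))"
    using galois_box_measure[of \<nu> "\<lambda>p. space (\<nu> p)", OF haar] V prob_space.prob_space[OF prob]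
    by (simp cong: sum.cong)
  also have "\<dots> = 1"
    unfolding box A1 using finite_Chars trivial_character_in_Chars by simp
  finally show "of_nat (card Chars) * measure ?N G = 1" unfolding box GA .
qed

theorem density_formula:
  fixes S :: "nat \<Rightarrow> (complex \<Rightarrow> complex) set"
  assumes haar: "\<And>p. prime p \<Longrightarrow> normalized_haar_measure (local_aut \<Gamma> p) (local_topology \<Gamma> p) (\<nu> p)"
    and S: "\<And>p. prime p \<Longrightarrow> S p \<in> sets (\<nu> p)" "\<And>p. prime p \<Longrightarrow> measure (\<nu> p) (S p) > 0"
  defines "N \<equiv> PiM {p. prime p} \<nu>" and "Box \<equiv> PiE {p. prime p} S"
  shows "measure N (G \<inter> Box) / measure N G = correction_factor \<Gamma> \<nu> S * (measure N Box / measure N A)"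
proof -
  let ?E = "\<lambda>chi p. (\<integral>x. indicat_real (S p) x * local_component chi p x \<partial>\<nu> p) / measure (\<nu> p) (S p)"
  have avg: "local_average \<Gamma> \<nu> S chi p = ?E chi p" if "chi \<in> Chars" for chi p
    unfolding local_average_def character_component_eq[OF that] set_lebesgue_integral_def by simp
  have one: "?E chi p = 1" if "chi \<in> Chars" "prime p" "p \<notin> ramified chi" for chi p
  proof -
    have "(\<integral>x. indicat_real (S p) x * local_component chi p x \<partial>\<nu> p) = (\<integral>x. indicat_real (S p) x \<partial>\<nu> p)"
    proof (rule Bochner_Integration.integral_cong[OF refl])
      fix x assume "x \<in> space (\<nu> p)"
      then have "x \<in> Ap p" using normalized_haar_measure_facts(2)[OF haar[OF that(2)]] by simp
      then have "local_component chi p x = 1" using that(2,3) by (auto simp: ramified_def)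
      then show "indicat_real (S p) x * local_component chi p x = indicat_real (S p) x" by simp
    qed
    also have "\<dots> = measure (\<nu> p) (S p)"
      using sets.sets_into_space[OF S(1)[OF that(2)]] S(1)[OF that(2)] by (simp add: Int_absorb2)
    finally show ?thesis using S(2)[OF that(2)] by simp
  qed
  have prod: "(\<Prod>p | prime p \<and> local_average \<Gamma> \<nu> S chi p \<noteq> 1. local_average \<Gamma> \<nu> S chi p) =
      (\<Prod>p\<in>ramified chi. ?E chi p)" if chi: "chi \<in> Chars" for chi
    unfolding avg[OF chi]
  proof (rule prod.mono_neutral_left)
    show "finite (ramified chi)" by (rule local_component_facts(1)[OF chi])
    show "{p. prime p \<and> ?E chi p \<noteq> 1} \<subseteq> ramified chi" using one[OF chi] by blast
    show "\<forall>p\<in>ramified chi - {p. prime p \<and> ?E chi p \<noteq> 1}. ?E chi p = 1" using ramified_prime by blast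
  qed
  have "correction_factor \<Gamma> \<nu> S = (\<Sum>chi\<in>Chars. \<Prod>p\<in>ramified chi. ?E chi p)"
    unfolding correction_factor_def by (rule sum.cong[OF refl prod])
  then have "correction_factor \<Gamma> \<nu> S * measure N Box = (\<Sum>chi\<in>Chars. measure N Box * (\<Prod>p\<in>ramified chi. ?E chi p))"
    by (simp only: sum_distrib_left mult.commute[of _ "measure N Box"])
  also have "\<dots> = of_nat (card Chars) * measure N (G \<inter> Box)"
    unfolding N_def Box_def by (rule galois_box_measure[OF haar S, symmetric])
  finally have "correction_factor \<Gamma> \<nu> S * measure N Box = of_nat (card Chars) * measure N (G \<inter> Box)" .
  moreover have c: "of_nat (card Chars) * measure N G = 1" "measure N A = 1"
    unfolding N_def by (rule galois_measure[OF haar], assumption)+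
  moreover have "measure N G \<noteq> 0" using c(1) by auto
  ultimately have "measure N (G \<inter> Box) = correction_factor \<Gamma> \<nu> S * measure N Box * measure N G"
    by (simp add: mult.commute mult.left_commute)
  then show ?thesis using \<open>measure N G \<noteq> 0\<close> c(2) by simp
qed

end

lemma fg_rational_groupI:
  assumes "subgroup \<Gamma> complex_units" "\<Gamma> \<subseteq> \<rat>" "\<exists>F. finite F \<and> F \<subseteq> \<Gamma> \<and> \<Gamma> = generate complex_units F"
  shows "fg_rational_group \<Gamma>"
proof
  interpret U: group complex_units
    by (rule field.field_mult_group[OF field_from_type_algebra])
  interpret S: subgroup \<Gamma> complex_units by (rule assms(1))
  show z: "0 \<notin> \<Gamma>" using S.subset by (auto simp: complex_field_ops)
  show "1 \<in> \<Gamma>" using S.one_closed by (simp add: complex_field_ops)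
  show "x * y \<in> \<Gamma>" if "x \<in> \<Gamma>" "y \<in> \<Gamma>" for x y using S.m_closed[OF that] by (simp add: complex_field_ops)
  show "inverse x \<in> \<Gamma>" if x: "x \<in> \<Gamma>" for x
  proof -
    have "x \<noteq> 0" using x z by blast
    then have "inv\<^bsub>complex_units\<^esub> x = inverse x"
      using U.inv_equality[of "inverse x" x] by (simp add: complex_field_ops)
    then show ?thesis using S.m_inv_closed[OF x] by simp
  qed
qed (fact assms)+

theorem theorem3p2:
  fixes \<Gamma> :: "complex set"
    and \<nu>\<^sub>p :: "nat \<Rightarrow> (complex \<Rightarrow> complex) measure"
    and S\<^sub>p :: "nat \<Rightarrow> (complex \<Rightarrow> complex) set"
  assumes "subgroup \<Gamma> complex_units" and "\<Gamma> \<subseteq> \<rat>"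
    and "\<exists>F. finite F \<and> F \<subseteq> \<Gamma> \<and> \<Gamma> = generate complex_units F"
    and "\<And>p. prime p \<Longrightarrow>
           normalized_haar_measure (local_aut \<Gamma> p) (local_topology \<Gamma> p) (\<nu>\<^sub>p p)"
    and "\<And>p. prime p \<Longrightarrow> S\<^sub>p p \<in> sets (\<nu>\<^sub>p p)"
    and "\<And>p. prime p \<Longrightarrow> measure (\<nu>\<^sub>p p) (S\<^sub>p p) > 0"
  shows "let A = carrier (global_aut \<Gamma>);
             G = galois_subgroup \<Gamma>;
             \<nu> = (\<Pi>\<^sub>M p\<in>{p. prime p}. \<nu>\<^sub>p p);
             S = (\<Pi>\<^sub>E p\<in>{p. prime p}. S\<^sub>p p)
         in relative_density \<nu> G S = measure \<nu> (G \<inter> S) / measure \<nu> G \<and>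
            measure \<nu> (G \<inter> S) / measure \<nu> G =
              correction_factor \<Gamma> \<nu>\<^sub>p S\<^sub>p * (measure \<nu> S / measure \<nu> A)"
proof -
  interpret fg_rational_group \<Gamma> by (rule fg_rational_groupI[OF assms(1-3)])
  show ?thesis
    unfolding Let_def relative_density_def using density_formula[OF assms(4-6)] by simp
qed

end
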